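(* For every $g \in L^2(\mathbb{R}^n)$ and every $\beta>0$, the regularized solution $$u_\beta = \underset{u \in L^2(\mathbb{R}^n)}{\mathrm{argmin}} \ \|Au-g\|_{L^2}^2 + \|(I-C_\beta)u\|_{L^2}^2$$ is well defined (the minimizer exists and is unique) and is characterized by the equation $$[A^*A + (I-C_\beta)^*(I-C_\beta)]\,u_\beta = A^*g .$$ Moreover, the mapping $R_\beta : L^2(\mathbb{R}^n)\to L^2(\mathbb{R}^n)$, $g\mapsto u_\beta$, is linear and bounded, and $$\forall u \in L^2(\mathbb{R}^n),\qquad R_\beta A u \to u \ \text{ in } L^2(\mathbb{R}^n) \ \text{ as } \beta\downarrow 0 .$$ That is, $(R_\beta)_{\beta>0}$ defines a regularization method for the equation $Au=g$.
   Context: Let $n\in\mathbb{N}$, $T>0$, $\tau\in(0,1]$, and let $\gamma:(0,T)\to(0,\infty)$ be integrable. The Fourier transform is $\hat f(\xi)=\mathcal{F}(f)(\xi)=\int_{\mathbb{R}^n} f(x)e^{-2\pi i x\cdot\xi}\,dx$ (extended to $L^2(\mathbb{R}^n)$). Put $\psi(\xi)=\exp\left(-|2\pi\xi|^{2\tau}\int_0^T\gamma(\lambda)\,d\lambda\right)$ and let $A:L^2(\mathbb{R}^n)\to L^2(\mathbb{R}^n)$ be the bounded operator $Af=\mathcal{F}^{-1}(\psi\hat f)$. Let $\phi\in L^1(\mathbb{R}^n)$ be a smooth real-valued function with $\int_{\mathbb{R}^n}\phi(x)\,dx=1$. For $\beta>0$ let $\phi_\beta(x)=\beta^{-n}\phi(x/\beta)$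 and let $C_\beta:L^2(\mathbb{R}^n)\to L^2(\mathbb{R}^n)$ be $C_\beta f=\phi_\beta\star f$ (convolution). $I$ is the identity operator on $L^2(\mathbb{R}^n)$. Here "regularization method for $Au=g$" means precisely that the operators $R_\beta$ are bounded and $R_\beta A u\to u$ for all $u$ as $\beta\downarrow0$. *)

theory Defs
  imports "HOL-Analysis.Analysis"
begin

definition square_integrable :: "(real ^ 'n \<Rightarrow> complex) \<Rightarrow> bool" where
  "square_integrable f \<longleftrightarrow>
     f \<in> borel_measurable lborel \<and> integrable lborel (\<lambda>x. (cmod (f x))\<^sup>2)"

lemma square_integrable_zero: "square_integrable (\<lambda>x. 0)"
  by (simp add: square_integrable_def)

lemma square_integrable_cmult:
  assumes "square_integrable f"
  shows "square_integrable (\<lambda>x. c * f x)"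
  using assms by (auto simp: square_integrable_def norm_mult power_mult_distrib)

lemma square_integrable_add:
  assumes f: "square_integrable f" and g: "square_integrable g"
  shows "square_integrable (\<lambda>x. f x + g x)"
proof -
  have le: "(cmod (a + b))\<^sup>2 \<le> 2 * (cmod a)\<^sup>2 + 2 * (cmod b)\<^sup>2" for a b
  proof -
    have "(cmod (a + b))\<^sup>2 \<le> (cmod a + cmod b)\<^sup>2"
      by (simp add: norm_triangle_ineq power_mono)
    also have "\<dots> \<le> 2 * (cmod a)\<^sup>2 + 2 * (cmod b)\<^sup>2"
      using zero_le_power2[of "cmod a - cmod b"] by (simp add: power2_sum power2_diff)
    finally show ?thesis .
  qed
  have "integrable lborel (\<lambda>x. (cmod (f x + g x))\<^sup>2)"
  proof (rule Bochner_Integration.integrable_bound)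
    show "integrable lborel (\<lambda>x. 2 * (cmod (f x))\<^sup>2 + 2 * (cmod (g x))\<^sup>2)"
      using f g by (simp add: square_integrable_def)
    have [measurable]: "f \<in> borel_measurable lborel" "g \<in> borel_measurable lborel"
      using f g by (simp_all add: square_integrable_def)
    show "(\<lambda>x. (cmod (f x + g x))\<^sup>2) \<in> borel_measurable lborel"
      by measurable
    show "AE x in lborel. norm ((cmod (f x + g x))\<^sup>2)
            \<le> norm (2 * (cmod (f x))\<^sup>2 + 2 * (cmod (g x))\<^sup>2)"
      by (rule AE_I2) (use le in simp)
  qed
  moreover have "(\<lambda>x. f x + g x) \<in> borel_measurable lborel"
    using f g unfolding square_integrable_def by (intro borel_measurable_add) auto
  ultimately show ?thesis
    by (simp only: square_integrable_def)
qed

lemma square_integrable_uminus: "square_integrable f \<Longrightarrow> square_integrable (\<lambda>x. - f x)"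
  using square_integrable_cmult[of f "- 1"] by simp

lemma square_integrable_diff:
  "square_integrable f \<Longrightarrow> square_integrable g \<Longrightarrow> square_integrable (\<lambda>x. f x - g x)"
  using square_integrable_add[of f "\<lambda>x. - g x"] square_integrable_uminus[of g] by simp

lemma integrable_mult_cnj:
  assumes f: "square_integrable f" and g: "square_integrable g"
  shows "integrable lborel (\<lambda>x. f x * cnj (g x))"
proof (rule Bochner_Integration.integrable_bound)
  show "integrable lborel (\<lambda>x. (cmod (f x))\<^sup>2 + (cmod (g x))\<^sup>2)"
    using f g by (simp add: square_integrable_def)
  have [measurable]: "f \<in> borel_measurable lborel" "g \<in> borel_measurable lborel"
    using f g by (simp_all add: square_integrable_def)
  have "(\<lambda>x. cnj (g x)) \<in> borel_measurable lborel"
    by (rule measurable_compose[OF _ borel_measurable_continuous_onI])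
      (auto intro!: continuous_intros)
  then show "(\<lambda>x. f x * cnj (g x)) \<in> borel_measurable lborel"
    by measurable
  have "a * b \<le> a\<^sup>2 + b\<^sup>2" if "a \<ge> 0" "b \<ge> 0" for a b :: real
    using zero_le_power2[of "a - b"] mult_nonneg_nonneg[OF that]
    unfolding power2_diff by linarith
  then show "AE x in lborel. norm (f x * cnj (g x))
               \<le> norm ((cmod (f x))\<^sup>2 + (cmod (g x))\<^sup>2)"
    by (intro AE_I2) (simp add: norm_mult)
qed

lemma integral_mult_cnj_cong:
  assumes "square_integrable f" "square_integrable f'" "AE x in lborel. f x = f' x"
    and "square_integrable g" "square_integrable g'" "AE x in lborel. g x = g' x"
  shows "(LINT x|lborel. f x * cnj (g x)) = (LINT x|lborel. f' x * cnj (g' x))"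
proof (rule integral_cong_AE)
  show "(\<lambda>x. f x * cnj (g x)) \<in> borel_measurable lborel"
    by (rule borel_measurable_integrable) (intro integrable_mult_cnj assms)
  show "(\<lambda>x. f' x * cnj (g' x)) \<in> borel_measurable lborel"
    by (rule borel_measurable_integrable) (intro integrable_mult_cnj assms)
  show "AE x in lborel. f x * cnj (g x) = f' x * cnj (g' x)"
    using assms(3,6) by eventually_elim simp
qed

text \<open>Every Lebesgue measurable function agrees almost everywhere with a Borel measurable one,
  so Borel representatives modulo almost-everywhere equality give the usual space \<open>L\<^sup>2\<close>.\<close>

quotient_type (overloaded) 'n L2 = "real ^ ('n::finite) \<Rightarrow> complex" /
  partial: "\<lambda>f g. square_integrable f \<and> square_integrable g \<and> (AE x in lborel. f x = g x)"
proof (rule part_equivpI)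
  show "\<exists>f :: real ^ 'n \<Rightarrow> complex.
      square_integrable f \<and> square_integrable f \<and> (AE x in lborel. f x = f x)"
    using square_integrable_zero by auto
qed (auto intro!: sympI transpI)

instantiation L2 :: (finite) real_inner
begin

lift_definition zero_L2 :: "'a L2" is "\<lambda>x. 0"
  by (simp add: square_integrable_zero)

lift_definition plus_L2 :: "'a L2 \<Rightarrow> 'a L2 \<Rightarrow> 'a L2" is "\<lambda>f g x. f x + g x"
  by (auto intro: square_integrable_add)

lift_definition uminus_L2 :: "'a L2 \<Rightarrow> 'a L2" is "\<lambda>f x. - f x"
  by (auto intro: square_integrable_uminus)

lift_definition minus_L2 :: "'a L2 \<Rightarrow> 'a L2 \<Rightarrow> 'a L2" is "\<lambda>f g x. f x - g x"
  by (auto intro: square_integrable_diff)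

lift_definition scaleR_L2 :: "real \<Rightarrow> 'a L2 \<Rightarrow> 'a L2" is "\<lambda>r f x. complex_of_real r * f x"
  by (auto intro: square_integrable_cmult)

lift_definition inner_L2 :: "'a L2 \<Rightarrow> 'a L2 \<Rightarrow> real"
  is "\<lambda>f g. Re (LINT x|lborel. f x * cnj (g x))"
  by (rule arg_cong[where f = Re]) (auto intro: integral_mult_cnj_cong)

definition norm_L2 :: "'a L2 \<Rightarrow> real" where "norm_L2 f = sqrt (inner f f)"
definition sgn_L2 :: "'a L2 \<Rightarrow> 'a L2" where "sgn_L2 f = inverse (norm f) *\<^sub>R f"
definition dist_L2 :: "'a L2 \<Rightarrow> 'a L2 \<Rightarrow> real" where "dist_L2 f g = norm (f - g)"
definition uniformity_L2 :: "('a L2 \<times> 'a L2) filter" where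
  "uniformity_L2 = (INF e\<in>{0<..}. principal {(f, g). dist f g < e})"
definition open_L2 :: "'a L2 set \<Rightarrow> bool" where
  "open_L2 U \<longleftrightarrow> (\<forall>x\<in>U. \<forall>\<^sub>F (x', y) in uniformity. x' = x \<longrightarrow> y \<in> U)"

instance
proof
  fix f g h :: "'a L2" and r s :: real
  show "f + g + h = f + (g + h)"
    by transfer (auto intro!: square_integrable_add simp: add.assoc)
  show "f + g = g + f"
    by transfer (auto intro!: square_integrable_add simp: add.commute)
  show "0 + f = f"
    by transfer auto
  show "- f + f = 0"
    by transfer (auto simp: square_integrable_zero)
  show "f - g = f + - g"
    by transfer (auto intro!: square_integrable_diff)
  show "r *\<^sub>R (f + g) = r *\<^sub>R f + r *\<^sub>R g"
    by transfer (auto simp: distrib_left intro!: square_integrable_add square_integrable_cmult)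
  show "(r + s) *\<^sub>R f = r *\<^sub>R f + s *\<^sub>R f"
    by transfer (auto intro!: square_integrable_add square_integrable_cmult
        simp: distrib_right)
  show "r *\<^sub>R s *\<^sub>R f = (r * s) *\<^sub>R f"
    by transfer (auto intro!: square_integrable_cmult simp: mult.assoc)
  show "1 *\<^sub>R f = f"
    by transfer auto
  show "sgn f = inverse (norm f) *\<^sub>R f" by (fact sgn_L2_def)
  show "dist f g = norm (f - g)" by (fact dist_L2_def)
  show "(uniformity :: ('a L2 \<times> 'a L2) filter) = (INF e\<in>{0<..}. principal {(x, y). dist x y < e})"
    by (fact uniformity_L2_def)
  show "open U \<longleftrightarrow> (\<forall>x\<in>U. \<forall>\<^sub>F (x', y) in uniformity. x' = x \<longrightarrow> y \<in> U)" for U :: "'a L2 set"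
    by (fact open_L2_def)
  show "inner f g = inner g f"
  proof transfer
    fix f g :: "real ^ 'a \<Rightarrow> complex"
    have "(LINT x|lborel. g x * cnj (f x)) = (LINT x|lborel. cnj (f x * cnj (g x)))"
      by (simp add: mult.commute)
    also have "\<dots> = cnj (LINT x|lborel. f x * cnj (g x))"
      by (rule Bochner_Integration.integral_cnj)
    finally show "Re (LINT x|lborel. f x * cnj (g x)) = Re (LINT x|lborel. g x * cnj (f x))"
      by simp
  qed
  show "inner (f + g) h = inner f h + inner g h"
    by transfer (simp add: distrib_right integrable_mult_cnj)
  show "inner (r *\<^sub>R f) g = r * inner f g"
    by transfer (simp add: mult.assoc)
  show "0 \<le> inner f f"
    by transfer (simp add: complex_mult_cnj flip: of_real_power of_real_add)
  show "inner f f = 0 \<longleftrightarrow> f = 0"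
  proof transfer
    fix f :: "real ^ 'a \<Rightarrow> complex"
    assume *: "square_integrable f \<and> square_integrable f \<and> (AE x in lborel. f x = f x)"
    have "Re (LINT x|lborel. f x * cnj (f x)) = (LINT x|lborel. (cmod (f x))\<^sup>2)"
      by (simp flip: complex_norm_square of_real_power)
    also have "\<dots> = 0 \<longleftrightarrow> (AE x in lborel. (cmod (f x))\<^sup>2 = 0)"
      using * by (intro integral_nonneg_eq_0_iff_AE) (auto simp: square_integrable_def)
    finally show "Re (LINT x|lborel. f x * cnj (f x)) = 0 \<longleftrightarrow>
        square_integrable f \<and> square_integrable (\<lambda>x. 0) \<and> (AE x in lborel. f x = 0)"
      using * by (simp add: square_integrable_zero)
  qed
  show "norm f = sqrt (inner f f)" by (fact norm_L2_def)
qed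

end

lift_definition cscale :: "complex \<Rightarrow> 'n::finite L2 \<Rightarrow> 'n L2" is "\<lambda>c f x. c * f x"
  by (auto intro: square_integrable_cmult)

lift_definition cinner :: "'n::finite L2 \<Rightarrow> 'n L2 \<Rightarrow> complex"
  is "\<lambda>f g. LINT x|lborel. f x * cnj (g x)"
  by (auto intro: integral_mult_cnj_cong)

definition bounded_clinear_L2 :: "('n::finite L2 \<Rightarrow> 'n L2) \<Rightarrow> bool" where
  "bounded_clinear_L2 B \<longleftrightarrow> bounded_linear B \<and> (\<forall>c f. B (cscale c f) = cscale c (B f))"

definition adjoint_L2 :: "('n::finite L2 \<Rightarrow> 'n L2) \<Rightarrow> 'n L2 \<Rightarrow> 'n L2" where
  "adjoint_L2 B = (THE B'. \<forall>f g. cinner (B f) g = cinner f (B' g))"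

definition fourier_integral :: "(real ^ 'n \<Rightarrow> complex) \<Rightarrow> real ^ 'n \<Rightarrow> complex" where
  "fourier_integral f \<xi> = (LINT x|lborel. f x * exp (- (2 * of_real pi * \<i> * of_real (x \<bullet> \<xi>))))"

text \<open>The bounded extension to \<open>L\<^sup>2\<close> of the Fourier integral on the dense subspace
  \<open>L\<^sup>1 \<inter> L\<^sup>2\<close>. The condition in particular forces the Fourier integral of such a
  function to be almost everywhere equal to a square integrable one. By density the extension is
  unique; it exists by Plancherel's theorem.\<close>

definition fourier_L2 :: "'n::finite L2 \<Rightarrow> 'n L2" where
  "fourier_L2 = (THE F. bounded_clinear_L2 F \<and>
     (\<forall>f. integrable lborel f \<and> square_integrable f \<longrightarrow>
        (AE \<xi> in lborel. rep_L2 (F (abs_L2 f)) \<xi> = fourier_integral f \<xi>)))"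

definition mult_L2 :: "(real ^ 'n \<Rightarrow> complex) \<Rightarrow> 'n::finite L2 \<Rightarrow> 'n L2" where
  "mult_L2 m f = abs_L2 (\<lambda>\<xi>. m \<xi> * rep_L2 f \<xi>)"

definition diffusion_symbol :: "(real \<Rightarrow> real) \<Rightarrow> real \<Rightarrow> real \<Rightarrow> real ^ 'n \<Rightarrow> real" where
  "diffusion_symbol \<gamma> T \<tau> \<xi> =
     exp (- (norm ((2 * pi) *\<^sub>R \<xi>) powr (2 * \<tau>) * (LINT s:{0<..<T}|lebesgue. \<gamma> s)))"

definition diffusion_op :: "(real \<Rightarrow> real) \<Rightarrow> real \<Rightarrow> real \<Rightarrow> 'n::finite L2 \<Rightarrow> 'n L2" where
  "diffusion_op \<gamma> T \<tau> f =
     inv fourier_L2 (mult_L2 (\<lambda>\<xi>. of_real (diffusion_symbol \<gamma> T \<tau> \<xi>)) (fourier_L2 f))"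

primrec Ck :: "nat \<Rightarrow> (real ^ 'n::finite \<Rightarrow> real) \<Rightarrow> bool" where
  "Ck 0 f \<longleftrightarrow> continuous_on UNIV f"
| "Ck (Suc k) f \<longleftrightarrow> (\<forall>x. f differentiable at x) \<and>
     (\<forall>v. Ck k (\<lambda>x. frechet_derivative f (at x) v))"

definition smooth :: "(real ^ 'n::finite \<Rightarrow> real) \<Rightarrow> bool" where
  "smooth f \<longleftrightarrow> (\<forall>k. Ck k f)"

definition dilate :: "(real ^ 'n \<Rightarrow> real) \<Rightarrow> real \<Rightarrow> real ^ 'n::finite \<Rightarrow> real" where
  "dilate \<phi> \<beta> x = \<phi> (x /\<^sub>R \<beta>) / \<beta> ^ CARD('n)"

text \<open>For \<open>\<phi>\<close> merely integrable the convolution integral exists for almost every \<open>x\<close>;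
  elsewhere the Bochner integral is \<open>0\<close>, which does not affect the class in \<open>L\<^sup>2\<close>.\<close>

definition mollify_op :: "(real ^ 'n \<Rightarrow> real) \<Rightarrow> real \<Rightarrow> 'n::finite L2 \<Rightarrow> 'n L2" where
  "mollify_op \<phi> \<beta> f =
     abs_L2 (\<lambda>x. LINT y|lborel. of_real (dilate \<phi> \<beta> (x - y)) * rep_L2 f y)"

definition mollify_defect :: "(real ^ 'n \<Rightarrow> real) \<Rightarrow> real \<Rightarrow> 'n::finite L2 \<Rightarrow> 'n L2" where
  "mollify_defect \<phi> \<beta> u = u - mollify_op \<phi> \<beta> u"

definition objective ::
    "('n::finite L2 \<Rightarrow> 'n L2) \<Rightarrow> (real ^ 'n \<Rightarrow> real) \<Rightarrow> real \<Rightarrow> 'n L2 \<Rightarrow> 'n L2 \<Rightarrow> real" where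
  "objective A \<phi> \<beta> g u = (norm (A u - g))\<^sup>2 + (norm (mollify_defect \<phi> \<beta> u))\<^sup>2"

definition regularized_solution ::
    "('n::finite L2 \<Rightarrow> 'n L2) \<Rightarrow> (real ^ 'n \<Rightarrow> real) \<Rightarrow> real \<Rightarrow> 'n L2 \<Rightarrow> 'n L2" where
  "regularized_solution A \<phi> \<beta> g = arg_min (objective A \<phi> \<beta> g) (\<lambda>_. True)"

definition regularization_method ::
    "('n::finite L2 \<Rightarrow> 'n L2) \<Rightarrow> (real \<Rightarrow> 'n L2 \<Rightarrow> 'n L2) \<Rightarrow> bool" where
  "regularization_method A R \<longleftrightarrow>
     (\<forall>\<beta>>0. bounded_clinear_L2 (R \<beta>)) \<and>
     (\<forall>u. ((\<lambda>\<beta>. R \<beta> (A u)) \<longlongrightarrow> u) (at_right 0))"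

end

theory Submission
  imports Defs "HOL-Probability.Characteristic_Functions"
begin

text \<open>
  By Plancherel's theorem the operators \<open>A\<close> and \<open>I - C\<^sub>\<beta>\<close> are conjugate to multiplication by the
  symbols \<open>\<psi>\<close> and \<open>1 - \<Phi>(\<beta> \<xi>)\<close>, where \<open>\<Phi>\<close> is the Fourier transform of \<open>\<phi>\<close>. Hence
  \<open>A\<^sup>*A + (I - C\<^sub>\<beta>)\<^sup>*(I - C\<^sub>\<beta>)\<close> has the symbol \<open>m\<^sub>\<beta> = \<psi>\<^sup>2 + \<bar>1 - \<Phi>(\<beta> \<xi>)\<bar>\<^sup>2\<close>, which is bounded below by a
  positive constant: by the Riemann-Lebesgue lemma for large \<open>\<xi>\<close>, and by \<open>\<psi> > 0\<close> on bounded sets.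
  So \<open>R\<^sub>\<beta>\<close> is the multiplier \<open>\<psi> / m\<^sub>\<beta>\<close>, and \<open>R\<^sub>\<beta> A\<close> is the multiplier \<open>\<psi>\<^sup>2 / m\<^sub>\<beta>\<close>, which lies in
  \<open>[0, 1]\<close> and tends to \<open>1\<close> pointwise as \<open>\<beta>\<close> decreases to \<open>0\<close>, since \<open>\<Phi>(0) = 1\<close>; dominated convergence
  concludes.

  The Fourier transform on \<open>L\<^sup>2\<close> is obtained by Gaussian summation: Plancherel's identity holds for
  continuous compactly supported functions by inserting the weight \<open>exp (- \<pi> \<bar>\<delta> \<xi>\<bar>\<^sup>2)\<close> and letting
  \<open>\<delta>\<close> tend to \<open>0\<close>, and extends by density. Surjectivity follows from the multiplication formula
  \<open>\<integral> \<F>f g = \<integral> f \<F>g\<close>.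
\<close>

section \<open>The space of square integrable functions\<close>

text \<open>\<open>A\<close> has no bounded inverse: its symbol tends to 0 at infinity. The norms of
  \<open>R_\<beta>\<close> are unbounded as \<beta> decreases to 0, because their symbols converge
  pointwise to 1/\<psi>. Hence the lower bound for \<open>m_\<beta>\<close> may depend on \<beta>,
  and convergence is sought only on the range of \<open>A\<close>, where the extra factor \<psi>
  brings the symbol back into [0, 1].

  Since everything is diagonal on the Fourier side, the minimizer is an explicit multiplier;
  expanding the quadratic functional around it gives existence and uniqueness together, without weak
  compactness.

  \<open>fourier_L2\<close> and \<open>adjoint_L2\<close> are definite descriptions, so each says
  something only after existence and uniqueness are proved. For the Fourier transform this requires
  completeness of the quotient space, the isometry on a dense subspace, and the extension by limits.
  The obstacle in Plancherel's identity is that the transform of an integrable function need not be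
  integrable, which forbids a direct use of Fubini's theorem; the Gaussian weight repairs this, and
  being its own transform it leaves an explicit approximate identity.\<close>

lemma borel_measurable_cnj [measurable (raw)]:
  assumes [measurable]: "f \<in> borel_measurable M"
  shows "(\<lambda>x. cnj (f x)) \<in> borel_measurable M"
  by (rule measurable_compose[OF assms borel_measurable_continuous_onI])
    (auto intro!: continuous_intros)

lemma square_integrable_measurable [measurable_dest]:
  "square_integrable f \<Longrightarrow> f \<in> borel_measurable borel"
  by (simp add: square_integrable_def)

lemma square_integrableI_nn_integral:
  assumes "f \<in> borel_measurable borel" "(\<integral>\<^sup>+x. ennreal ((cmod (f x))\<^sup>2) \<partial>lborel) < \<infinity>"
  shows "square_integrable f"
  unfolding square_integrable_def using assms by (auto intro!: integrableI_bounded)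

section \<open>Passing between classes and representatives\<close>

lemma square_integrable_rep [simp]: "square_integrable (rep_L2 u)"
  using Quotient3_rel_rep[OF Quotient3_L2, of u u] by simp

lemma rep_L2_measurable [measurable]: "rep_L2 u \<in> borel_measurable borel"
  by (rule square_integrable_measurable) simp

lemma abs_rep_L2 [simp]: "abs_L2 (rep_L2 u) = u"
  by (rule Quotient3_abs_rep[OF Quotient3_L2])

lemma rep_abs_L2: "square_integrable f \<Longrightarrow> AE x in lborel. rep_L2 (abs_L2 f) x = f x"
  using rep_abs_rsp_left[OF Quotient3_L2, of f f] by simp

lemma abs_L2_eqI:
  assumes "square_integrable f" "square_integrable g" "AE x in lborel. f x = g x"
  shows "abs_L2 f = abs_L2 g"
  using Quotient3_rel_abs[OF Quotient3_L2, of f g] assms by simp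

lemma rep_L2_eqI: "AE x in lborel. rep_L2 u x = rep_L2 v x \<Longrightarrow> u = v"
  using abs_L2_eqI[of "rep_L2 u" "rep_L2 v"] by simp

lemma abs_L2_plus:
  "square_integrable f \<Longrightarrow> square_integrable g \<Longrightarrow> abs_L2 f + abs_L2 g = abs_L2 (\<lambda>x. f x + g x)"
  by (simp add: plus_L2.abs_eq)

lemma abs_L2_minus:
  "square_integrable f \<Longrightarrow> square_integrable g \<Longrightarrow> abs_L2 f - abs_L2 g = abs_L2 (\<lambda>x. f x - g x)"
  by (simp add: minus_L2.abs_eq)

lemma abs_L2_cscale: "square_integrable f \<Longrightarrow> cscale c (abs_L2 f) = abs_L2 (\<lambda>x. c * f x)"
  by (simp add: cscale.abs_eq)

lemma scaleR_eq_cscale: "r *\<^sub>R u = cscale (of_real r) u"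
  by transfer (auto intro: square_integrable_cmult)

lemma rep_L2_plus: "AE x in lborel. rep_L2 (u + v) x = rep_L2 u x + rep_L2 v x"
  using rep_abs_L2[of "\<lambda>x. rep_L2 u x + rep_L2 v x"] abs_L2_plus[of "rep_L2 u" "rep_L2 v"]
  by (simp add: square_integrable_add)

lemma rep_L2_cscale: "AE x in lborel. rep_L2 (cscale c u) x = c * rep_L2 u x"
  using rep_abs_L2[of "\<lambda>x. c * rep_L2 u x"] abs_L2_cscale[of "rep_L2 u" c]
  by (simp add: square_integrable_cmult)

lemma cinner_abs_L2:
  "square_integrable f \<Longrightarrow> square_integrable g \<Longrightarrow>
    cinner (abs_L2 f) (abs_L2 g) = (LINT x|lborel. f x * cnj (g x))"
  by (simp add: cinner.abs_eq)

lemma cinner_rep_L2: "cinner u v = (LINT x|lborel. rep_L2 u x * cnj (rep_L2 v x))"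
  by (fact cinner.rep_eq)

lemma Re_cinner: "Re (cinner u v) = u \<bullet> v"
  by transfer simp

lemma norm_L2_rep: "(norm u)\<^sup>2 = (LINT x|lborel. (cmod (rep_L2 u x))\<^sup>2)"
  unfolding power2_norm_eq_inner[of u] inner_L2.rep_eq
  by (simp flip: complex_norm_square of_real_power)

lemma norm_abs_L2: 
  assumes "square_integrable f" shows "(norm (abs_L2 f))\<^sup>2 = (LINT x|lborel. (cmod (f x))\<^sup>2)"
  unfolding power2_norm_eq_inner[of "abs_L2 f"] using assms
  by (simp add: inner_L2.abs_eq flip: complex_norm_square of_real_power)

section \<open>Fatou's lemma for squared moduli and completeness\<close>

lemma nn_integral_square_integrable:
  assumes "square_integrable f"
  shows "(\<integral>\<^sup>+x. ennreal ((cmod (f x))\<^sup>2) \<partial>lborel) = ennreal ((norm (abs_L2 f))\<^sup>2)"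
  using assms by (subst nn_integral_eq_integral) (auto simp: norm_abs_L2 square_integrable_def)

text \<open>Nonnegative integrals are used because square integrability of the limit is what has to
  be derived. The bound is asked for only eventually, since in the applications the norms merely
  approach their limit.\<close>

lemma nn_integral_fatou_square:
  fixes u :: "nat \<Rightarrow> real ^ 'n \<Rightarrow> complex"
  assumes [measurable]: "\<And>k. u k \<in> borel_measurable borel"
    and lim: "AE x in lborel. (\<lambda>k. u k x) \<longlonglongrightarrow> v x"
    and le: "eventually (\<lambda>k. (\<integral>\<^sup>+x. ennreal ((cmod (u k x))\<^sup>2) \<partial>lborel) \<le> C) sequentially"
  shows "(\<integral>\<^sup>+x. ennreal ((cmod (v x))\<^sup>2) \<partial>lborel) \<le> C"
proof -
  have "(\<integral>\<^sup>+x. ennreal ((cmod (v x))\<^sup>2) \<partial>lborel)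
      = (\<integral>\<^sup>+x. liminf (\<lambda>k. ennreal ((cmod (u k x))\<^sup>2)) \<partial>lborel)"
  proof (rule nn_integral_cong_AE)
    show "AE x in lborel. ennreal ((cmod (v x))\<^sup>2) = liminf (\<lambda>k. ennreal ((cmod (u k x))\<^sup>2))"
      using lim
    proof eventually_elim
      case (elim x)
      have "(\<lambda>k. ennreal ((cmod (u k x))\<^sup>2)) \<longlonglongrightarrow> ennreal ((cmod (v x))\<^sup>2)"
        by (intro tendsto_intros elim)
      then show ?case by (intro lim_imp_Liminf[symmetric]) auto
    qed
  qed
  also have "\<dots> \<le> liminf (\<lambda>k. \<integral>\<^sup>+x. ennreal ((cmod (u k x))\<^sup>2) \<partial>lborel)"
    by (rule nn_integral_liminf) measurable
  also have "\<dots> \<le> C"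
    using Liminf_le[OF _ le] by simp
  finally show ?thesis .
qed

lemma tendsto_L2_I:
  assumes "\<And>k. square_integrable (f k)" "square_integrable g"
    "(\<lambda>k. LINT x|lborel. (cmod (f k x - g x))\<^sup>2) \<longlonglongrightarrow> 0"
  shows "(\<lambda>k. abs_L2 (f k)) \<longlonglongrightarrow> abs_L2 g"
proof -
  have "(\<lambda>k. (norm (abs_L2 (f k) - abs_L2 g))\<^sup>2) \<longlonglongrightarrow> 0"
    using assms by (simp add: abs_L2_minus norm_abs_L2 square_integrable_diff)
  then have "(\<lambda>k. norm (abs_L2 (f k) - abs_L2 g)) \<longlonglongrightarrow> 0"
    by (auto dest: tendsto_real_sqrt)
  then show ?thesis
    using LIM_zero_iff tendsto_norm_zero_iff by blast
qed

text \<open>Riesz-Fischer: a rapidly converging subsequence of representatives converges almost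
  everywhere, Fatou's lemma identifies the pointwise limit as the limit in norm, and a Cauchy
  sequence follows its subsequence.\<close>

instance L2 :: (finite) complete_space
proof
  fix X :: "nat \<Rightarrow> 'a L2"
  assume X: "Cauchy X"
  have "\<forall>k. \<exists>N. \<forall>m\<ge>N. \<forall>n\<ge>N. dist (X m) (X n) < (1/4)^k"
    using X unfolding Cauchy_def by auto
  then obtain N where N: "\<And>k m n. m \<ge> N k \<Longrightarrow> n \<ge> N k \<Longrightarrow> dist (X m) (X n) < (1/4)^k"
    by metis
  \<comment> \<open>The sum dominates each \<open>N i\<close> with i \<le> k, and the extra
    \<open>k\<close> makes \<open>r\<close> strictly increasing.\<close>
  define r where "r k = (\<Sum>i\<le>k. N i) + k" for k
  have r_ge: "N k \<le> r k" "k \<le> r k" for k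
    by (auto simp: r_def intro: trans_le_add1 member_le_sum)
  define f where "f k = rep_L2 (X (r k))" for k
  have [measurable]: "f k \<in> borel_measurable borel" for k
    unfolding f_def by measurable
  have sq: "square_integrable (f k)" for k unfolding f_def by simp
  have nn: "(\<integral>\<^sup>+x. ennreal ((cmod (f m x - f n x))\<^sup>2) \<partial>lborel) \<le> ennreal ((1/16)^k)"
    if "r m \<ge> N k" "r n \<ge> N k" for m n k
  proof -
    have "(norm (X (r m) - X (r n)))\<^sup>2 \<le> ((1/4)^k)\<^sup>2"
      using N[OF that] by (intro power_mono) (auto simp: dist_norm)
    also have "\<dots> = (1/16)^k" by (simp add: power2_eq_square flip: power_mult_distrib)
    finally show ?thesis
      using abs_L2_minus[OF sq sq, of m n]
      by (subst nn_integral_square_integrable) (auto simp: f_def square_integrable_diff)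
  qed
  \<comment> \<open>Against squared norms of size (1/16)^k the weight 4^k still leaves a convergent
    series, while a finite value C of the weighted sum at x forces increments of at most sqrt C /
    2^k there.\<close>
  have "(\<integral>\<^sup>+x. (\<Sum>k. ennreal (4^k * (cmod (f (Suc k) x - f k x))\<^sup>2)) \<partial>lborel)
      = (\<Sum>k. ennreal (4^k) * (\<integral>\<^sup>+x. ennreal ((cmod (f (Suc k) x - f k x))\<^sup>2) \<partial>lborel))"
    by (subst nn_integral_suminf) (auto simp: ennreal_mult nn_integral_cmult)
  also have "\<dots> \<le> (\<Sum>k. ennreal ((1/4)^k))"
  proof (intro suminf_le summableI)
    fix k
    have "N k \<le> sum N {..Suc k}" by (rule member_le_sum) auto
    then have "N k \<le> r (Suc k)" unfolding r_def by simp
    then have "ennreal (4^k) * (\<integral>\<^sup>+x. ennreal ((cmod (f (Suc k) x - f k x))\<^sup>2) \<partial>lborel)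
        \<le> ennreal (4^k) * ennreal ((1/16)^k)"
      using r_ge by (intro mult_left_mono nn) auto
    also have "\<dots> = ennreal ((1/4)^k)"
      by (simp add: power_divide flip: ennreal_mult) (simp add: field_simps flip: power_mult_distrib)
    finally show "ennreal (4^k) * (\<integral>\<^sup>+x. ennreal ((cmod (f (Suc k) x - f k x))\<^sup>2) \<partial>lborel)
        \<le> ennreal ((1/4)^k)" .
  qed
  also have "\<dots> < \<infinity>"
    by (subst suminf_ennreal2) (auto intro: summable_geometric)
  finally have "AE x in lborel. (\<Sum>k. ennreal (4^k * (cmod (f (Suc k) x - f k x))\<^sup>2)) \<noteq> \<infinity>"
    by (intro nn_integral_PInf_AE) auto
  then have conv: "AE x in lborel. Cauchy (\<lambda>k. f k x)"
  proof eventually_elim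
    case (elim x)
    obtain C where C: "C \<ge> 0" "(\<Sum>k. ennreal (4^k * (cmod (f (Suc k) x - f k x))\<^sup>2)) = ennreal C"
      using elim by (rule_tac ennreal_cases[of "\<Sum>k. ennreal (4^k * (cmod (f (Suc k) x - f k x))\<^sup>2)"]) (blast, simp only: infinity_ennreal_def)
    have bd: "cmod (f (Suc k) x - f k x) \<le> sqrt C * (1/2)^k" for k
    proof -
      have "ennreal (4^k * (cmod (f (Suc k) x - f k x))\<^sup>2)
          = (\<Sum>i\<in>{k}. ennreal (4^i * (cmod (f (Suc i) x - f i x))\<^sup>2))" by simp
      also have "\<dots> \<le> ennreal C" 
        unfolding C(2)[symmetric] by (intro sum_le_suminf summableI) auto
      finally have "4^k * (cmod (f (Suc k) x - f k x))\<^sup>2 \<le> C" using C(1) by simp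
      moreover have "(2^k)\<^sup>2 = (4^k :: real)" by (simp add: power2_eq_square flip: power_mult_distrib)
      ultimately have "(2^k * cmod (f (Suc k) x - f k x))\<^sup>2 \<le> C" 
        by (simp add: power_mult_distrib)
      then have "2^k * cmod (f (Suc k) x - f k x) \<le> sqrt C" by (rule real_le_rsqrt)
      then show ?thesis by (simp add: field_simps)
    qed
    have "summable (\<lambda>k. f (Suc k) x - f k x)"
      by (rule summable_comparison_test'[of "\<lambda>k. sqrt C * (1/2)^k"])
        (use bd in \<open>auto intro!: summable_mult summable_geometric\<close>)
    then have "convergent (\<lambda>n. \<Sum>k<n. f (Suc k) x - f k x)"
      by (simp add: summable_iff_convergent)
    then have "convergent (\<lambda>n. (f n x - f 0 x) + f 0 x)"
      by (subst (asm) sum_lessThan_telescope) (intro convergent_add convergent_const)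
    then show ?case by (simp add: convergent_Cauchy)
  qed
  define g where "g x = lim (\<lambda>k. f k x)" for x
  have g_meas [measurable]: "g \<in> borel_measurable borel"
    unfolding g_def by measurable
  have lim: "AE x in lborel. (\<lambda>k. f k x) \<longlonglongrightarrow> g x"
    using conv by eventually_elim (simp add: g_def Cauchy_convergent_iff convergent_LIMSEQ_iff)
  have bound: "(\<integral>\<^sup>+x. ennreal ((cmod (g x - f k x))\<^sup>2) \<partial>lborel) \<le> ennreal ((1/16)^k)" for k
  proof (rule nn_integral_fatou_square[where u = "\<lambda>j x. f j x - f k x"])
    show "AE x in lborel. (\<lambda>j. f j x - f k x) \<longlonglongrightarrow> g x - f k x"
      using lim by eventually_elim (intro tendsto_intros)
    show "eventually (\<lambda>j. (\<integral>\<^sup>+x. ennreal ((cmod (f j x - f k x))\<^sup>2) \<partial>lborel) \<le> ennreal ((1/16)^k))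
        sequentially"
      using eventually_ge_at_top[of "N k"] 
      by eventually_elim (rule nn, use r_ge in \<open>auto intro: order_trans\<close>)
  qed auto
  have sqd: "square_integrable (\<lambda>x. g x - f k x)" for k
    by (rule square_integrableI_nn_integral) (use bound[of k] in \<open>auto intro: le_less_trans\<close>)
  have sqg: "square_integrable g" using square_integrable_add[OF sqd[of 0] sq[of 0]] by simp
  have "dist (X (r k)) (abs_L2 g) \<le> (1/4)^k" for k
  proof -
    have "ennreal ((norm (abs_L2 g - X (r k)))\<^sup>2) \<le> ennreal ((1/16)^k)"
      using bound[of k] nn_integral_square_integrable[OF sqd[of k]] abs_L2_minus[OF sqg sq[of k]]
      by (simp add: f_def)
    then have "(norm (abs_L2 g - X (r k)))\<^sup>2 \<le> ((1/4)^k)\<^sup>2"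
      by (simp add: power2_eq_square flip: power_mult_distrib)
    then show ?thesis
      using power2_le_imp_le[of "norm (abs_L2 g - X (r k))" "(1/4)^k"] 
      by (simp add: dist_norm norm_minus_commute)
  qed
  then have sub: "(\<lambda>k. X (r k)) \<longlonglongrightarrow> abs_L2 g"
    by (subst tendsto_dist_iff, intro Lim_null_comparison[OF _ LIMSEQ_realpow_zero[of "1/4"]])
       auto
  have "strict_mono r" unfolding r_def strict_mono_Suc_iff by simp
  then have "X \<longlonglongrightarrow> abs_L2 g" using X sub
    by (auto intro!: Cauchy_converges_subseq[of X r] simp: o_def)
  then show "convergent X" by (auto simp: convergent_def)
qed

section \<open>Density of continuous functions of compact support\<close>

definition compactly_supported :: "(real ^ 'n \<Rightarrow> complex) \<Rightarrow> bool" where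
  "compactly_supported g \<longleftrightarrow> continuous_on UNIV g \<and> (\<exists>N. \<forall>x. norm x > N \<longrightarrow> g x = 0)"

lemma compactly_supportedE:
  assumes "compactly_supported g"
  obtains N B where "N > 0" "B > 0" "\<And>x. cmod (g x) \<le> B * indicator (cball 0 N) x" 
proof -
  obtain N where N: "\<And>x. norm x > N \<Longrightarrow> g x = 0" and c: "continuous_on UNIV g"
    using assms by (auto simp: compactly_supported_def)
  define N' where "N' = max N 1"
  have "bounded (g ` cball 0 N')"
    by (intro compact_imp_bounded compact_continuous_image continuous_on_subset[OF c]) auto
  then obtain B where "B > 0" "\<forall>y \<in> g ` cball 0 N'. norm y \<le> B"
    by (auto simp: bounded_pos)
  then have "cmod (g x) \<le> B * indicator (cball 0 N') x" for x
    using N[of x] by (auto simp: indicator_def N'_def)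
  then show ?thesis using that[of N' B] \<open>B > 0\<close> by (simp add: N'_def)
qed

lemma integrable_indicator_cball: 
  "integrable lborel (\<lambda>x::real ^ 'n. c * indicator (cball 0 N) x :: real)"
  by (intro integrable_mult_right integrable_real_indicator emeasure_bounded_finite) auto

lemma compactly_supported_measurable: "compactly_supported g \<Longrightarrow> g \<in> borel_measurable borel"
  by (auto simp: compactly_supported_def intro: borel_measurable_continuous_onI)

lemma compactly_supported_integrable: 
  assumes "compactly_supported g" shows "integrable lborel g"
proof -
  obtain N B where *: "\<And>x. cmod (g x) \<le> B * indicator (cball 0 N) x" 
    using compactly_supportedE[OF assms] by metis
  show ?thesis
    by (rule Bochner_Integration.integrable_bound[OF integrable_indicator_cball[of B N]])
     (use * compactly_supported_measurable[OF assms] in \<open>auto intro: order_trans[OF _ abs_ge_self]\<close>)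
qed

lemma square_integrableI_bounded:
  assumes "integrable lborel g" "\<And>x. cmod (g x) \<le> B"
  shows "square_integrable g"
  unfolding square_integrable_def
proof
  show m: "g \<in> borel_measurable lborel" using assms(1) by auto
  show "integrable lborel (\<lambda>x. (cmod (g x))\<^sup>2)"
  proof (rule Bochner_Integration.integrable_bound)
    show "integrable lborel (\<lambda>x. B * cmod (g x))" using assms(1) by simp
    show "AE x in lborel. norm ((cmod (g x))\<^sup>2) \<le> norm (B * cmod (g x))"
      using assms(2) by (intro AE_I2) 
        (auto simp: power2_eq_square abs_mult intro!: mult_right_mono intro: order_trans[OF _ abs_ge_self])
  qed (use m in measurable)
qed

lemma compactly_supported_square_integrable: 
  assumes "compactly_supported g" shows "square_integrable g"
proof -
  obtain N B where "B > 0" "\<And>x. cmod (g x) \<le> B * indicator (cball 0 N) x" 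
    using compactly_supportedE[OF assms] by metis
  then have "cmod (g x) \<le> B" for x 
    by (rule_tac order_trans[of _ "B * indicator (cball 0 N) x"]) (auto simp: indicator_def)
  then show ?thesis
    by (intro square_integrableI_bounded compactly_supported_integrable assms)
qed

text \<open>Converts the exceptional sets of \<open>measurable_on\<close>, which are null for the
  completed measure, into statements about \<open>lborel\<close>.\<close>

lemma AE_lborel_of_negligible: "negligible N \<Longrightarrow> AE x in lborel. x \<notin> N"
proof -
  assume "negligible N"
  then have "AE x in lebesgue. x \<notin> N"
    by (intro AE_not_in) (simp add: negligible_iff_null_sets)
  then show ?thesis by (simp add: AE_completion_iff)
qed

lemma cmod_diff_square_le: "(cmod (a - b))\<^sup>2 \<le> 2 * (cmod (a - c))\<^sup>2 + 2 * (cmod (c - b))\<^sup>2"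
proof -
  have "(cmod (a - b))\<^sup>2 \<le> (cmod (a - c) + cmod (c - b))\<^sup>2"
    by (intro power_mono norm_triangle_le) (auto intro: norm_triangle_ineq4 order_trans[OF norm_triangle_ineq[of "a - c" "c - b", simplified]])
  also have "\<dots> \<le> 2 * (cmod (a - c))\<^sup>2 + 2 * (cmod (c - b))\<^sup>2"
    using zero_le_power2[of "cmod (a - c) - cmod (c - b)"] by (simp add: power2_sum power2_diff)
  finally show ?thesis .
qed

text \<open>Lebesgue measurability supplies continuous functions converging almost everywhere, but
  with no control of size or support. Composing with \<open>c\<close> restores the bound M and
  multiplying by \<open>\<kappa>\<close>, which is 1 on the ball of radius N and 0 outside radius N
  + 1, restores the support; dominated convergence then gives both limits.\<close>

lemma compactly_supported_approx_bounded:
  fixes f :: "real ^ 'n \<Rightarrow> complex"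
  assumes f [measurable]: "f \<in> borel_measurable borel"
    and bd: "\<And>x. cmod (f x) \<le> M * indicator (cball 0 N) x"
    and "M > 0"
  obtains h where "\<And>k::nat. compactly_supported (h k)" 
    "(\<lambda>k. LINT x|lborel. cmod (f x - h k x)) \<longlonglongrightarrow> 0"
    "(\<lambda>k. LINT x|lborel. (cmod (f x - h k x))\<^sup>2) \<longlonglongrightarrow> 0"
proof -
  have "f \<in> borel_measurable lebesgue"
    using f by (intro measurable_completion) simp
  then have "f measurable_on UNIV"
    by (rule lebesgue_measurable_imp_measurable_on) auto
  then obtain Z g where Z: "negligible Z" and g: "\<And>n. continuous_on UNIV (g n)"
    and lim: "\<And>x. x \<notin> Z \<Longrightarrow> (\<lambda>n. g n x) \<longlonglongrightarrow> f x"
    unfolding measurable_on_def by auto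
  define \<kappa> :: "real ^ 'n \<Rightarrow> complex" where "\<kappa> x = of_real (max 0 (min 1 (N + 1 - norm x)))" for x
  \<comment> \<open>The radial retraction onto the disc of radius M: continuous, and the identity on
    that disc.\<close>
  define c where "c z = z * of_real (M / max M (cmod z))" for z :: complex
  define h where "h k x = \<kappa> x * c (g k x)" for k x
  have c_bd: "cmod (c z) \<le> M" for z
    using \<open>M > 0\<close> unfolding c_def norm_mult norm_of_real
    by (auto simp: abs_if max_def field_simps split: if_splits)
  have c_cont: "continuous_on UNIV c"
    unfolding c_def using \<open>M > 0\<close> by (intro continuous_intros) (auto simp: max_def)
  have c_id: "c z = z" if "cmod z \<le> M" for z
    using that \<open>M > 0\<close> by (simp add: c_def)
  have \<kappa>_bd: "cmod (\<kappa> x) \<le> indicator (cball 0 (N+1)) x" for x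
    by (auto simp: \<kappa>_def indicator_def)
  have h_cont: "continuous_on UNIV (h k)" for k
    unfolding h_def \<kappa>_def
    by (intro continuous_intros continuous_on_compose2[OF c_cont g]) auto
  have hs: "compactly_supported (h k)" for k
    unfolding compactly_supported_def using h_cont[of k]
    by (auto intro!: exI[of _ "N+1"] simp: h_def \<kappa>_def)
  have [measurable]: "h k \<in> borel_measurable borel" for k
    by (rule compactly_supported_measurable[OF hs])
  have h_bd: "cmod (h k x) \<le> M * indicator (cball 0 (N+1)) x" for k x
    using mult_mono[OF \<kappa>_bd c_bd] \<open>M > 0\<close> by (simp add: h_def norm_mult mult.commute)
  have f_bd: "cmod (f x) \<le> M * indicator (cball 0 (N+1)) x" for x
    by (rule order_trans[OF bd]) (use \<open>M > 0\<close> in \<open>auto simp: indicator_def\<close>)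
  have d_bd: "cmod (f x - h k x) \<le> 2 * M * indicator (cball 0 (N+1)) x" for k x
    using norm_triangle_ineq4[of "f x" "h k x"] f_bd[of x] h_bd[of k x] by simp
  have h_lim: "AE x in lborel. (\<lambda>k. f x - h k x) \<longlonglongrightarrow> 0"
    using AE_lborel_of_negligible[OF Z]
  proof eventually_elim
    case (elim x)
    have "cmod (f x) \<le> M" using bd[of x] \<open>M > 0\<close> by (cases "norm x \<le> N") (auto simp: indicator_def)
    have "(\<lambda>k. c (g k x)) \<longlonglongrightarrow> c (f x)"
      using c_cont lim[OF elim] by (auto intro!: continuous_on_tendsto_compose[OF c_cont])
    then have "(\<lambda>k. c (g k x)) \<longlonglongrightarrow> f x" using \<open>cmod (f x) \<le> M\<close> by (simp add: c_id)
    then have "(\<lambda>k. f x - h k x) \<longlonglongrightarrow> f x - \<kappa> x * f x"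
      unfolding h_def by (intro tendsto_intros)
    moreover have "\<kappa> x * f x = f x"
      using bd[of x] by (cases "norm x \<le> N") (auto simp: \<kappa>_def)
    ultimately show ?case by simp
  qed
  have 1: "(\<lambda>k. LINT x|lborel. cmod (f x - h k x)) \<longlonglongrightarrow> (integral\<^sup>L lborel (\<lambda>x::real ^ 'n. 0::real))"
  proof (rule integral_dominated_convergence)
    show "integrable lborel (\<lambda>x::real ^ 'n. 2 * M * indicator (cball 0 (N+1)) x :: real)"
      by (rule integrable_indicator_cball)
    show "AE x in lborel. (\<lambda>k. cmod (f x - h k x)) \<longlonglongrightarrow> 0"
      using h_lim by eventually_elim (rule tendsto_norm_zero)
  qed (use d_bd in auto)
  have 2: "(\<lambda>k. LINT x|lborel. (cmod (f x - h k x))\<^sup>2) \<longlonglongrightarrow> (integral\<^sup>L lborel (\<lambda>x::real ^ 'n. 0::real))"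
  proof (rule integral_dominated_convergence)
    show "integrable lborel (\<lambda>x::real ^ 'n. (2 * M)\<^sup>2 * indicator (cball 0 (N+1)) x :: real)"
      by (rule integrable_indicator_cball)
    show "AE x in lborel. (\<lambda>k. (cmod (f x - h k x))\<^sup>2) \<longlonglongrightarrow> 0"
      using h_lim by eventually_elim (use tendsto_power[OF tendsto_norm_zero, of _ _ 2] in auto)
    show "AE x in lborel. norm ((cmod (f x - h k x))\<^sup>2) \<le> (2 * M)\<^sup>2 * indicator (cball 0 (N+1)) x" for k
    proof (rule AE_I2)
      fix x
      have "(cmod (f x - h k x))\<^sup>2 \<le> (2 * M * indicator (cball 0 (N+1)) x)\<^sup>2"
        by (intro power_mono d_bd) auto
      then show "norm ((cmod (f x - h k x))\<^sup>2) \<le> (2 * M)\<^sup>2 * indicator (cball 0 (N+1)) x"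
        by (cases "norm x \<le> N + 1") (simp_all add: power_mult_distrib)
    qed
  qed auto
  show ?thesis using that[OF hs] 1 2 by simp
qed

text \<open>One \<open>g\<close> serves both norms: for Plancherel the L1 estimate gives pointwise
  convergence of the transforms and the L2 estimate convergence of the norms. The implications let
  the same lemma serve the Riemann-Lebesgue argument, where only integrability is known.\<close>

lemma compactly_supported_dense:
  fixes f :: "real ^ 'n \<Rightarrow> complex"
  assumes f [measurable]: "f \<in> borel_measurable borel" and "e > 0"
  obtains g where "compactly_supported g" 
    "integrable lborel f \<Longrightarrow> (LINT x|lborel. cmod (f x - g x)) < e"
    "square_integrable f \<Longrightarrow> (LINT x|lborel. (cmod (f x - g x))\<^sup>2) < e"
proof -
  \<comment> \<open>Truncation in value and in space at once, as the bounded case requires.\<close>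
  define t where "t n x = (if cmod (f x) \<le> real n \<and> norm x \<le> real n then f x else 0)" for n x
  have [measurable]: "t n \<in> borel_measurable borel" for n
    unfolding t_def by measurable
  have lim: "(\<lambda>n. f x - t n x) \<longlonglongrightarrow> 0" for x
  proof (rule tendsto_eventually)
    obtain m where m: "max (cmod (f x)) (norm x) \<le> real m" using real_arch_simple by blast
    show "eventually (\<lambda>n. f x - t n x = 0) sequentially"
      using eventually_ge_at_top[of m]
      by eventually_elim (use m in \<open>auto simp: t_def intro: order_trans\<close>)
  qed
  have bd: "cmod (f x - t n x) \<le> cmod (f x)" for n x by (simp add: t_def)
  have tb: "cmod (t n x) \<le> (real n + 1) * indicator (cball 0 (real n)) x" for n x
    by (auto simp: t_def indicator_def)
  \<comment> \<open>The quarter is dictated by the squared estimate, where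
    \<open>cmod_diff_square_le\<close> doubles both errors: 2 * e/4 + 2 * e/4 = e.\<close>
  have 1: "eventually (\<lambda>n. (LINT x|lborel. cmod (f x - t n x)) < e/4) sequentially" 
    if i: "integrable lborel f"
  proof (rule order_tendstoD(2)[where y = 0])
    have "(\<lambda>n. LINT x|lborel. cmod (f x - t n x)) \<longlonglongrightarrow> (integral\<^sup>L lborel (\<lambda>x::real ^ 'n. 0::real))"
      by (rule integral_dominated_convergence[where w = "\<lambda>x. cmod (f x)"])
        (use i bd tendsto_norm_zero[OF lim] in auto)
    then show "(\<lambda>n. LINT x|lborel. cmod (f x - t n x)) \<longlonglongrightarrow> 0" by simp
  qed (use \<open>e > 0\<close> in auto)
  have 2: "eventually (\<lambda>n. (LINT x|lborel. (cmod (f x - t n x))\<^sup>2) < e/4) sequentially" 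
    if i: "square_integrable f"
  proof (rule order_tendstoD(2)[where y = 0])
    have "(\<lambda>n. LINT x|lborel. (cmod (f x - t n x))\<^sup>2) \<longlonglongrightarrow> (integral\<^sup>L lborel (\<lambda>x::real ^ 'n. 0::real))"
      by (rule integral_dominated_convergence[where w = "\<lambda>x. (cmod (f x))\<^sup>2"])
        (use i bd tendsto_norm_zero[OF lim] in 
          \<open>auto simp: square_integrable_def intro!: power_mono\<close>)
    then show "(\<lambda>n. LINT x|lborel. (cmod (f x - t n x))\<^sup>2) \<longlonglongrightarrow> 0" by simp
  qed (use \<open>e > 0\<close> in auto)
  have "eventually (\<lambda>n. (integrable lborel f \<longrightarrow> (LINT x|lborel. cmod (f x - t n x)) < e/4)
      \<and> (square_integrable f \<longrightarrow> (LINT x|lborel. (cmod (f x - t n x))\<^sup>2) < e/4)) sequentially"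
    using 1 2 by (cases "integrable lborel f"; cases "square_integrable f") (auto intro: eventually_conj)
  then obtain n where n: "integrable lborel f \<Longrightarrow> (LINT x|lborel. cmod (f x - t n x)) < e/4"
    "square_integrable f \<Longrightarrow> (LINT x|lborel. (cmod (f x - t n x))\<^sup>2) < e/4"
    by (auto simp: eventually_sequentially)
  obtain h where h: "\<And>k::nat. compactly_supported (h k)" 
    "(\<lambda>k. LINT x|lborel. cmod (t n x - h k x)) \<longlonglongrightarrow> 0"
    "(\<lambda>k. LINT x|lborel. (cmod (t n x - h k x))\<^sup>2) \<longlonglongrightarrow> 0"
    using compactly_supported_approx_bounded[of "t n", OF _ tb[of n]] by auto
  have "eventually (\<lambda>k. (LINT x|lborel. cmod (t n x - h k x)) < e/4
      \<and> (LINT x|lborel. (cmod (t n x - h k x))\<^sup>2) < e/4) sequentially"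
    using order_tendstoD(2)[OF h(2), of "e/4"] order_tendstoD(2)[OF h(3), of "e/4"] \<open>e > 0\<close>
    by (auto intro: eventually_conj)
  then obtain k where k: "(LINT x|lborel. cmod (t n x - h k x)) < e/4"
    "(LINT x|lborel. (cmod (t n x - h k x))\<^sup>2) < e/4"
    by (auto simp: eventually_sequentially)
  have tint: "integrable lborel (t n)"
    by (rule Bochner_Integration.integrable_bound[OF integrable_indicator_cball[of "real n + 1" "real n"]])
      (use tb in \<open>auto intro: order_trans[OF _ abs_ge_self]\<close>)
  have "cmod (t n x) \<le> real n" for x by (auto simp: t_def)
  then have tsq: "square_integrable (t n)"
    by (rule square_integrableI_bounded[OF tint])
  note hint = compactly_supported_integrable[OF h(1)[of k]]
  note hsq = compactly_supported_square_integrable[OF h(1)[of k]]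
  show ?thesis
  proof (rule that[OF h(1)[of k]])
    assume i: "integrable lborel f"
    have "(LINT x|lborel. cmod (f x - h k x)) 
        \<le> (LINT x|lborel. cmod (f x - t n x) + cmod (t n x - h k x))"
      by (rule integral_mono) (use i hint tint norm_triangle_ineq[of "f x - t n x" "t n x - h k x" for x] in auto)
    also have "\<dots> = (LINT x|lborel. cmod (f x - t n x)) + (LINT x|lborel. cmod (t n x - h k x))"
      by (rule Bochner_Integration.integral_add) (use i hint tint in auto)
    also have "\<dots> < e" using n(1)[OF i] k \<open>e > 0\<close> by simp
    finally show "(LINT x|lborel. cmod (f x - h k x)) < e" .
  next
    assume i: "square_integrable f"
    note ii = square_integrable_diff[OF i tsq, unfolded square_integrable_def]
       square_integrable_diff[OF tsq hsq, unfolded square_integrable_def]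
       square_integrable_diff[OF i hsq, unfolded square_integrable_def]
    have "(LINT x|lborel. (cmod (f x - h k x))\<^sup>2) 
        \<le> (LINT x|lborel. 2 * (cmod (f x - t n x))\<^sup>2 + 2 * (cmod (t n x - h k x))\<^sup>2)"
      by (rule integral_mono) (use ii cmod_diff_square_le in auto)
    also have "\<dots> = 2 * (LINT x|lborel. (cmod (f x - t n x))\<^sup>2) + 2 * (LINT x|lborel. (cmod (t n x - h k x))\<^sup>2)"
      by (subst Bochner_Integration.integral_add) (use ii in auto)
    also have "\<dots> < e" using n(2)[OF i] k \<open>e > 0\<close> by simp
    finally show "(LINT x|lborel. (cmod (f x - h k x))\<^sup>2) < e" .
  qed
qed

section \<open>The Fourier integral\<close>

abbreviation fchar :: "real ^ 'n \<Rightarrow> real ^ 'n \<Rightarrow> complex" where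
  "fchar x \<xi> \<equiv> exp (- (2 * of_real pi * \<i> * of_real (x \<bullet> \<xi>)))"

lemma norm_fchar [simp]: "cmod (fchar x \<xi>) = 1"
  by (simp add: norm_exp_eq_Re)

lemma cnj_fchar: "cnj (fchar x \<xi>) = fchar (- x) \<xi>"
  by (simp add: exp_cnj)

lemma fchar_add: "fchar (x + y) \<xi> = fchar x \<xi> * fchar y \<xi>"
  by (simp add: inner_add_left algebra_simps flip: exp_add)

lemma fourier_integrable: 
  "integrable lborel f \<Longrightarrow> integrable lborel (\<lambda>x. f x * fchar x \<xi>)"
  by (rule Bochner_Integration.integrable_bound[of _ f]) (auto simp: norm_mult)

lemma fourier_integral_bound:
  assumes "integrable lborel f"
  shows "cmod (fourier_integral f \<xi>) \<le> (LINT x|lborel. cmod (f x))"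
  unfolding fourier_integral_def
  by (rule order_trans[OF integral_norm_bound]) (simp add: norm_mult)

lemma fourier_integral_add:
  "integrable lborel f \<Longrightarrow> integrable lborel g \<Longrightarrow>
    fourier_integral (\<lambda>x. f x + g x) = (\<lambda>\<xi>. fourier_integral f \<xi> + fourier_integral g \<xi>)"
  unfolding fourier_integral_def distrib_right
  by (intro ext Bochner_Integration.integral_add fourier_integrable)

lemma fourier_integral_diff:
  "integrable lborel f \<Longrightarrow> integrable lborel g \<Longrightarrow>
    fourier_integral (\<lambda>x. f x - g x) = (\<lambda>\<xi>. fourier_integral f \<xi> - fourier_integral g \<xi>)"
  unfolding fourier_integral_def left_diff_distrib
  by (intro ext Bochner_Integration.integral_diff fourier_integrable)

lemma fourier_integral_cmult:
  "fourier_integral (\<lambda>x. c * f x) = (\<lambda>\<xi>. c * fourier_integral f \<xi>)"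
  unfolding fourier_integral_def by (simp add: mult.assoc)

text \<open>Dominated convergence along sequences, with |f| as the bound. It later gives
  \<Phi>(\<beta> \<xi>) \<longlonglongrightarrow> \<Phi>(0).\<close>

lemma fourier_integral_continuous:
  assumes "integrable lborel f"
  shows "continuous_on UNIV (fourier_integral f)"
proof -
  have "(\<lambda>n. fourier_integral f (u n)) \<longlonglongrightarrow> fourier_integral f a" if "u \<longlonglongrightarrow> a" for u a
    unfolding fourier_integral_def
  proof (rule integral_dominated_convergence)
    show "integrable lborel (\<lambda>x. cmod (f x))" using assms by simp
    show "AE x in lborel. (\<lambda>i. f x * fchar x (u i)) \<longlonglongrightarrow> f x * fchar x a"
      by (intro AE_I2 tendsto_intros that)
  qed (use assms in \<open>auto simp: norm_mult\<close>)
  then show ?thesis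
    by (simp add: continuous_on_sequentially o_def)
qed

lemma fourier_integral_measurable [measurable]:
  assumes [measurable]: "f \<in> borel_measurable borel"
  shows "fourier_integral f \<in> borel_measurable borel"
  unfolding fourier_integral_def by measurable

lemma integrable_bounded_mult:
  fixes f g :: "'a \<Rightarrow> complex"
  assumes "integrable M f" "g \<in> borel_measurable M" "\<And>x. cmod (g x) \<le> B"
  shows "integrable M (\<lambda>x. f x * g x)" "integrable M (\<lambda>x. g x * f x)"
proof -
  show "integrable M (\<lambda>x. f x * g x)"
  proof (rule Bochner_Integration.integrable_bound)
    show "integrable M (\<lambda>x. B * cmod (f x))" using assms by simp
    show "AE x in M. norm (f x * g x) \<le> norm (B * cmod (f x))"
      using assms(3) by (intro AE_I2) (auto simp: norm_mult abs_mult mult.commute[of "cmod (f _)"] 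
        intro!: mult_right_mono intro: order_trans[OF _ abs_ge_self])
  qed (use assms in measurable)
  then show "integrable M (\<lambda>x. g x * f x)" by (simp add: mult.commute)
qed

lemma integrable_pair_mult:
  fixes f g :: "'a::euclidean_space \<Rightarrow> complex"
  assumes "integrable lborel f" "integrable lborel g"
  shows "integrable (lborel \<Otimes>\<^sub>M lborel) (\<lambda>(x,y). f x * g y)"
proof -
  have [measurable]: "f \<in> borel_measurable borel" "g \<in> borel_measurable borel"
    using assms by auto
  show ?thesis
    by (rule lborel_pair.Fubini_integrable) (use assms in \<open>auto simp: norm_mult\<close>)
qed

text \<open>Fubini's theorem and the symmetry of the character in its two arguments. It drives both
  the Gaussian summation and the proof of surjectivity.\<close>

lemma fourier_integral_mult_formula:
  assumes f: "integrable lborel f" and h: "integrable lborel h"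
  shows "(LINT \<xi>|lborel. fourier_integral f \<xi> * h \<xi>) = (LINT x|lborel. f x * fourier_integral h x)"
proof -
  have [measurable]: "f \<in> borel_measurable borel" "h \<in> borel_measurable borel"
    using f h by auto
  have i: "integrable (lborel \<Otimes>\<^sub>M lborel) (\<lambda>(x, \<xi>). f x * fchar x \<xi> * h \<xi>)"
    by (rule Bochner_Integration.integrable_bound[OF integrable_pair_mult[OF f h]])
      (auto simp: norm_mult)
  have "(LINT \<xi>|lborel. LINT x|lborel. f x * fchar x \<xi> * h \<xi>)
      = (LINT x|lborel. LINT \<xi>|lborel. f x * fchar x \<xi> * h \<xi>)"
    using lborel_pair.Fubini_integral[OF i] by simp
  moreover have "fourier_integral f \<xi> * h \<xi> = (LINT x|lborel. f x * fchar x \<xi> * h \<xi>)" for \<xi>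
    unfolding fourier_integral_def by (rule integral_mult_left_zero[symmetric])
  moreover have "f x * fourier_integral h x = (LINT \<xi>|lborel. f x * fchar x \<xi> * h \<xi>)" for x
    unfolding fourier_integral_def integral_mult_right_zero[symmetric]
    by (simp add: ac_simps inner_commute)
  ultimately show ?thesis by (simp only:)
qed

section \<open>Gaussians\<close>

text \<open>The definition of \<open>lborel\<close> has interval measures as factors; with
  one-dimensional \<open>lborel\<close> in their place, integrals of products factor over the
  coordinates.\<close>

lemma lborel_eq_PiM:
  "(lborel :: 'a::euclidean_space measure)
    = distr (Pi\<^sub>M Basis (\<lambda>b. lborel)) borel (\<lambda>f. \<Sum>b\<in>Basis. f b *\<^sub>R b)"
  by (subst lborel_def) (simp add: lborel_eq_real)

lemma
  fixes f :: "'a::euclidean_space \<Rightarrow> real \<Rightarrow> complex"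
  assumes f: "\<And>b. b \<in> Basis \<Longrightarrow> integrable lborel (f b)"
  shows integrable_prod_Basis: "integrable lborel (\<lambda>x. \<Prod>b\<in>Basis. f b (x \<bullet> b))"
    and integral_prod_Basis:
      "(LINT x|lborel. (\<Prod>b\<in>Basis. f b (x \<bullet> b))) = (\<Prod>b\<in>Basis. LINT t|lborel. f b t)"
proof -
  interpret product_sigma_finite "\<lambda>b::'a. lborel :: real measure" 
    by standard (rule lborel.sigma_finite_countable)
  have m: "f b \<in> borel_measurable borel" if "b \<in> Basis" for b
    using f[OF that] by auto
  have [measurable]: "(\<lambda>x. \<Prod>b\<in>Basis. f b (x \<bullet> b)) \<in> borel_measurable borel"
    by (intro borel_measurable_prod measurable_compose[OF _ m]) auto
  have [measurable]: "(\<lambda>f. \<Sum>b\<in>Basis. f b *\<^sub>R b) \<in> Pi\<^sub>M Basis (\<lambda>b::'a. lborel) \<rightarrow>\<^sub>M borel"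
    by measurable
  have eq: "(\<Prod>b\<in>Basis. f b ((\<Sum>b\<in>Basis. g b *\<^sub>R b) \<bullet> b)) = (\<Prod>b\<in>Basis. f b (g b))" for g
    by (intro prod.cong refl) (simp add: inner_sum_left_Basis)
  show "integrable lborel (\<lambda>x. \<Prod>b\<in>Basis. f b (x \<bullet> b))"
    by (subst lborel_eq_PiM, subst integrable_distr_eq)
      (use product_integrable_prod[of Basis f] f in \<open>simp_all add: eq\<close>)
  show "(LINT x|lborel. (\<Prod>b\<in>Basis. f b (x \<bullet> b))) = (\<Prod>b\<in>Basis. LINT t|lborel. f b t)"
    by (subst lborel_eq_PiM, subst integral_distr)
      (use product_integral_prod[of Basis f] f in \<open>simp_all add: eq\<close>)
qed

text \<open>Up to scaling this is the characteristic function of the standard normal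
  distribution.\<close>

lemma
  shows integrable_gauss_1d: "integrable lborel (\<lambda>t. of_real (exp (- pi * t\<^sup>2)) * exp (- (2 * of_real pi * \<i> * of_real (t * s))) :: complex)"
    and integral_gauss_1d: "(LINT t|lborel. of_real (exp (- pi * t\<^sup>2)) * exp (- (2 * of_real pi * \<i> * of_real (t * s))))
      = complex_of_real (exp (- pi * s\<^sup>2))"
proof -
  \<comment> \<open>Chosen so that (c t)^2 / 2 = \<pi> t^2; the same c is the normalizing constant
    of the normal density, so c times the density at c t is exactly exp (- \<pi> t^2).\<close>
  define c where "c = sqrt (2 * pi)"
  have c: "c > 0" "c\<^sup>2 = 2 * pi" unfolding c_def by auto
  define f where "f x = std_normal_density x *\<^sub>R iexp (- c * s * x)" for x
  have f_int: "integrable lborel f"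
    unfolding f_def
    by (rule Bochner_Integration.integrable_bound[OF integrable_normal_density[of 1 0]])
      (auto simp: norm_mult)
  have eq: "c *\<^sub>R f (0 + c * t) = of_real (exp (- pi * t\<^sup>2)) * exp (- (2 * of_real pi * \<i> * of_real (t * s)))" for t
  proof -
    have "c * std_normal_density (c * t) = exp (- pi * t\<^sup>2)"
      using c unfolding std_normal_density_def c_def[symmetric] by (simp add: power_mult_distrib)
    moreover have "iexp (- c * s * (c * t)) = exp (- (2 * of_real pi * \<i> * of_real (t * s)))"
    proof -
      have "- c * s * (c * t) = - (c\<^sup>2 * (t * s))" by (simp add: power2_eq_square)
      also have "\<dots> = - (2 * pi * (t * s))" by (simp only: c(2))
      finally show ?thesis by (simp only:) (simp add: mult_ac)
    qed
    ultimately show ?thesis by (simp add: f_def scaleR_conv_of_real flip: of_real_mult)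
  qed
  show "integrable lborel (\<lambda>t. of_real (exp (- pi * t\<^sup>2)) * exp (- (2 * of_real pi * \<i> * of_real (t * s))) :: complex)"
    using lborel_integrable_real_affine[OF f_int, of c 0] c unfolding eq[symmetric] by simp
  have "(LINT x|lborel. f x) = char std_normal_distribution (- c * s)"
    unfolding char_def f_def by (subst integral_density) auto
  also have "\<dots> = of_real (exp (- (c * s)\<^sup>2 / 2))" by (simp add: char_std_normal_distribution)
  also have "(c * s)\<^sup>2 = 2 * pi * s\<^sup>2" by (simp add: power_mult_distrib c)
  finally have "(LINT x|lborel. f x) = of_real (exp (- pi * s\<^sup>2))" by simp
  moreover have "(LINT x|lborel. f x) = c *\<^sub>R (LINT x|lborel. f (0 + c * x))"
    using lborel_integral_real_affine[of c f 0] c by simp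
  ultimately show "(LINT t|lborel. of_real (exp (- pi * t\<^sup>2)) * exp (- (2 * of_real pi * \<i> * of_real (t * s))))
      = complex_of_real (exp (- pi * s\<^sup>2))"
    unfolding eq[symmetric] by simp
qed

text \<open>The normalization makes this function equal to its own Fourier transform, with integral
  1. Complex values let it be an argument of \<open>fourier_integral\<close>.\<close>

definition gauss :: "real ^ 'n \<Rightarrow> complex" where
  "gauss x = of_real (exp (- pi * (norm x)\<^sup>2))"

lemma gauss_continuous: "continuous_on UNIV gauss"
  unfolding gauss_def by (intro continuous_intros)

lemma gauss_measurable [measurable]: "gauss \<in> borel_measurable borel"
  by (rule borel_measurable_continuous_onI[OF gauss_continuous])

lemma gauss_0 [simp]: "gauss 0 = 1"
  by (simp add: gauss_def)

lemma norm_gauss: "cmod (gauss x) = Re (gauss x)"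
  by (simp add: gauss_def)

lemma gauss_fchar_eq_prod: 
  "gauss x * fchar x y = (\<Prod>b\<in>Basis. of_real (exp (- pi * (x \<bullet> b)\<^sup>2)) 
    * exp (- (2 * of_real pi * \<i> * of_real ((x \<bullet> b) * (y \<bullet> b)))))"
proof -
  have "(norm x)\<^sup>2 = (\<Sum>b\<in>Basis. (x \<bullet> b)\<^sup>2)" 
    unfolding power2_norm_eq_inner by (subst euclidean_inner) (simp add: power2_eq_square)
  then have "gauss x = (\<Prod>b\<in>Basis. of_real (exp (- pi * (x \<bullet> b)\<^sup>2)))"
    by (simp add: gauss_def sum_distrib_left exp_sum flip: sum_negf)
  moreover have "fchar x y = (\<Prod>b\<in>Basis. exp (- (2 * of_real pi * \<i> * of_real ((x \<bullet> b) * (y \<bullet> b)))))"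
    by (subst euclidean_inner) (simp add: sum_distrib_left exp_sum flip: sum_negf)
  ultimately show ?thesis by (simp only: prod.distrib)
qed

lemma integrable_gauss: "integrable lborel (gauss :: real ^ 'n \<Rightarrow> complex)"
proof -
  have "integrable lborel (\<lambda>x :: real ^ 'n. gauss x * fchar x 0)"
    unfolding gauss_fchar_eq_prod 
    by (rule integrable_prod_Basis[where f = "\<lambda>b t. of_real (exp (- pi * t\<^sup>2)) * exp (- (2 * of_real pi * \<i> * of_real (t * (0 \<bullet> b))))"])
      (rule integrable_gauss_1d)
  then show ?thesis by simp
qed

lemma fourier_integral_gauss: "fourier_integral gauss y = gauss y"
  unfolding fourier_integral_def gauss_fchar_eq_prod
  unfolding integral_prod_Basis[where f = "\<lambda>b t. of_real (exp (- pi * t\<^sup>2)) * exp (- (2 * of_real pi * \<i> * of_real (t * (y \<bullet> b))))", OF integrable_gauss_1d] 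
    integral_gauss_1d
  using gauss_fchar_eq_prod[of y 0] by simp

section \<open>Affine changes of variables\<close>

lemma
  fixes f :: "'a::euclidean_space \<Rightarrow> 'b::{banach, second_countable_topology}"
  assumes c: "c \<noteq> 0" and [measurable]: "f \<in> borel_measurable borel"
  shows integral_affine: "integral\<^sup>L lborel f = \<bar>c\<bar> ^ DIM('a) *\<^sub>R (LINT x|lborel. f (t + c *\<^sub>R x))"
    and integrable_affine_iff: "integrable lborel (\<lambda>x. f (t + c *\<^sub>R x)) \<longleftrightarrow> integrable lborel f"
proof -
  show "integral\<^sup>L lborel f = \<bar>c\<bar> ^ DIM('a) *\<^sub>R (LINT x|lborel. f (t + c *\<^sub>R x))"
    by (subst lborel_affine[OF c, of t], subst integral_density, simp, simp, simp, subst integral_distr) auto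
  have "integrable lborel f \<longleftrightarrow> integrable lborel (\<lambda>x. \<bar>c\<bar> ^ DIM('a) *\<^sub>R f (t + c *\<^sub>R x))"
    by (subst lborel_affine[OF c, of t], subst integrable_density, simp, simp, simp, subst integrable_distr_eq) auto
  moreover have "\<dots> \<longleftrightarrow> integrable lborel (\<lambda>x. f (t + c *\<^sub>R x))"
    using c integrable_scaleR_right[of "inverse (\<bar>c\<bar> ^ DIM('a))" lborel "\<lambda>x. \<bar>c\<bar> ^ DIM('a) *\<^sub>R f (t + c *\<^sub>R x)"]
    by auto
  ultimately show "integrable lborel (\<lambda>x. f (t + c *\<^sub>R x)) \<longleftrightarrow> integrable lborel f"
    by simp
qed

lemma integral_reflect:
  fixes f :: "'a::euclidean_space \<Rightarrow> 'b::{banach, second_countable_topology}"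
  assumes "f \<in> borel_measurable borel"
  shows "(LINT x|lborel. f (- x)) = integral\<^sup>L lborel f"
  using integral_affine[OF _ assms, of "-1" 0] by simp

lemma integrable_reflect:
  fixes f :: "'a::euclidean_space \<Rightarrow> 'b::{banach, second_countable_topology}"
  assumes "integrable lborel f"
  shows "integrable lborel (\<lambda>x. f (- x))"
  using integrable_affine_iff[of "-1" f 0] assms by simp

lemma fourier_integral_dilate:
  fixes f :: "real ^ 'n \<Rightarrow> complex"
  assumes c: "c > 0" and f: "integrable lborel f"
  shows "fourier_integral (\<lambda>x. f (c *\<^sub>R x)) \<xi> = fourier_integral f (\<xi> /\<^sub>R c) / of_real c ^ CARD('n)"
proof -
  have [measurable]: "f \<in> borel_measurable borel" using f by auto
  have "fourier_integral f (\<xi> /\<^sub>R c) 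
    = c ^ CARD('n) *\<^sub>R (LINT x|lborel. f (0 + c *\<^sub>R x) * fchar (0 + c *\<^sub>R x) (\<xi> /\<^sub>R c))"
    unfolding fourier_integral_def using c 
    by (subst integral_affine[where c = c and t = 0]) auto
  also have "\<dots> = c ^ CARD('n) *\<^sub>R fourier_integral (\<lambda>x. f (c *\<^sub>R x)) \<xi>"
  proof -
    have "(0 + c *\<^sub>R x) \<bullet> (\<xi> /\<^sub>R c) = x \<bullet> \<xi>" for x using c by simp
    then show ?thesis unfolding fourier_integral_def by (simp only: add_0)
  qed
  finally show ?thesis using c by (simp add: scaleR_conv_of_real)
qed

section \<open>Plancherel's identity\<close>

lemma cnj_fourier_integral:
  assumes f: "integrable lborel f"
  shows "cnj (fourier_integral f \<xi>) = fourier_integral (\<lambda>y. cnj (f (- y))) \<xi>"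
proof -
  have [measurable]: "f \<in> borel_measurable borel" using f by auto
  have "cnj (fourier_integral f \<xi>) = (LINT y|lborel. cnj (f y) * fchar (- y) \<xi>)"
    unfolding fourier_integral_def
    by (simp only: Bochner_Integration.integral_cnj[symmetric] complex_cnj_mult cnj_fchar)
  also have "\<dots> = (LINT y|lborel. cnj (f (- y)) * fchar (- (- y)) \<xi>)"
    by (rule integral_reflect[symmetric]) measurable
  finally show ?thesis by (simp add: fourier_integral_def)
qed

text \<open>The Gaussian weight makes the triple integral absolutely convergent; the right-hand side
  is a mollification of \<open>g\<close> tested against \<open>g\<close>.\<close>

lemma gauss_weighted_plancherel:
  fixes g :: "real ^ 'n \<Rightarrow> complex"
  assumes g: "integrable lborel g" and d: "d > 0"
  shows "(LINT \<xi>|lborel. fourier_integral g \<xi> * (cnj (fourier_integral g \<xi>) * gauss (d *\<^sub>R \<xi>)))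
    = (LINT x|lborel. g x * (LINT z|lborel. cnj (g (x - d *\<^sub>R z)) * gauss z))"
proof -
  have [measurable]: "g \<in> borel_measurable borel" using g by auto
  define G where "G = fourier_integral g"
  have [measurable]: "G \<in> borel_measurable borel" unfolding G_def by measurable
  \<comment> \<open>The conjugate reflection of \<open>g\<close> has the conjugate transform, so the
    multiplication formula can move the transform from it to the Gaussian.\<close>
  define g' where "g' y = cnj (g (- y))" for y
  have g': "integrable lborel g'"
    unfolding g'_def using integrable_reflect[OF g] by simp
  then have g'_meas [measurable]: "g' \<in> borel_measurable borel" by auto
  have gd: "integrable lborel (\<lambda>\<xi>::real ^ 'n. gauss (d *\<^sub>R \<xi>))"
    using integrable_affine_iff[of d "gauss :: real ^ 'n \<Rightarrow> complex" 0] d integrable_gauss by simp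
  have h: "integrable lborel (\<lambda>\<xi>. cnj (G \<xi>) * gauss (d *\<^sub>R \<xi>))"
    by (rule integrable_bounded_mult(2)[OF gd, where B = "LINT x|lborel. cmod (g x)"])
      (auto simp: G_def fourier_integral_bound g)
  have "fourier_integral (\<lambda>\<xi>. cnj (G \<xi>) * gauss (d *\<^sub>R \<xi>)) x
      = (LINT z|lborel. cnj (g (x - d *\<^sub>R z)) * gauss z)" for x
  proof -
    have "fourier_integral (\<lambda>\<xi>. cnj (G \<xi>) * gauss (d *\<^sub>R \<xi>)) x
        = (LINT \<xi>|lborel. fourier_integral g' \<xi> * (gauss (d *\<^sub>R \<xi>) * fchar \<xi> x))"
      unfolding fourier_integral_def[of _ x] G_def cnj_fourier_integral[OF g] g'_def
      by (simp add: mult.assoc)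
    also have "\<dots> = (LINT y|lborel. g' y * fourier_integral (\<lambda>\<xi>. gauss (d *\<^sub>R \<xi>) * fchar \<xi> x) y)"
      by (rule fourier_integral_mult_formula[OF g' fourier_integrable[OF gd]])
    also have "\<dots> = (LINT y|lborel. g' y * (gauss ((x + y) /\<^sub>R d) / of_real d ^ CARD('n)))"
    proof -
      \<comment> \<open>A modulation by the character at \<open>x\<close> translates the transform
        by \<open>x\<close>.\<close>
      have "fourier_integral (\<lambda>\<xi>. gauss (d *\<^sub>R \<xi>) * fchar \<xi> x) y = fourier_integral (\<lambda>\<xi>. gauss (d *\<^sub>R \<xi>)) (x + y)" for y
        unfolding fourier_integral_def
        by (simp add: inner_add_right algebra_simps flip: exp_add)
      then show ?thesis
        by (simp only: fourier_integral_dilate[OF d integrable_gauss] fourier_integral_gauss)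
    qed
    \<comment> \<open>The substitution y = - x + d z; its Jacobian d^n cancels the factor of the
      dilated Gaussian.\<close>
    also have "\<dots> = d ^ CARD('n) *\<^sub>R (LINT z|lborel. g' (- x + d *\<^sub>R z) * (gauss ((x + (- x + d *\<^sub>R z)) /\<^sub>R d) / of_real d ^ CARD('n)))"
      by (subst integral_affine[where c = d and t = "- x"]) (use d in auto)
    also have "\<dots> = (LINT z|lborel. cnj (g (x - d *\<^sub>R z)) * gauss z)"
    proof -
      have "(x + (- x + d *\<^sub>R z)) /\<^sub>R d = z" "- (- x + d *\<^sub>R z) = x - d *\<^sub>R z" for z
        using d by simp_all
      then show ?thesis
        using d unfolding g'_def by (simp add: scaleR_conv_of_real[of "d ^ _"])
    qed
    finally show ?thesis .
  qed
  then show ?thesis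
    using fourier_integral_mult_formula[OF g h] by (simp add: G_def)
qed

text \<open>The right-hand side of the weighted identity converges because \<open>g\<close> is
  bounded and continuous. On the left no dominating function is known at first: Fatou's lemma shows
  that |G|^2 is integrable, and only then does |G|^2 dominate the weighted integrands and identify
  the limit.\<close>

lemma plancherel_compactly_supported:
  fixes g :: "real ^ 'n \<Rightarrow> complex"
  assumes cs: "compactly_supported g"
  shows "square_integrable (fourier_integral g)"
    and "norm (abs_L2 (fourier_integral g)) = norm (abs_L2 g)"
proof -
  note g = compactly_supported_integrable[OF cs] and sq = compactly_supported_square_integrable[OF cs]
  have [measurable]: "g \<in> borel_measurable borel" using g by auto
  obtain N B where "B > 0" "\<And>x. cmod (g x) \<le> B * indicator (cball 0 N) x" 
    using compactly_supportedE[OF cs] by metis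
  then have B: "cmod (g x) \<le> B" for x 
    by (rule_tac order_trans[of _ "B * indicator (cball 0 N) x"]) (auto simp: indicator_def)
  have g_cont: "isCont g x" for x
    using cs by (simp add: compactly_supported_def continuous_on_eq_continuous_at)
  define G where "G = fourier_integral g"
  have [measurable]: "G \<in> borel_measurable borel" unfolding G_def by measurable
  define d where "d k = 1 / (real k + 1)" for k
  have d: "d k > 0" for k by (simp add: d_def)
  have d_lim: "d \<longlonglongrightarrow> 0" unfolding d_def
    using LIMSEQ_inverse_real_of_nat by (simp add: inverse_eq_divide add.commute)
  define L where "L = (LINT x|lborel. (cmod (g x))\<^sup>2)"
  have gauss1: "(LINT z::real ^ 'n|lborel. gauss z) = 1"
    using fourier_integral_gauss[of "0 :: real ^ 'n"] by (simp add: fourier_integral_def)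
  have inner: "(\<lambda>k. LINT z|lborel. cnj (g (x - d k *\<^sub>R z)) * gauss z) \<longlonglongrightarrow> cnj (g x)" for x
  proof -
    have "(\<lambda>k. LINT z|lborel. cnj (g (x - d k *\<^sub>R z)) * gauss z) \<longlonglongrightarrow> (LINT z::real ^ 'n|lborel. cnj (g x) * gauss z)"
    proof (rule integral_dominated_convergence)
      show "integrable lborel (\<lambda>z::real ^ 'n. B * cmod (gauss z))"
        by (intro integrable_mult_right integrable_norm integrable_gauss)
      show "AE z in lborel. (\<lambda>k. cnj (g (x - d k *\<^sub>R z)) * gauss z) \<longlonglongrightarrow> cnj (g x) * gauss z"
      proof (rule AE_I2)
        fix z
        have "(\<lambda>k. x - d k *\<^sub>R z) \<longlonglongrightarrow> x - 0 *\<^sub>R z"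
          by (rule tendsto_diff[OF tendsto_const tendsto_scaleR[OF d_lim tendsto_const]])
        then have "(\<lambda>k. g (x - d k *\<^sub>R z)) \<longlonglongrightarrow> g (x - 0 *\<^sub>R z)"
          by (rule isCont_tendsto_compose[rotated]) (rule g_cont)
        then have "(\<lambda>k. g (x - d k *\<^sub>R z)) \<longlonglongrightarrow> g x" by simp
        then show "(\<lambda>k. cnj (g (x - d k *\<^sub>R z)) * gauss z) \<longlonglongrightarrow> cnj (g x) * gauss z"
          by (rule tendsto_mult[OF tendsto_cnj tendsto_const])
      qed
    qed (auto simp: norm_mult B intro!: mult_right_mono)
    then show ?thesis by (simp add: gauss1)
  qed
  have inner_bd: "cmod (LINT z|lborel. cnj (g (x - d k *\<^sub>R z)) * gauss z) \<le> B" for x k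
  proof -
    have "cmod (LINT z|lborel. cnj (g (x - d k *\<^sub>R z)) * gauss z)
       \<le> (LINT z|lborel. cmod (cnj (g (x - d k *\<^sub>R z)) * gauss z))" by (rule integral_norm_bound)
    also have "\<dots> \<le> (LINT z::real ^ 'n|lborel. B * cmod (gauss z))"
    proof (rule integral_mono')
      show "integrable lborel (\<lambda>z::real ^ 'n. B * cmod (gauss z))"
        by (intro integrable_mult_right integrable_norm integrable_gauss)
    qed (use \<open>B > 0\<close> in \<open>auto simp: norm_mult B intro!: mult_right_mono\<close>)
    also have "(LINT z::real ^ 'n|lborel. B * cmod (gauss z)) = B * (LINT z::real ^ 'n|lborel. Re (gauss z))"
      by (simp only: norm_gauss integral_mult_right_zero)
    also have "(LINT z::real ^ 'n|lborel. Re (gauss z)) = 1"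
      using integral_Re[OF integrable_gauss[where 'n = 'n]] gauss1 by (simp only: one_complex.sel)
    finally show ?thesis by simp
  qed
  have outer: "(\<lambda>k. LINT x|lborel. g x * (LINT z|lborel. cnj (g (x - d k *\<^sub>R z)) * gauss z)) 
      \<longlonglongrightarrow> (LINT x|lborel. g x * cnj (g x))"
  proof (rule integral_dominated_convergence)
    show "integrable lborel (\<lambda>x. cmod (g x) * B)" using g by simp
    show "AE x in lborel. (\<lambda>k. g x * (LINT z|lborel. cnj (g (x - d k *\<^sub>R z)) * gauss z)) \<longlonglongrightarrow> g x * cnj (g x)"
      by (intro AE_I2 tendsto_intros inner)
  qed (auto simp: norm_mult intro!: mult_left_mono inner_bd)
  define I where "I k = (LINT \<xi>|lborel. (cmod (G \<xi>))\<^sup>2 * Re (gauss (d k *\<^sub>R \<xi>)))" for k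
  have I_eq: "complex_of_real (I k) = (LINT x|lborel. g x * (LINT z|lborel. cnj (g (x - d k *\<^sub>R z)) * gauss z))" for k
    unfolding gauss_weighted_plancherel[OF g d, symmetric] I_def integral_complex_of_real[symmetric] G_def
    by (intro Bochner_Integration.integral_cong refl)
      (simp only: of_real_mult complex_norm_square mult.assoc, simp add: gauss_def)
  have "(LINT x|lborel. g x * cnj (g x)) = complex_of_real L"
    unfolding L_def integral_complex_of_real[symmetric] by (simp only: complex_norm_square)
  then have I_lim: "I \<longlonglongrightarrow> L"
    using outer unfolding I_eq[symmetric] by (simp add: tendsto_of_real_iff)
  \<comment> \<open>The square root of the weight makes the weighted integrand a squared modulus,
    the form in which Fatou's lemma is available.\<close>
  define u where "u = (\<lambda>k \<xi>. G \<xi> * complex_of_real (sqrt (Re (gauss (d k *\<^sub>R \<xi>)))))"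
  have u_sq: "(cmod (u k \<xi>))\<^sup>2 = (cmod (G \<xi>))\<^sup>2 * Re (gauss (d k *\<^sub>R \<xi>))" for k \<xi>
    by (simp add: u_def norm_mult power_mult_distrib gauss_def)
  have gauss_lim: "(\<lambda>k. Re (gauss (d k *\<^sub>R \<xi>))) \<longlonglongrightarrow> 1" for \<xi>
  proof -
    have "(\<lambda>k. d k *\<^sub>R \<xi>) \<longlonglongrightarrow> 0 *\<^sub>R \<xi>"
      by (rule tendsto_scaleR[OF d_lim tendsto_const])
    moreover have "isCont gauss (0 *\<^sub>R \<xi>)"
      using gauss_continuous continuous_on_eq_continuous_at open_UNIV by blast
    ultimately have "(\<lambda>k. gauss (d k *\<^sub>R \<xi>)) \<longlonglongrightarrow> gauss (0 *\<^sub>R \<xi>)"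
      by (rule isCont_tendsto_compose[rotated])
    then show ?thesis using tendsto_Re[of _ "gauss 0"] by simp
  qed
  have "(\<integral>\<^sup>+\<xi>. ennreal ((cmod (G \<xi>))\<^sup>2) \<partial>lborel) \<le> ennreal (L + 1)"
  proof (rule nn_integral_fatou_square[where u = u])
    show "AE \<xi> in lborel. (\<lambda>k. u k \<xi>) \<longlonglongrightarrow> G \<xi>"
    proof (rule AE_I2)
      fix \<xi>
      have "(\<lambda>k. u k \<xi>) \<longlonglongrightarrow> G \<xi> * of_real (sqrt 1)"
        unfolding u_def by (intro tendsto_intros gauss_lim)
      then show "(\<lambda>k. u k \<xi>) \<longlonglongrightarrow> G \<xi>" by simp
    qed
    \<comment> \<open>For fixed k, boundedness of \<open>G\<close> suffices, since the Gaussian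
      factor is integrable.\<close>
    have gi: "integrable lborel (\<lambda>\<xi>. (cmod (G \<xi>))\<^sup>2 * Re (gauss (d k *\<^sub>R \<xi>)))" for k
    proof (rule Bochner_Integration.integrable_bound)
      show "integrable lborel (\<lambda>\<xi>::real ^ 'n. (LINT x|lborel. cmod (g x))\<^sup>2 * cmod (gauss (d k *\<^sub>R \<xi>)))"
        using integrable_affine_iff[of "d k" "gauss :: real ^ 'n \<Rightarrow> complex" 0] d[of k] integrable_gauss
        by (intro integrable_mult_right integrable_norm) simp
    qed (auto simp: gauss_def abs_mult G_def fourier_integral_bound[OF g] intro!: mult_right_mono power_mono)
    have "eventually (\<lambda>k. I k < L + 1) sequentially"
      by (rule order_tendstoD(2)[OF I_lim]) simp
    then show "eventually (\<lambda>k. (\<integral>\<^sup>+x. ennreal ((cmod (u k x))\<^sup>2) \<partial>lborel) \<le> ennreal (L + 1)) sequentially"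
    proof eventually_elim
      case (elim k)
      have "(\<integral>\<^sup>+x. ennreal ((cmod (u k x))\<^sup>2) \<partial>lborel) = ennreal (I k)"
        unfolding u_sq I_def by (rule nn_integral_eq_integral[OF gi]) (simp add: gauss_def)
      with elim show ?case by (simp add: ennreal_leI)
    qed
  qed (auto simp: u_def)
  then show sqG: "square_integrable (fourier_integral g)"
    unfolding G_def[symmetric] by (intro square_integrableI_nn_integral) (auto intro: le_less_trans)
  have "I \<longlonglongrightarrow> (LINT \<xi>|lborel. (cmod (G \<xi>))\<^sup>2)"
    unfolding I_def
  proof (rule integral_dominated_convergence)
    show "integrable lborel (\<lambda>\<xi>. (cmod (G \<xi>))\<^sup>2)"
      using sqG by (simp add: square_integrable_def G_def)
    show "AE \<xi> in lborel. (\<lambda>k. (cmod (G \<xi>))\<^sup>2 * Re (gauss (d k *\<^sub>R \<xi>))) \<longlonglongrightarrow> (cmod (G \<xi>))\<^sup>2"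
    proof (rule AE_I2)
      show "(\<lambda>k. (cmod (G \<xi>))\<^sup>2 * Re (gauss (d k *\<^sub>R \<xi>))) \<longlonglongrightarrow> (cmod (G \<xi>))\<^sup>2" for \<xi>
        using tendsto_mult[OF tendsto_const[of "(cmod (G \<xi>))\<^sup>2"] gauss_lim[of \<xi>]] by (simp only: mult_1_right)
    qed
  qed (auto simp: gauss_def abs_mult intro!: mult_left_le)
  then have "(norm (abs_L2 G))\<^sup>2 = (norm (abs_L2 g))\<^sup>2"
    using I_lim sq sqG LIMSEQ_unique unfolding G_def[symmetric] by (simp add: norm_abs_L2 L_def)
  then show "norm (abs_L2 (fourier_integral g)) = norm (abs_L2 g)"
    by (simp add: G_def power2_eq_iff_nonneg)
qed

text \<open>Approximation in L1 and L2 together with Fatou's lemma yields only the inequality.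
  Applied to the differences \<open>g k - f\<close>, that inequality gives norm convergence of the
  transforms, and equality follows in the limit.\<close>

lemma plancherel_integral:
  fixes f :: "real ^ 'n \<Rightarrow> complex"
  assumes int: "integrable lborel f" and sq: "square_integrable f"
  shows "square_integrable (fourier_integral f)"
    and "norm (abs_L2 (fourier_integral f)) = norm (abs_L2 f)"
proof -
  \<comment> \<open>Proved for every such \<open>f\<close>, because it is used below both for the
    given function and for \<open>g k - f\<close>.\<close>
  have Fatou: "square_integrable (fourier_integral f) \<and> norm (abs_L2 (fourier_integral f)) \<le> norm (abs_L2 f)"
    and approx: "\<exists>g. (\<forall>k::nat. compactly_supported (g k)) \<and> (\<lambda>k. abs_L2 (g k)) \<longlonglongrightarrow> abs_L2 f"
    if int: "integrable lborel f" and sq: "square_integrable f" for f :: "real ^ 'n \<Rightarrow> complex"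
  proof -
    have [measurable]: "f \<in> borel_measurable borel" using int by auto
    have ex: "\<forall>k. \<exists>g. compactly_supported g \<and> (LINT x|lborel. cmod (f x - g x)) < 1 / (real k + 1) \<and>
        (LINT x|lborel. (cmod (f x - g x))\<^sup>2) < 1 / (real k + 1)"
    proof
      fix k
      obtain h where "compactly_supported h" "(LINT x|lborel. cmod (f x - h x)) < 1 / (real k + 1)"
        "(LINT x|lborel. (cmod (f x - h x))\<^sup>2) < 1 / (real k + 1)"
        by (rule compactly_supported_dense[of f "1 / (real k + 1)"]) (use int sq in simp_all)
      then show "\<exists>g. compactly_supported g \<and> (LINT x|lborel. cmod (f x - g x)) < 1 / (real k + 1) \<and>
        (LINT x|lborel. (cmod (f x - g x))\<^sup>2) < 1 / (real k + 1)" by blast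
    qed
    from choice[OF ex] obtain g where "\<forall>k. compactly_supported (g k) \<and> (LINT x|lborel. cmod (f x - g k x)) < 1 / (real k + 1) \<and>
        (LINT x|lborel. (cmod (f x - g k x))\<^sup>2) < 1 / (real k + 1)"
      by (elim exE)
    then have g: "\<And>k. compactly_supported (g k)" 
      "\<And>k. (LINT x|lborel. cmod (f x - g k x)) < 1 / (real k + 1)"
      "\<And>k. (LINT x|lborel. (cmod (f x - g k x))\<^sup>2) < 1 / (real k + 1)"
      by blast+
    note gi = compactly_supported_integrable[OF g(1)] and gs = compactly_supported_square_integrable[OF g(1)]
    have d_lim: "(\<lambda>k. 1 / (real k + 1)) \<longlonglongrightarrow> 0"
      using LIMSEQ_inverse_real_of_nat by (simp add: inverse_eq_divide add.commute)
    have lim: "(\<lambda>k. abs_L2 (g k)) \<longlonglongrightarrow> abs_L2 f"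
    proof (rule tendsto_L2_I[OF gs sq])
      show "(\<lambda>k. LINT x|lborel. (cmod (g k x - f x))\<^sup>2) \<longlonglongrightarrow> 0"
        by (rule Lim_null_comparison[OF _ d_lim])
          (use g(3) in \<open>auto simp: norm_minus_commute[of "g _ _"] intro!: always_eventually less_imp_le\<close>)
    qed
    then show "\<exists>g. (\<forall>k::nat. compactly_supported (g k)) \<and> (\<lambda>k. abs_L2 (g k)) \<longlonglongrightarrow> abs_L2 f"
      using g(1) by auto
    have ptw: "(\<lambda>k. fourier_integral (g k) \<xi>) \<longlonglongrightarrow> fourier_integral f \<xi>" for \<xi>
    proof (rule LIM_zero_cancel)
      show "(\<lambda>k. fourier_integral (g k) \<xi> - fourier_integral f \<xi>) \<longlonglongrightarrow> 0"
      proof (rule Lim_null_comparison[OF always_eventually d_lim], rule allI)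
        fix k
        have "norm (fourier_integral (\<lambda>x. f x - g k x) \<xi>) \<le> (LINT x|lborel. cmod (f x - g k x))"
          using int gi by (intro fourier_integral_bound) auto
        then show "norm (fourier_integral (g k) \<xi> - fourier_integral f \<xi>) \<le> 1 / (real k + 1)"
          using g(2)[of k] by (simp add: fourier_integral_diff int gi norm_minus_commute)
      qed
    qed
    \<comment> \<open>The slack \<open>e\<close> is needed because the norms of \<open>g k\<close>
      only tend to the norm of \<open>f\<close>; \<open>field_le_epsilon\<close> removes it
      afterwards.\<close>
    have nn: "(\<integral>\<^sup>+\<xi>. ennreal ((cmod (fourier_integral f \<xi>))\<^sup>2) \<partial>lborel) \<le> ennreal ((norm (abs_L2 f))\<^sup>2 + e)"
      if "e > 0" for e
    proof (rule nn_integral_fatou_square[where u = "\<lambda>k. fourier_integral (g k)"])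
      show "fourier_integral (g k) \<in> borel_measurable borel" for k
        using gi[of k] by (intro fourier_integral_measurable) auto
      have "(\<lambda>k. (norm (abs_L2 (g k)))\<^sup>2) \<longlonglongrightarrow> (norm (abs_L2 f))\<^sup>2"
        by (intro tendsto_intros lim)
      then have "eventually (\<lambda>k. (norm (abs_L2 (g k)))\<^sup>2 < (norm (abs_L2 f))\<^sup>2 + e) sequentially"
        by (rule order_tendstoD) (use \<open>e > 0\<close> in simp)
      then show "eventually (\<lambda>k. (\<integral>\<^sup>+\<xi>. ennreal ((cmod (fourier_integral (g k) \<xi>))\<^sup>2) \<partial>lborel)
         \<le> ennreal ((norm (abs_L2 f))\<^sup>2 + e)) sequentially"
        by eventually_elim 
          (simp add: nn_integral_square_integrable plancherel_compactly_supported g(1) ennreal_leI)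
    qed (use ptw in auto)
    have sqF: "square_integrable (fourier_integral f)"
      using nn[of 1] by (intro square_integrableI_nn_integral) (auto intro: le_less_trans)
    have "(norm (abs_L2 (fourier_integral f)))\<^sup>2 \<le> (norm (abs_L2 f))\<^sup>2"
    proof (rule field_le_epsilon)
      fix e :: real assume "e > 0"
      then have "0 \<le> (norm (abs_L2 f))\<^sup>2 + e" by simp
      then show "(norm (abs_L2 (fourier_integral f)))\<^sup>2 \<le> (norm (abs_L2 f))\<^sup>2 + e"
        using nn[OF \<open>e > 0\<close>] unfolding nn_integral_square_integrable[OF sqF] 
        by (simp only: ennreal_le_iff)
    qed
    then show "square_integrable (fourier_integral f) \<and> norm (abs_L2 (fourier_integral f)) \<le> norm (abs_L2 f)"
      using sqF by (auto intro: power2_le_imp_le)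
  qed
  show sqF: "square_integrable (fourier_integral f)" using Fatou[OF int sq] by blast
  obtain g where g: "\<And>k::nat. compactly_supported (g k)" and lim: "(\<lambda>k. abs_L2 (g k)) \<longlonglongrightarrow> abs_L2 f"
    using approx[OF int sq] by blast
  note gi = compactly_supported_integrable[OF g(1)] and gs = compactly_supported_square_integrable[OF g(1)]
  have "(\<lambda>k. abs_L2 (fourier_integral (g k)) - abs_L2 (fourier_integral f)) \<longlonglongrightarrow> 0"
  proof (rule Lim_null_comparison)
    show "(\<lambda>k. norm (abs_L2 (g k) - abs_L2 f)) \<longlonglongrightarrow> 0"
      using lim by (simp add: LIM_zero_iff tendsto_norm_zero_iff)
    show "eventually (\<lambda>k. norm (abs_L2 (fourier_integral (g k)) - abs_L2 (fourier_integral f))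
      \<le> norm (abs_L2 (g k) - abs_L2 f)) sequentially"
    proof (rule always_eventually, rule allI)
      fix k
      have "abs_L2 (fourier_integral (g k)) - abs_L2 (fourier_integral f) 
          = abs_L2 (fourier_integral (\<lambda>x. g k x - f x))"
        using int gi[of k] by (simp add: abs_L2_minus sqF plancherel_compactly_supported g fourier_integral_diff)
      then show "norm (abs_L2 (fourier_integral (g k)) - abs_L2 (fourier_integral f))
          \<le> norm (abs_L2 (g k) - abs_L2 f)"
        using Fatou[of "\<lambda>x. g k x - f x"] int gi[of k] sq gs[of k] 
        by (simp add: abs_L2_minus square_integrable_diff)
    qed
  qed
  then have "(\<lambda>k. norm (abs_L2 (fourier_integral (g k)))) \<longlonglongrightarrow> norm (abs_L2 (fourier_integral f))"
    by (intro tendsto_norm) (simp add: LIM_zero_iff)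
  then have "(\<lambda>k. norm (abs_L2 (g k))) \<longlonglongrightarrow> norm (abs_L2 (fourier_integral f))"
    by (simp add: plancherel_compactly_supported g)
  moreover have "(\<lambda>k. norm (abs_L2 (g k))) \<longlonglongrightarrow> norm (abs_L2 f)"
    by (intro tendsto_norm lim)
  ultimately show "norm (abs_L2 (fourier_integral f)) = norm (abs_L2 f)"
    by (rule LIMSEQ_unique)
qed

section \<open>The Fourier transform of square integrable functions\<close>

lemma bounded_linear_cscale: "bounded_linear (cscale c :: 'n::finite L2 \<Rightarrow> _)"
proof (rule bounded_linear_intro[where K = "cmod c"])
  show "cscale c (u + v) = cscale c u + cscale c v" for u v :: "'n L2"
    by transfer (auto simp: distrib_left intro!: square_integrable_cmult square_integrable_add)
  show "cscale c (r *\<^sub>R u) = r *\<^sub>R cscale c u" for r and u :: "'n L2"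
    by transfer (auto simp: mult.left_commute intro!: square_integrable_cmult)
  have "(norm (cscale c u))\<^sup>2 = (norm u * cmod c)\<^sup>2" for u :: "'n L2"
    using norm_abs_L2[of "\<lambda>x. c * rep_L2 u x"] abs_L2_cscale[of "rep_L2 u" c]
    by (simp add: square_integrable_cmult norm_mult power_mult_distrib norm_L2_rep)
  then show "norm (cscale c u) \<le> norm u * cmod c" for u :: "'n L2"
    by (simp add: power2_eq_iff_nonneg)
qed

lemma cinner_cscale_left: "cinner (cscale c u) v = c * cinner u v"
  by transfer (simp add: mult.assoc)

text \<open>Im z = Re (- i z). Facts about the real inner product, such as continuity and invariance
  under \<F>, thereby carry over to \<open>cinner\<close>.\<close>

lemma cinner_eq_inner: "cinner u v = Complex (u \<bullet> v) (cscale (- \<i>) u \<bullet> v)"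
  using Re_cinner[of u v] Re_cinner[of "cscale (- \<i>) u" v]
  by (simp add: complex_eq_iff cinner_cscale_left)

lemma continuous_cinner [continuous_intros]:
  "continuous_on S f \<Longrightarrow> continuous_on S g \<Longrightarrow> continuous_on S (\<lambda>x. cinner (f x) (g x))"
  unfolding cinner_eq_inner
  by (intro continuous_on_Complex continuous_intros bounded_linear.continuous_on[OF bounded_linear_cscale])

lemma cinner_eqI:
  assumes "\<And>w. cinner w u = cinner w v" shows "u = v"
proof -
  have "(u - v) \<bullet> u = (u - v) \<bullet> v" using assms[of "u - v"] by (metis Re_cinner)
  then have "(u - v) \<bullet> (u - v) = 0" by (simp add: inner_diff_right)
  then show ?thesis by simp
qed

section \<open>Truncation to balls and extension by density\<close>

definition cutoff :: "nat \<Rightarrow> (real ^ 'n \<Rightarrow> complex) \<Rightarrow> real ^ 'n \<Rightarrow> complex" where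
  "cutoff n f x = (if norm x \<le> real n then f x else 0)"

lemma cutoff_square_integrable:
  assumes f: "square_integrable f" shows "square_integrable (cutoff n f)"
proof -
  have [measurable]: "f \<in> borel_measurable borel" using f by (rule square_integrable_measurable)
  show ?thesis
    unfolding square_integrable_def
  proof
    show m: "cutoff n f \<in> borel_measurable lborel" unfolding cutoff_def by measurable
    show "integrable lborel (\<lambda>x. (cmod (cutoff n f x))\<^sup>2)"
      by (rule Bochner_Integration.integrable_bound[of _ "\<lambda>x. (cmod (f x))\<^sup>2"])
        (use f m in \<open>auto simp: square_integrable_def cutoff_def\<close>)
  qed
qed

text \<open>On the ball, which has finite measure, a \<le> 1 + a^2 bounds the modulus by an
  integrable function.\<close>

lemma cutoff_integrable:
  assumes f: "square_integrable f" shows "integrable lborel (cutoff n f)"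
proof (rule Bochner_Integration.integrable_bound)
  show "integrable lborel (\<lambda>x::real ^ 'a. 1 * indicator (cball 0 (real n)) x + (cmod (f x))\<^sup>2)"
    using f integrable_indicator_cball
    by (intro Bochner_Integration.integrable_add) (auto simp: square_integrable_def)
  have "a \<le> 1 + a\<^sup>2" for a :: real 
    using zero_le_power2[of "a - 1 / 2"] by (simp add: power2_diff power_divide)
  then show "AE x in lborel. norm (cutoff n f x) \<le> norm (1 * indicator (cball 0 (real n)) x + (cmod (f x))\<^sup>2)"
    by (auto simp: cutoff_def)
qed (use square_integrable_measurable[OF cutoff_square_integrable[OF f]] in simp)

lemma cutoff_tendsto:
  assumes f: "square_integrable f"
  shows "(\<lambda>n. abs_L2 (cutoff n f)) \<longlonglongrightarrow> abs_L2 f"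
proof (rule tendsto_L2_I[OF cutoff_square_integrable[OF f] f])
  have [measurable]: "f \<in> borel_measurable borel" "cutoff n f \<in> borel_measurable borel" for n 
    using f cutoff_square_integrable[OF f] by (auto intro: square_integrable_measurable)
  have "(\<lambda>k. LINT x|lborel. (cmod (cutoff k f x - f x))\<^sup>2) \<longlonglongrightarrow> (LINT x::real ^ 'a|lborel. (0::real))"
  proof (rule integral_dominated_convergence)
    show "integrable lborel (\<lambda>x. (cmod (f x))\<^sup>2)" using f by (simp add: square_integrable_def)
    show "AE x in lborel. (\<lambda>k. (cmod (cutoff k f x - f x))\<^sup>2) \<longlonglongrightarrow> 0"
    proof (rule AE_I2)
      fix x :: "real ^ 'a"
      obtain m where m: "norm x \<le> real m" using real_arch_simple by blast
      show "(\<lambda>k. (cmod (cutoff k f x - f x))\<^sup>2) \<longlonglongrightarrow> 0"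
        by (rule tendsto_eventually, use eventually_ge_at_top[of m] in eventually_elim)
          (use m in \<open>auto simp: cutoff_def\<close>)
    qed
  qed (auto simp: cutoff_def)
  then show "(\<lambda>k. LINT x|lborel. (cmod (cutoff k f x - f x))\<^sup>2) \<longlonglongrightarrow> 0" by simp
qed

text \<open>Density of the intersection of L1 and L2 as an induction rule: two continuous maps agree
  on a closed set, so an identity has to be checked only where integral formulas are
  available.\<close>

lemma L2_dense_induct [consumes 1, case_names integrable]:
  assumes "closed {u. P u}"
    and "\<And>f. integrable lborel f \<Longrightarrow> square_integrable f \<Longrightarrow> P (abs_L2 f)"
  shows "P u"
proof -
  have "(\<lambda>n. abs_L2 (cutoff n (rep_L2 u))) \<longlonglongrightarrow> u"
    using cutoff_tendsto[of "rep_L2 u"] by simp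
  then have "u \<in> {u. P u}"
    by (rule closed_sequentially[OF assms(1), rotated])
      (simp add: assms(2) cutoff_integrable cutoff_square_integrable)
  then show ?thesis by simp
qed

lemma fourier_integral_cong_AE:
  assumes "integrable lborel f" "integrable lborel g" "AE x in lborel. f x = g x"
  shows "fourier_integral f = fourier_integral g"
proof
  show "fourier_integral f \<xi> = fourier_integral g \<xi>" for \<xi>
    unfolding fourier_integral_def
    using fourier_integrable[OF assms(1)] fourier_integrable[OF assms(2)] assms(3)
    by (intro integral_cong_AE) auto
qed

lemma norm_diff_fourier_integral:
  assumes "integrable lborel f" "square_integrable f" "integrable lborel g" "square_integrable g"
  shows "norm (abs_L2 (fourier_integral f) - abs_L2 (fourier_integral g)) = norm (abs_L2 f - abs_L2 g)"
  using plancherel_integral(2)[of "\<lambda>x. f x - g x"] assms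
  by (simp add: abs_L2_minus fourier_integral_diff square_integrable_diff plancherel_integral(1))

text \<open>A canonical approximating sequence. Truncation to balls commutes with sums and scalar
  multiples, so linearity holds for each \<open>n\<close> and survives the limit.\<close>

definition fourier_cutoff :: "nat \<Rightarrow> 'n::finite L2 \<Rightarrow> 'n L2" where
  "fourier_cutoff n u = abs_L2 (fourier_integral (cutoff n (rep_L2 u)))"

text \<open>By Plancherel the transforms have the same mutual distances as the truncations, which
  converge; completeness does the rest.\<close>

lemma fourier_cutoff_convergent: "convergent (\<lambda>n. fourier_cutoff n u)"
proof -
  have "Cauchy (\<lambda>n. abs_L2 (cutoff n (rep_L2 u)))"
    by (rule LIMSEQ_imp_Cauchy[OF cutoff_tendsto]) simp
  moreover have "dist (fourier_cutoff m u) (fourier_cutoff n u) 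
      = dist (abs_L2 (cutoff m (rep_L2 u))) (abs_L2 (cutoff n (rep_L2 u)))" for m n
    unfolding fourier_cutoff_def dist_norm
    by (simp add: norm_diff_fourier_integral cutoff_integrable cutoff_square_integrable)
  ultimately have "Cauchy (\<lambda>n. fourier_cutoff n u)"
    by (simp add: Cauchy_def)
  then show ?thesis by (simp add: Cauchy_convergent_iff)
qed

definition fourier_ext :: "'n::finite L2 \<Rightarrow> 'n L2" where
  "fourier_ext u = lim (\<lambda>n. fourier_cutoff n u)"

lemma fourier_ext_tendsto: "(\<lambda>n. fourier_cutoff n u) \<longlonglongrightarrow> fourier_ext u"
  using fourier_cutoff_convergent[of u] unfolding fourier_ext_def by (simp add: convergent_LIMSEQ_iff)

lemma fourier_ext_abs:
  assumes f: "integrable lborel f" "square_integrable f"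
  shows "fourier_ext (abs_L2 f) = abs_L2 (fourier_integral f)"
proof -
  define u where "u = abs_L2 f"
  have "(\<lambda>n. fourier_cutoff n u) \<longlonglongrightarrow> abs_L2 (fourier_integral f)"
  proof (rule LIM_zero_cancel, rule tendsto_norm_zero_cancel)
    have "norm (fourier_cutoff n u - abs_L2 (fourier_integral f)) = norm (abs_L2 (cutoff n (rep_L2 u)) - u)" for n
      unfolding fourier_cutoff_def 
      by (subst norm_diff_fourier_integral) (use f in \<open>auto simp: cutoff_integrable cutoff_square_integrable u_def\<close>)
    moreover have "(\<lambda>n. norm (abs_L2 (cutoff n (rep_L2 u)) - u)) \<longlonglongrightarrow> 0"
      using cutoff_tendsto[of "rep_L2 u"] by (intro tendsto_norm_zero LIM_zero) simp
    ultimately show "(\<lambda>n. norm (fourier_cutoff n u - abs_L2 (fourier_integral f))) \<longlonglongrightarrow> 0" by simp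
  qed
  then show ?thesis using fourier_ext_tendsto[of u] LIMSEQ_unique unfolding u_def by blast
qed

lemma fourier_cutoff_add: "fourier_cutoff n (u + v) = fourier_cutoff n u + fourier_cutoff n v"
proof -
  \<comment> \<open>The chosen representatives add up only almost everywhere, a difference that the
    Fourier integral does not see.\<close>
  have eq: "AE x in lborel. cutoff n (rep_L2 (u + v)) x = cutoff n (rep_L2 u) x + cutoff n (rep_L2 v) x"
    using rep_L2_plus[of u v] by eventually_elim (simp add: cutoff_def)
  have "fourier_integral (cutoff n (rep_L2 (u + v))) 
      = fourier_integral (\<lambda>x. cutoff n (rep_L2 u) x + cutoff n (rep_L2 v) x)"
    by (rule fourier_integral_cong_AE[OF _ _ eq]) (simp_all add: cutoff_integrable)
  then show ?thesis
    unfolding fourier_cutoff_def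
    by (simp add: fourier_integral_add cutoff_integrable abs_L2_plus plancherel_integral(1) cutoff_square_integrable)
qed

lemma fourier_cutoff_cscale: "fourier_cutoff n (cscale c u) = cscale c (fourier_cutoff n u)"
proof -
  have eq: "AE x in lborel. cutoff n (rep_L2 (cscale c u)) x = c * cutoff n (rep_L2 u) x"
    using rep_L2_cscale[of c u] by eventually_elim (simp add: cutoff_def)
  have "fourier_integral (cutoff n (rep_L2 (cscale c u))) 
      = fourier_integral (\<lambda>x. c * cutoff n (rep_L2 u) x)"
    by (rule fourier_integral_cong_AE[OF _ _ eq]) (simp_all add: cutoff_integrable)
  then show ?thesis
    unfolding fourier_cutoff_def
    by (simp add: fourier_integral_cmult cutoff_integrable abs_L2_cscale plancherel_integral(1) cutoff_square_integrable)
qed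

lemma norm_fourier_ext: "norm (fourier_ext u) = norm u"
proof (rule LIMSEQ_unique)
  show "(\<lambda>n. norm (fourier_cutoff n u)) \<longlonglongrightarrow> norm (fourier_ext u)"
    by (intro tendsto_norm fourier_ext_tendsto)
  show "(\<lambda>n. norm (fourier_cutoff n u)) \<longlonglongrightarrow> norm u"
    using tendsto_norm[OF cutoff_tendsto[of "rep_L2 u"]]
    by (simp add: fourier_cutoff_def plancherel_integral(2) cutoff_integrable cutoff_square_integrable)
qed

lemma bounded_clinearI:
  assumes "\<And>u v. B (u + v) = B u + B v" "\<And>c u. B (cscale c u) = cscale c (B u)"
    "\<And>u. norm (B u) \<le> norm u * K"
  shows "bounded_clinear_L2 B"
  unfolding bounded_clinear_L2_def
  by (auto intro!: bounded_linear_intro[where K = K] simp: assms scaleR_eq_cscale)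

lemma bounded_clinear_fourier_ext: "bounded_clinear_L2 (fourier_ext :: 'n::finite L2 \<Rightarrow> _)"
proof (rule bounded_clinearI[where K = 1])
  show "fourier_ext (u + v) = fourier_ext u + fourier_ext v" for u v :: "'n L2"
    by (rule LIMSEQ_unique[OF fourier_ext_tendsto])
      (simp add: fourier_cutoff_add tendsto_add fourier_ext_tendsto)
  show "fourier_ext (cscale c u) = cscale c (fourier_ext u)" for c and u :: "'n L2"
    by (rule LIMSEQ_unique[OF fourier_ext_tendsto])
      (simp add: fourier_cutoff_cscale bounded_linear.tendsto[OF bounded_linear_cscale] fourier_ext_tendsto)
qed (simp add: norm_fourier_ext)

text \<open>Resolves the definite description: \<open>fourier_ext\<close> is a witness, and any
  other bounded operator with these values agrees with it on a dense subspace.\<close>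

lemma fourier_L2_eq: "fourier_L2 = fourier_ext"
  unfolding fourier_L2_def
proof (rule the_equality)
  show "bounded_clinear_L2 (fourier_ext :: 'a L2 \<Rightarrow> _) \<and>
     (\<forall>f. integrable lborel f \<and> square_integrable f \<longrightarrow>
        (AE \<xi> in lborel. rep_L2 (fourier_ext (abs_L2 f)) \<xi> = fourier_integral f \<xi>))"
    using rep_abs_L2[OF plancherel_integral(1)] 
    by (auto simp: bounded_clinear_fourier_ext fourier_ext_abs)
next
  fix F :: "'a L2 \<Rightarrow> 'a L2"
  assume F: "bounded_clinear_L2 F \<and> (\<forall>f. integrable lborel f \<and> square_integrable f \<longrightarrow>
        (AE \<xi> in lborel. rep_L2 (F (abs_L2 f)) \<xi> = fourier_integral f \<xi>))"
  show "F = fourier_ext"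
  proof
    fix u
    have "closed {u. F u = fourier_ext u}"
      using F bounded_clinear_fourier_ext
      by (intro closed_Collect_eq) (auto simp: bounded_clinear_L2_def intro: linear_continuous_on)
    then show "F u = fourier_ext u"
    proof (induction u rule: L2_dense_induct)
      case (integrable f)
      have "abs_L2 (rep_L2 (F (abs_L2 f))) = abs_L2 (fourier_integral f)"
        by (rule abs_L2_eqI) (use F integrable plancherel_integral(1) in auto)
      then show ?case by (simp add: fourier_ext_abs integrable)
    qed
  qed
qed

lemma fourier_L2_abs:
  "integrable lborel f \<Longrightarrow> square_integrable f \<Longrightarrow> fourier_L2 (abs_L2 f) = abs_L2 (fourier_integral f)"
  by (simp add: fourier_L2_eq fourier_ext_abs)

lemma bounded_clinear_fourier_L2: "bounded_clinear_L2 fourier_L2"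
  by (simp add: fourier_L2_eq bounded_clinear_fourier_ext)

lemma norm_fourier_L2 [simp]: "norm (fourier_L2 u) = norm u"
  by (simp add: fourier_L2_eq norm_fourier_ext)

lemma bounded_linear_fourier_L2: "bounded_linear fourier_L2"
  by (rule bounded_clinear_fourier_L2[unfolded bounded_clinear_L2_def, THEN conjunct1])

lemma fourier_L2_cscale: "fourier_L2 (cscale c u) = cscale c (fourier_L2 u)"
  using bounded_clinear_fourier_L2 unfolding bounded_clinear_L2_def by blast

lemmas fourier_L2_add = linear_simps(1)[OF bounded_linear_fourier_L2]
  and fourier_L2_diff = linear_simps(2)[OF bounded_linear_fourier_L2]
  and continuous_fourier_L2 = linear_continuous_on[OF bounded_linear_fourier_L2]

text \<open>Polarization: a linear map that preserves norms preserves inner products.\<close>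

lemma inner_fourier_L2: "fourier_L2 u \<bullet> fourier_L2 v = u \<bullet> v"
  by (simp add: dot_norm flip: fourier_L2_add)

lemma cinner_fourier_L2: "cinner (fourier_L2 u) (fourier_L2 v) = cinner u v"
  by (simp add: cinner_eq_inner inner_fourier_L2 flip: fourier_L2_cscale)

section \<open>Conjugation and surjectivity of the Fourier transform\<close>

lemma square_integrable_cnj: "square_integrable f \<Longrightarrow> square_integrable (\<lambda>x. cnj (f x))"
  by (auto simp: square_integrable_def)

text \<open>Pairing with a conjugate turns the sesquilinear \<open>cinner\<close> into the bilinear
  integral of a product, in which the multiplication formula is stated.\<close>

lift_definition cnj_L2 :: "'n::finite L2 \<Rightarrow> 'n L2" is "\<lambda>f x. cnj (f x)"
  by (auto intro: square_integrable_cnj)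

lemma cnj_L2_abs: "square_integrable f \<Longrightarrow> cnj_L2 (abs_L2 f) = abs_L2 (\<lambda>x. cnj (f x))"
  by (simp add: cnj_L2.abs_eq)

lemma cnj_cnj_L2 [simp]: "cnj_L2 (cnj_L2 u) = u"
  by transfer auto

lemma norm_cnj_L2 [simp]: "norm (cnj_L2 u) = norm u"
  unfolding norm_L2_def by transfer (simp add: mult.commute)

lemma bounded_linear_cnj_L2: "bounded_linear (cnj_L2 :: 'n::finite L2 \<Rightarrow> _)"
proof (rule bounded_linear_intro[where K = 1])
  show "cnj_L2 (u + v) = cnj_L2 u + cnj_L2 v" for u v :: "'n L2"
    by transfer (auto intro!: square_integrable_cnj square_integrable_add)
  show "cnj_L2 (r *\<^sub>R u) = r *\<^sub>R cnj_L2 u" for r and u :: "'n L2"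
    by transfer (auto intro!: square_integrable_cnj square_integrable_cmult)
qed simp

text \<open>The formula for Fourier integrals, extended by density in one argument at a time: first
  \<open>v\<close> for an integrable left argument, then \<open>u\<close>.\<close>

lemma fourier_L2_mult_formula:
  "cinner (fourier_L2 u) (cnj_L2 v) = cinner u (cnj_L2 (fourier_L2 v))"
proof -
  note cont = continuous_intros continuous_on_compose2[OF continuous_fourier_L2]
    bounded_linear.continuous_on[OF bounded_linear_cnj_L2]
  have *: "cinner (fourier_L2 (abs_L2 f)) (cnj_L2 v) = cinner (abs_L2 f) (cnj_L2 (fourier_L2 v))"
    if f: "integrable lborel f" "square_integrable f" for f :: "real ^ 'a \<Rightarrow> complex" and v
  proof -
    have "closed {v. cinner (fourier_L2 (abs_L2 f)) (cnj_L2 v) = cinner (abs_L2 f) (cnj_L2 (fourier_L2 v))}"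
      by (intro closed_Collect_eq cont subset_UNIV) auto
    then show ?thesis
    proof (induction v rule: L2_dense_induct)
      case (integrable h)
      then show ?case using f
        by (simp add: fourier_L2_abs cnj_L2_abs plancherel_integral(1) cinner_abs_L2 square_integrable_cnj
            fourier_integral_mult_formula)
    qed
  qed
  have "closed {u. cinner (fourier_L2 u) (cnj_L2 v) = cinner u (cnj_L2 (fourier_L2 v))}"
    by (intro closed_Collect_eq cont subset_UNIV) auto
  then show ?thesis
    by (induction u rule: L2_dense_induct) (rule *)
qed

text \<open>The isometry \<open>v \<mapsto> cnj (\<F> (cnj v))\<close> is adjoint to the isometry \<open>\<F>\<close>, hence a right inverse.\<close>

lemma bij_fourier_L2: "bij (fourier_L2 :: 'n::finite L2 \<Rightarrow> _)"
proof -
  have "fourier_L2 (cnj_L2 (fourier_L2 (cnj_L2 v))) = v" for v :: "'n L2"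
  proof -
    define w where "w = cnj_L2 (fourier_L2 (cnj_L2 v))"
    have "cinner (fourier_L2 w) v = cinner w w"
      using fourier_L2_mult_formula[of w "cnj_L2 v"] by (simp add: w_def)
    then have "fourier_L2 w \<bullet> v = w \<bullet> w" by (metis Re_cinner)
    moreover have "v \<bullet> v = w \<bullet> w" by (simp add: w_def flip: norm_eq)
    \<comment> \<open>Expanding the square gives w \<bullet> w - 2 (w \<bullet> w) + w \<bullet>
      w.\<close>
    ultimately have "(norm (fourier_L2 w - v))\<^sup>2 = 0"
      unfolding power2_norm_eq_inner
      by (simp add: inner_diff_left inner_diff_right inner_commute[of v "fourier_L2 w"] inner_fourier_L2)
    then show ?thesis by (simp add: w_def)
  qed
  then have "surj (fourier_L2 :: 'n L2 \<Rightarrow> _)" by (rule surjI)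
  moreover have "inj (fourier_L2 :: 'n L2 \<Rightarrow> _)"
  proof (rule injI)
    fix u v :: "'n L2" assume "fourier_L2 u = fourier_L2 v"
    then have "norm (u - v) = 0" using norm_fourier_L2[of "u - v"] by (simp add: fourier_L2_diff)
    then show "u = v" by simp
  qed
  ultimately show ?thesis by (rule bijI[rotated])
qed

section \<open>The Riemann-Lebesgue lemma\<close>

text \<open>A convergent sequence of shifts is bounded, so all translates are supported in one fixed
  ball, where the bound on \<open>g\<close> provides a dominating function.\<close>

lemma isCont_L1_translation:
  fixes g :: "real ^ 'n \<Rightarrow> complex"
  assumes cs: "compactly_supported g"
  shows "isCont (\<lambda>h. LINT x|lborel. cmod (g x - g (x + h))) 0"
  unfolding continuous_at_sequentially
proof (intro allI impI)
  fix u :: "nat \<Rightarrow> real ^ 'n" assume u: "u \<longlonglongrightarrow> 0"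
  have [measurable]: "g \<in> borel_measurable borel" by (rule compactly_supported_measurable[OF cs])
  have g_cont: "isCont g x" for x
    using cs by (simp add: compactly_supported_def continuous_on_eq_continuous_at)
  obtain N B where NB: "N > 0" "B > 0" "\<And>x. cmod (g x) \<le> B * indicator (cball 0 N) x" 
    using compactly_supportedE[OF cs] by metis
  obtain K where K: "K > 0" "\<And>k. norm (u k) \<le> K"
    using convergent_imp_Bseq[of u] u by (auto simp: convergent_def Bseq_def)
  have bd1: "cmod (g x) \<le> B * indicator (cball 0 (N + K)) x" for x
    by (rule order_trans[OF NB(3)]) (use NB K in \<open>auto simp: indicator_def\<close>)
  have bd2: "cmod (g (x + u k)) \<le> B * indicator (cball 0 (N + K)) x" for x k
  proof (rule order_trans[OF NB(3)], rule mult_left_mono)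
    have "norm x \<le> N + K" if "norm (x + u k) \<le> N"
      using that K(2)[of k] norm_triangle_ineq4[of "x + u k" "u k"] by simp
    then show "indicator (cball 0 N) (x + u k) \<le> (indicator (cball 0 (N + K)) x :: real)"
      by (auto simp: indicator_def)
  qed (use NB in simp)
  have "(\<lambda>k. LINT x|lborel. cmod (g x - g (x + u k))) \<longlonglongrightarrow> (LINT x::real ^ 'n|lborel. (0::real))"
  proof (rule integral_dominated_convergence)
    show "integrable lborel (\<lambda>x::real ^ 'n. (2 * B) * indicator (cball 0 (N + K)) x :: real)"
      by (rule integrable_indicator_cball)
    show "AE x in lborel. (\<lambda>k. cmod (g x - g (x + u k))) \<longlonglongrightarrow> 0"
    proof (rule AE_I2)
      fix x
      have "(\<lambda>k. x + u k) \<longlonglongrightarrow> x" using tendsto_add[OF tendsto_const u] by simp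
      then have "(\<lambda>k. g (x + u k)) \<longlonglongrightarrow> g x" by (rule isCont_tendsto_compose[OF g_cont])
      then have "(\<lambda>k. cmod (g x - g (x + u k))) \<longlonglongrightarrow> cmod (g x - g x)"
        by (intro tendsto_norm tendsto_diff tendsto_const)
      then show "(\<lambda>k. cmod (g x - g (x + u k))) \<longlonglongrightarrow> 0" by simp
    qed
    show "AE x in lborel. norm (cmod (g x - g (x + u k))) \<le> (2 * B) * indicator (cball 0 (N + K)) x" for k
    proof (rule AE_I2)
      show "norm (cmod (g x - g (x + u k))) \<le> (2 * B) * indicator (cball 0 (N + K)) x" for x
        using norm_triangle_ineq4[of "g x" "g (x + u k)"] bd1[of x] bd2[of x k] by simp
    qed
  qed auto
  then show "((\<lambda>h. LINT x|lborel. cmod (g x - g (x + h))) \<circ> u) \<longlonglongrightarrow> (LINT x|lborel. cmod (g x - g (x + 0)))"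
    by (simp add: o_def)
qed

text \<open>Translating by half a period, \<open>\<xi> / (2 \<bar>\<xi>\<bar>\<^sup>2)\<close>, changes the sign of the character.\<close>

lemma fourier_integral_half_period:
  fixes g :: "real ^ 'n \<Rightarrow> complex"
  assumes g: "integrable lborel g" and "\<xi> \<noteq> 0"
  shows "2 * cmod (fourier_integral g \<xi>) 
    \<le> (LINT x|lborel. cmod (g x - g (x + \<xi> /\<^sub>R (2 * (norm \<xi>)\<^sup>2))))"
proof -
  define h where "h = \<xi> /\<^sub>R (2 * (norm \<xi>)\<^sup>2)"
  have [measurable]: "g \<in> borel_measurable borel" using g by auto
  have gh: "integrable lborel (\<lambda>x. g (x + h))"
    using integrable_affine_iff[of 1 g h] g by (simp add: add.commute)
  have "h \<bullet> \<xi> = 1 / 2"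
    using \<open>\<xi> \<noteq> 0\<close> by (simp add: h_def power2_norm_eq_inner)
  then have "fchar h \<xi> = exp (- (2 * of_real pi * \<i> * of_real (1 / 2)))" by (simp only:)
  also have "\<dots> = exp (- (\<i> * of_real pi))" by (simp add: mult.commute)
  finally have "fchar h \<xi> = exp (- (\<i> * of_real pi))" .
  then have h: "fchar h \<xi> = - 1" by (simp add: exp_minus)
  have "fourier_integral g \<xi> = (LINT x|lborel. g (h + 1 *\<^sub>R x) * fchar (h + 1 *\<^sub>R x) \<xi>)"
    unfolding fourier_integral_def by (subst integral_affine[of 1 _ h]) auto
  also have "\<dots> = - fourier_integral (\<lambda>x. g (x + h)) \<xi>"
    unfolding fchar_add h by (simp add: fourier_integral_def add.commute)
  finally have "2 * fourier_integral g \<xi> = fourier_integral g \<xi> - fourier_integral (\<lambda>x. g (x + h)) \<xi>"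
    by simp
  also have "\<dots> = fourier_integral (\<lambda>x. g x - g (x + h)) \<xi>"
    using g gh by (simp add: fourier_integral_diff)
  finally have "cmod (2 * fourier_integral g \<xi>) \<le> (LINT x|lborel. cmod (g x - g (x + h)))"
    using fourier_integral_bound[of "\<lambda>x. g x - g (x + h)" \<xi>] g gh by simp
  then show ?thesis by (simp add: norm_mult h_def)
qed

text \<open>The half-period shift has length 1 / (2 |\<xi>|). It tends to 0 at infinity, and
  continuity of translation in L1 bounds the transform.\<close>

lemma riemann_lebesgue_compactly_supported:
  fixes g :: "real ^ 'n \<Rightarrow> complex"
  assumes cs: "compactly_supported g"
  shows "(fourier_integral g \<longlongrightarrow> 0) at_infinity"
proof (rule Lim_null_comparison)
  let ?h = "\<lambda>\<xi>::real ^ 'n. \<xi> /\<^sub>R (2 * (norm \<xi>)\<^sup>2)"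
  let ?\<Phi> = "\<lambda>h. LINT x|lborel. cmod (g x - g (x + h))"
  have "(?h \<longlongrightarrow> 0) at_infinity"
  proof (rule Lim_null_comparison)
    show "((\<lambda>\<xi>::real ^ 'n. inverse (norm \<xi>)) \<longlongrightarrow> 0) at_infinity"
      by (rule tendsto_inverse_0_at_top[OF filterlim_norm_at_top])
    show "eventually (\<lambda>\<xi>. norm (?h \<xi>) \<le> inverse (norm \<xi>)) at_infinity"
      by (rule always_eventually) (simp add: field_simps power2_eq_square)
  qed
  then have "((\<lambda>\<xi>. ?\<Phi> (?h \<xi>)) \<longlongrightarrow> ?\<Phi> 0) at_infinity"
    by (rule isCont_tendsto_compose[OF isCont_L1_translation[OF cs]])
  then show "((\<lambda>\<xi>. ?\<Phi> (?h \<xi>)) \<longlongrightarrow> 0) at_infinity" by simp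
  show "eventually (\<lambda>\<xi>. norm (fourier_integral g \<xi>) \<le> ?\<Phi> (?h \<xi>)) at_infinity"
    unfolding eventually_at_infinity
  proof (intro exI[of _ 1] allI impI)
    fix \<xi> :: "real ^ 'n" assume "1 \<le> norm \<xi>"
    then have "\<xi> \<noteq> 0" by auto
    then show "norm (fourier_integral g \<xi>) \<le> ?\<Phi> (?h \<xi>)"
      using fourier_integral_half_period[OF compactly_supported_integrable[OF cs], of \<xi>] 
        norm_ge_zero[of "fourier_integral g \<xi>"] by linarith
  qed
qed

text \<open>An L1 approximation of \<open>f\<close> approximates its transform uniformly.\<close>

lemma riemann_lebesgue:
  fixes f :: "real ^ 'n \<Rightarrow> complex"
  assumes f: "integrable lborel f"
  shows "(fourier_integral f \<longlongrightarrow> 0) at_infinity"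
proof (rule tendstoI)
  fix e :: real assume "e > 0"
  have "f \<in> borel_measurable borel" using f by auto
  then obtain g where g: "compactly_supported g" "(LINT x|lborel. cmod (f x - g x)) < e / 2"
    using compactly_supported_dense[of f "e / 2"] f \<open>e > 0\<close> by auto
  have "eventually (\<lambda>\<xi>. dist (fourier_integral g \<xi>) 0 < e / 2) at_infinity"
    using \<open>e > 0\<close> by (intro tendstoD[OF riemann_lebesgue_compactly_supported[OF g(1)]]) simp
  then show "eventually (\<lambda>\<xi>. dist (fourier_integral f \<xi>) 0 < e) at_infinity"
  proof eventually_elim
    case (elim \<xi>)
    note gi = compactly_supported_integrable[OF g(1)]
    have "cmod (fourier_integral f \<xi> - fourier_integral g \<xi>) < e / 2"
      using fourier_integral_bound[of "\<lambda>x. f x - g x" \<xi>] f gi g(2) by (simp add: fourier_integral_diff)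
    then show ?case
      using elim norm_triangle_ineq2[of "fourier_integral f \<xi>" "fourier_integral g \<xi>"] by simp
  qed
qed

section \<open>Convolution\<close>

definition convolution :: "(real ^ 'n \<Rightarrow> complex) \<Rightarrow> (real ^ 'n \<Rightarrow> complex) \<Rightarrow> real ^ 'n \<Rightarrow> complex" where
  "convolution k f x = (LINT y|lborel. k (x - y) * f y)"

lemma convolution_measurable [measurable]:
  assumes [measurable]: "k \<in> borel_measurable borel" "f \<in> borel_measurable borel"
  shows "convolution k f \<in> borel_measurable borel"
  unfolding convolution_def by measurable

lemma nn_integral_affine:
  fixes f :: "'a::euclidean_space \<Rightarrow> ennreal"
  assumes c: "c \<noteq> 0" and [measurable]: "f \<in> borel_measurable borel"
  shows "integral\<^sup>N lborel f = ennreal (\<bar>c\<bar> ^ DIM('a)) * (\<integral>\<^sup>+x. f (t + c *\<^sub>R x) \<partial>lborel)"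
  by (subst lborel_affine[OF c, of t], subst nn_integral_density, simp, simp, subst nn_integral_distr)
    (auto simp: nn_integral_cmult)

text \<open>Write |k| as a product of two square roots, attach one of them to \<open>f\<close> and
  apply Cauchy-Schwarz; Tonelli's theorem and translation invariance evaluate the outer integral.
  The modulus stays inside, so the estimate also shows that the convolution integral exists almost
  everywhere.\<close>

lemma young_nn_integral:
  fixes k f :: "real ^ 'n \<Rightarrow> complex"
  assumes k: "integrable lborel k" and f: "square_integrable f"
  shows "(\<integral>\<^sup>+x. (\<integral>\<^sup>+y. ennreal (cmod (k (x - y) * f y)) \<partial>lborel)\<^sup>2 \<partial>lborel)
    \<le> ennreal (((LINT x|lborel. cmod (k x)) * norm (abs_L2 f))\<^sup>2)"
proof -
  have [measurable]: "k \<in> borel_measurable borel" "f \<in> borel_measurable borel" 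
    using k f by (auto intro: square_integrable_measurable)
  define K where "K = (LINT x|lborel. cmod (k x))"
  have K: "K \<ge> 0" "(\<integral>\<^sup>+x. ennreal (cmod (k x)) \<partial>lborel) = ennreal K"
    unfolding K_def using k by (auto intro!: nn_integral_eq_integral)
  have Ky: "(\<integral>\<^sup>+y. ennreal (cmod (k (x - y))) \<partial>lborel) = ennreal K" for x
    unfolding K(2)[symmetric] by (subst (2) nn_integral_affine[of "-1" _ x]) auto
  have Kx: "(\<integral>\<^sup>+x. ennreal (cmod (k (x - y))) \<partial>lborel) = ennreal K" for y
    unfolding K(2)[symmetric] by (subst (2) nn_integral_affine[of 1 _ "- y"]) auto
  have "(\<integral>\<^sup>+y. ennreal (cmod (k (x - y) * f y)) \<partial>lborel)\<^sup>2
      \<le> ennreal K * (\<integral>\<^sup>+y. ennreal (cmod (k (x - y)) * (cmod (f y))\<^sup>2) \<partial>lborel)" for x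
  proof -
    have "(\<integral>\<^sup>+y. ennreal (cmod (k (x - y) * f y)) \<partial>lborel)
      = (\<integral>\<^sup>+y. ennreal (sqrt (cmod (k (x - y)))) * ennreal (sqrt (cmod (k (x - y))) * cmod (f y)) \<partial>lborel)"
      by (intro nn_integral_cong) (simp add: norm_mult flip: ennreal_mult mult.assoc)
    then have "(\<integral>\<^sup>+y. ennreal (cmod (k (x - y) * f y)) \<partial>lborel)\<^sup>2
      \<le> (\<integral>\<^sup>+y. (ennreal (sqrt (cmod (k (x - y)))))\<^sup>2 \<partial>lborel) 
        * (\<integral>\<^sup>+y. (ennreal (sqrt (cmod (k (x - y))) * cmod (f y)))\<^sup>2 \<partial>lborel)"
      by (simp only:) (rule Cauchy_Schwarz_nn_integral, measurable)
    then show ?thesis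
      by (simp add: ennreal_power power_mult_distrib Ky)
  qed
  then have "(\<integral>\<^sup>+x. (\<integral>\<^sup>+y. ennreal (cmod (k (x - y) * f y)) \<partial>lborel)\<^sup>2 \<partial>lborel)
      \<le> (\<integral>\<^sup>+x. ennreal K * (\<integral>\<^sup>+y. ennreal (cmod (k (x - y)) * (cmod (f y))\<^sup>2) \<partial>lborel) \<partial>lborel)"
    by (intro nn_integral_mono)
  also have "\<dots> = ennreal K * (\<integral>\<^sup>+x. \<integral>\<^sup>+y. ennreal (cmod (k (x - y)) * (cmod (f y))\<^sup>2) \<partial>lborel \<partial>lborel)"
    by (rule nn_integral_cmult) measurable
  also have "(\<integral>\<^sup>+x. \<integral>\<^sup>+y. ennreal (cmod (k (x - y)) * (cmod (f y))\<^sup>2) \<partial>lborel \<partial>lborel)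
      = (\<integral>\<^sup>+y. \<integral>\<^sup>+x. ennreal (cmod (k (x - y)) * (cmod (f y))\<^sup>2) \<partial>lborel \<partial>lborel)"
    by (rule lborel_pair.Fubini') measurable
  also have "\<dots> = (\<integral>\<^sup>+y. ennreal K * ennreal ((cmod (f y))\<^sup>2) \<partial>lborel)"
    by (intro nn_integral_cong) (simp add: ennreal_mult nn_integral_multc Kx)
  also have "\<dots> = ennreal K * ennreal ((norm (abs_L2 f))\<^sup>2)"
    by (simp add: nn_integral_cmult nn_integral_square_integrable f)
  also have "ennreal K * (ennreal K * ennreal ((norm (abs_L2 f))\<^sup>2)) = ennreal ((K * norm (abs_L2 f))\<^sup>2)"
    using K(1) by (simp add: power_mult_distrib power2_eq_square mult_ac flip: ennreal_mult)
  finally show ?thesis by (simp add: K_def)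
qed

lemma
  fixes k f :: "real ^ 'n \<Rightarrow> complex"
  assumes k: "integrable lborel k" and f: "square_integrable f"
  shows convolution_square_integrable: "square_integrable (convolution k f)"
    and convolution_norm_le:
      "norm (abs_L2 (convolution k f)) \<le> (LINT x|lborel. cmod (k x)) * norm (abs_L2 f)"
    and convolution_AE_integrable: "AE x in lborel. integrable lborel (\<lambda>y. k (x - y) * f y)"
proof -
  have [measurable]: "k \<in> borel_measurable borel" "f \<in> borel_measurable borel" 
    using k f by (auto intro: square_integrable_measurable)
  note young = young_nn_integral[OF k f]
  have le: "ennreal ((cmod (convolution k f x))\<^sup>2) \<le> (\<integral>\<^sup>+y. ennreal (cmod (k (x - y) * f y)) \<partial>lborel)\<^sup>2" for x
  proof -
    \<comment> \<open>At points where the integrand is not integrable the Bochner integral is 0 and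
      the bound is trivial.\<close>
    have "ennreal (cmod (convolution k f x)) \<le> (\<integral>\<^sup>+y. ennreal (cmod (k (x - y) * f y)) \<partial>lborel)"
      unfolding convolution_def
      by (cases "integrable lborel (\<lambda>y. k (x - y) * f y)") 
        (simp_all add: integral_norm_bound_ennreal not_integrable_integral_eq)
    then show ?thesis by (simp add: power_mono flip: ennreal_power)
  qed
  have nn: "(\<integral>\<^sup>+x. ennreal ((cmod (convolution k f x))\<^sup>2) \<partial>lborel)
      \<le> ennreal (((LINT x|lborel. cmod (k x)) * norm (abs_L2 f))\<^sup>2)"
    by (rule order_trans[OF nn_integral_mono[OF le] young])
  then show sq: "square_integrable (convolution k f)"
    by (intro square_integrableI_nn_integral) (auto intro: le_less_trans)
  have "(norm (abs_L2 (convolution k f)))\<^sup>2 \<le> ((LINT x|lborel. cmod (k x)) * norm (abs_L2 f))\<^sup>2"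
    using nn unfolding nn_integral_square_integrable[OF sq] by (simp only: ennreal_le_iff zero_le_power2)
  then show "norm (abs_L2 (convolution k f)) \<le> (LINT x|lborel. cmod (k x)) * norm (abs_L2 f)"
    by (rule power2_le_imp_le) simp
  have "AE x in lborel. (\<integral>\<^sup>+y. ennreal (cmod (k (x - y) * f y)) \<partial>lborel)\<^sup>2 \<noteq> \<infinity>"
    by (rule nn_integral_PInf_AE) (use young in \<open>auto simp: top_unique\<close>)
  then show "AE x in lborel. integrable lborel (\<lambda>y. k (x - y) * f y)"
  proof eventually_elim
    case (elim x)
    then have "(\<integral>\<^sup>+y. ennreal (cmod (k (x - y) * f y)) \<partial>lborel) < \<infinity>"
      by (auto simp: power2_eq_square less_top ennreal_mult_eq_top_iff)
    then show ?case by (intro integrableI_bounded) auto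
  qed
qed

lemma convolution_cong_AE:
  fixes k f :: "real ^ 'n \<Rightarrow> complex"
  assumes [measurable]: "k \<in> borel_measurable borel" "f \<in> borel_measurable borel" "g \<in> borel_measurable borel"
    and "AE x in lborel. f x = g x"
  shows "convolution k f = convolution k g"
proof
  show "convolution k f x = convolution k g x" for x
    unfolding convolution_def using assms(4) by (intro integral_cong_AE) auto
qed

text \<open>Additivity of the Bochner integral needs both convolution integrals to converge at the
  point, which is guaranteed only almost everywhere.\<close>

lemma convolution_diff_AE:
  fixes k f g :: "real ^ 'n \<Rightarrow> complex"
  assumes "integrable lborel k" "square_integrable f" "square_integrable g"
  shows "AE x in lborel. convolution k (\<lambda>x. f x - g x) x = convolution k f x - convolution k g x"
  using convolution_AE_integrable[OF assms(1,2)] convolution_AE_integrable[OF assms(1,3)]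
  by eventually_elim (simp add: convolution_def right_diff_distrib)

definition convolution_L2 :: "(real ^ 'n \<Rightarrow> complex) \<Rightarrow> 'n::finite L2 \<Rightarrow> 'n L2" where
  "convolution_L2 k u = abs_L2 (convolution k (rep_L2 u))"

lemma convolution_L2_abs:
  fixes k f :: "real ^ 'n \<Rightarrow> complex"
  assumes "integrable lborel k" "square_integrable f"
  shows "convolution_L2 k (abs_L2 f) = abs_L2 (convolution k f)"
  unfolding convolution_L2_def
  by (subst convolution_cong_AE[OF _ _ _ rep_abs_L2[OF assms(2)]])
    (use assms in \<open>auto intro: square_integrable_measurable\<close>)

lemma convolution_L2_diff:
  assumes k: "integrable lborel k"
  shows "convolution_L2 k (u - v) = convolution_L2 k u - convolution_L2 k v"
proof -
  have "u - v = abs_L2 (\<lambda>x. rep_L2 u x - rep_L2 v x)" by (simp flip: abs_L2_minus)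
  then have "convolution_L2 k (u - v) = abs_L2 (convolution k (\<lambda>x. rep_L2 u x - rep_L2 v x))"
    by (simp add: convolution_L2_abs k square_integrable_diff)
  also have "\<dots> = abs_L2 (\<lambda>x. convolution k (rep_L2 u) x - convolution k (rep_L2 v) x)"
    by (rule abs_L2_eqI)
      (simp_all add: convolution_square_integrable k square_integrable_diff convolution_diff_AE)
  finally show ?thesis
    by (simp add: convolution_L2_def abs_L2_minus convolution_square_integrable k)
qed

text \<open>Young's inequality for \<open>u - v\<close> makes the L1 norm of \<open>k\<close> a
  Lipschitz constant. Continuity is what the density argument for the multiplier form of convolution
  requires.\<close>

lemma continuous_convolution_L2:
  assumes k: "integrable lborel k"
  shows "continuous_on S (convolution_L2 k)"
proof (rule lipschitz_on_continuous_on)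
  show "(LINT x|lborel. cmod (k x))-lipschitz_on S (convolution_L2 k)"
  proof (rule lipschitz_onI)
    fix u v
    have "dist (convolution_L2 k u) (convolution_L2 k v) = norm (convolution_L2 k (u - v))"
      by (simp add: dist_norm convolution_L2_diff k)
    also have "\<dots> \<le> (LINT x|lborel. cmod (k x)) * norm (u - v)"
      using convolution_norm_le[OF k, of "rep_L2 (u - v)"] by (simp add: convolution_L2_def)
    finally show "dist (convolution_L2 k u) (convolution_L2 k v) \<le> (LINT x|lborel. cmod (k x)) * dist u v"
      by (simp add: dist_norm)
  qed simp
qed

lemma
  fixes k f :: "real ^ 'n \<Rightarrow> complex"
  assumes k: "integrable lborel k" and f: "integrable lborel f"
  shows convolution_integrable: "integrable lborel (convolution k f)"
    and fourier_integral_convolution: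
      "fourier_integral (convolution k f) \<xi> = fourier_integral k \<xi> * fourier_integral f \<xi>"
proof -
  have [measurable]: "k \<in> borel_measurable borel" "f \<in> borel_measurable borel" 
    using k f by auto
  have kt: "integrable lborel (\<lambda>x. k (x - y))" for y
    using integrable_affine_iff[of 1 k "- y"] k by simp
  have kn: "(LINT x|lborel. cmod (k (x - y))) = (LINT x|lborel. cmod (k x))" for y
    by (subst (2) integral_affine[of 1 _ "- y"]) auto
  have pair: "integrable (lborel \<Otimes>\<^sub>M lborel) (\<lambda>(y, x). k (x - y) * f y)"
    by (rule lborel_pair.Fubini_integrable) (use f kt in \<open>auto simp: norm_mult kn\<close>)
  have pair': "integrable (lborel \<Otimes>\<^sub>M lborel) (\<lambda>(y, x). k (x - y) * f y * fchar x \<xi>)"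
    by (rule Bochner_Integration.integrable_bound[OF pair]) (auto simp: norm_mult)
  show "integrable lborel (convolution k f)"
    using lborel_pair.integrable_snd[OF pair] by (simp add: convolution_def[abs_def])
  have "fourier_integral (convolution k f) \<xi> = (LINT x|lborel. LINT y|lborel. k (x - y) * f y * fchar x \<xi>)"
    by (simp add: fourier_integral_def convolution_def)
  also have "\<dots> = (LINT y|lborel. LINT x|lborel. k (x - y) * f y * fchar x \<xi>)"
    by (rule lborel_pair.Fubini_integral[OF pair'])
  also have "\<dots> = (LINT y|lborel. fourier_integral k \<xi> * (f y * fchar y \<xi>))"
  proof (rule Bochner_Integration.integral_cong[OF refl])
    fix y
    \<comment> \<open>Translating the variable by - y splits off the factor
      \<open>fchar (- y) \<xi>\<close>, which cancels against \<open>fchar y \<xi>\<close>.\<close>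
    have "fourier_integral k \<xi> = (LINT x|lborel. k (- y + 1 *\<^sub>R x) * fchar (- y + 1 *\<^sub>R x) \<xi>)"
      unfolding fourier_integral_def by (subst integral_affine[of 1 _ "- y"]) auto
    also have "\<dots> = (LINT x|lborel. k (x - y) * fchar x \<xi> * fchar (- y) \<xi>)"
      unfolding fchar_add by (simp add: mult_ac)
    finally have "fourier_integral k \<xi> * (f y * fchar y \<xi>) 
        = (LINT x|lborel. k (x - y) * fchar x \<xi>) * fchar (- y) \<xi> * (f y * fchar y \<xi>)"
      by (simp only: integral_mult_left_zero)
    also have "\<dots> = (LINT x|lborel. k (x - y) * fchar x \<xi>) * f y * fchar (- y + y) \<xi>"
      unfolding fchar_add by (simp only: mult_ac)
    also have "\<dots> = (LINT x|lborel. k (x - y) * fchar x \<xi> * f y)"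
      by simp
    also have "\<dots> = (LINT x|lborel. k (x - y) * f y * fchar x \<xi>)"
      by (intro Bochner_Integration.integral_cong refl) (simp only: mult_ac)
    finally show "(LINT x|lborel. k (x - y) * f y * fchar x \<xi>) = fourier_integral k \<xi> * (f y * fchar y \<xi>)" ..
  qed
  also have "\<dots> = fourier_integral k \<xi> * fourier_integral f \<xi>"
    by (simp only: integral_mult_right_zero fourier_integral_def)
  finally show "fourier_integral (convolution k f) \<xi> = fourier_integral k \<xi> * fourier_integral f \<xi>" .
qed

section \<open>Fourier multipliers\<close>

text \<open>The bound is required at every point, as all symbols below satisfy it, so essential
  suprema do not enter.\<close>

definition bounded_symbol :: "(real ^ 'n \<Rightarrow> complex) \<Rightarrow> bool" where
  "bounded_symbol m \<longleftrightarrow> m \<in> borel_measurable borel \<and> (\<exists>B. \<forall>\<xi>. cmod (m \<xi>) \<le> B)"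

lemma bounded_symbolI:
  "m \<in> borel_measurable borel \<Longrightarrow> (\<And>\<xi>. cmod (m \<xi>) \<le> B) \<Longrightarrow> bounded_symbol m"
  by (auto simp: bounded_symbol_def)

lemma bounded_symbol_measurable [measurable_dest]: "bounded_symbol m \<Longrightarrow> m \<in> borel_measurable borel"
  by (simp add: bounded_symbol_def)

lemma bounded_symbol_cnj: "bounded_symbol m \<Longrightarrow> bounded_symbol (\<lambda>\<xi>. cnj (m \<xi>))"
  by (auto simp: bounded_symbol_def)

lemma bounded_symbol_const: "bounded_symbol (\<lambda>_. c)"
  by (rule bounded_symbolI[where B = "cmod c"]) auto

lemma bounded_symbol_add:
  assumes "bounded_symbol m" "bounded_symbol k" shows "bounded_symbol (\<lambda>\<xi>. m \<xi> + k \<xi>)"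
proof -
  obtain B C where "\<And>\<xi>. cmod (m \<xi>) \<le> B" "\<And>\<xi>. cmod (k \<xi>) \<le> C"
    using assms by (auto simp: bounded_symbol_def)
  then show ?thesis using assms
    by (intro bounded_symbolI[where B = "B + C"] norm_triangle_le add_mono borel_measurable_add)
      (auto simp: bounded_symbol_def)
qed

lemma bounded_symbol_mult:
  assumes "bounded_symbol m" "bounded_symbol k" shows "bounded_symbol (\<lambda>\<xi>. m \<xi> * k \<xi>)"
proof -
  obtain B C where B: "\<And>\<xi>. cmod (m \<xi>) \<le> B" and C: "\<And>\<xi>. cmod (k \<xi>) \<le> C"
    using assms by (auto simp: bounded_symbol_def)
  have "0 \<le> B" using B[of 0] norm_ge_zero[of "m 0"] by linarith
  then show ?thesis using assms B C
    by (intro bounded_symbolI[where B = "B * C"] borel_measurable_times)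
      (auto simp: bounded_symbol_def norm_mult intro!: mult_mono)
qed

lemma bounded_symbol_diff:
  "bounded_symbol m \<Longrightarrow> bounded_symbol k \<Longrightarrow> bounded_symbol (\<lambda>\<xi>. m \<xi> - k \<xi>)"
  using bounded_symbol_add[of m "\<lambda>\<xi>. - 1 * k \<xi>"] bounded_symbol_mult[OF bounded_symbol_const[of "-1"], of k]
  by simp

lemma mult_square_integrable:
  assumes m: "m \<in> borel_measurable borel" "\<And>\<xi>. cmod (m \<xi>) \<le> B" and f: "square_integrable f"
  shows "square_integrable (\<lambda>\<xi>. m \<xi> * f \<xi>)"
    and "(LINT \<xi>|lborel. (cmod (m \<xi> * f \<xi>))\<^sup>2) \<le> B\<^sup>2 * (LINT \<xi>|lborel. (cmod (f \<xi>))\<^sup>2)"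
proof -
  have le: "(cmod (m \<xi> * f \<xi>))\<^sup>2 \<le> B\<^sup>2 * (cmod (f \<xi>))\<^sup>2" for \<xi>
    using m(2)[of \<xi>] by (auto simp: norm_mult power_mult_distrib intro!: mult_right_mono power_mono)
  have [measurable]: "m \<in> borel_measurable borel" "f \<in> borel_measurable borel"
    using m f by (auto intro: square_integrable_measurable)
  have fi: "integrable lborel (\<lambda>\<xi>. B\<^sup>2 * (cmod (f \<xi>))\<^sup>2)" using f by (simp add: square_integrable_def)
  have "integrable lborel (\<lambda>\<xi>. (cmod (m \<xi> * f \<xi>))\<^sup>2)"
    by (rule Bochner_Integration.integrable_bound[OF fi]) (use le in auto)
  then show "square_integrable (\<lambda>\<xi>. m \<xi> * f \<xi>)" by (simp add: square_integrable_def)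
  show "(LINT \<xi>|lborel. (cmod (m \<xi> * f \<xi>))\<^sup>2) \<le> B\<^sup>2 * (LINT \<xi>|lborel. (cmod (f \<xi>))\<^sup>2)"
    unfolding integral_mult_right_zero[symmetric]
    by (rule integral_mono') (use le fi in auto)
qed

lemma bounded_symbol_square_integrable:
  "bounded_symbol m \<Longrightarrow> square_integrable f \<Longrightarrow> square_integrable (\<lambda>\<xi>. m \<xi> * f \<xi>)"
  unfolding bounded_symbol_def using mult_square_integrable(1) by blast

lemma rep_mult_L2:
  "bounded_symbol m \<Longrightarrow> AE \<xi> in lborel. rep_L2 (mult_L2 m u) \<xi> = m \<xi> * rep_L2 u \<xi>"
  unfolding mult_L2_def by (rule rep_abs_L2) (simp add: bounded_symbol_square_integrable)

lemma mult_L2_abs: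
  assumes m: "bounded_symbol m" and f: "square_integrable f"
  shows "mult_L2 m (abs_L2 f) = abs_L2 (\<lambda>\<xi>. m \<xi> * f \<xi>)"
  unfolding mult_L2_def
  by (rule abs_L2_eqI) (use m f rep_abs_L2[OF f] in \<open>auto simp: bounded_symbol_square_integrable\<close>)

lemma norm_mult_L2_le:
  assumes m: "m \<in> borel_measurable borel" "\<And>\<xi>. cmod (m \<xi>) \<le> B"
  shows "norm (mult_L2 m u) \<le> norm u * B"
proof (rule power2_le_imp_le)
  show "(norm (mult_L2 m u))\<^sup>2 \<le> (norm u * B)\<^sup>2"
    unfolding mult_L2_def using mult_square_integrable[OF m, of "rep_L2 u"]
    by (simp add: norm_abs_L2 power_mult_distrib norm_L2_rep[of u] mult.commute)
  have "0 \<le> B" using m(2)[of 0] norm_ge_zero[of "m 0"] by linarith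
  then show "0 \<le> norm u * B" by simp
qed

lemma mult_L2_add:
  assumes m: "bounded_symbol m" shows "mult_L2 m (u + v) = mult_L2 m u + mult_L2 m v"
  by (rule rep_L2_eqI, use rep_mult_L2[OF m, of "u + v"] rep_mult_L2[OF m, of u] rep_mult_L2[OF m, of v]
      rep_L2_plus[of u v] rep_L2_plus[of "mult_L2 m u" "mult_L2 m v"] in eventually_elim)
    (simp add: distrib_left)

lemma mult_L2_cscale:
  assumes m: "bounded_symbol m" shows "mult_L2 m (cscale c u) = cscale c (mult_L2 m u)"
  by (rule rep_L2_eqI, use rep_mult_L2[OF m, of "cscale c u"] rep_mult_L2[OF m, of u] 
      rep_L2_cscale[of c u] rep_L2_cscale[of c "mult_L2 m u"] in eventually_elim)
    simp

lemma mult_L2_mult_L2: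
  assumes m: "bounded_symbol m" and k: "bounded_symbol k"
  shows "mult_L2 m (mult_L2 k u) = mult_L2 (\<lambda>\<xi>. m \<xi> * k \<xi>) u"
  by (rule rep_L2_eqI, use rep_mult_L2[OF m, of "mult_L2 k u"] rep_mult_L2[OF k, of u] 
      rep_mult_L2[OF bounded_symbol_mult[OF m k], of u] in eventually_elim)
    simp

lemma mult_L2_plus:
  assumes m: "bounded_symbol m" and k: "bounded_symbol k"
  shows "mult_L2 m u + mult_L2 k u = mult_L2 (\<lambda>\<xi>. m \<xi> + k \<xi>) u"
  by (rule rep_L2_eqI, use rep_L2_plus[of "mult_L2 m u" "mult_L2 k u"] rep_mult_L2[OF m, of u] 
      rep_mult_L2[OF k, of u] rep_mult_L2[OF bounded_symbol_add[OF m k], of u] in eventually_elim)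
    (simp add: distrib_right)

lemma mult_L2_one: "mult_L2 (\<lambda>_. 1) u = u"
  by (simp add: mult_L2_def)

lemma cinner_mult_L2:
  assumes m: "bounded_symbol m"
  shows "cinner (mult_L2 m u) v = cinner u (mult_L2 (\<lambda>\<xi>. cnj (m \<xi>)) v)"
proof -
  have [measurable]: "m \<in> borel_measurable borel" using m by (simp add: bounded_symbol_def)
  show ?thesis
    unfolding cinner_rep_L2
    by (rule integral_cong_AE, measurable, 
      use rep_mult_L2[OF m, of u] rep_mult_L2[OF bounded_symbol_cnj[OF m], of v] in eventually_elim)
      simp
qed

text \<open>Has the shape of \<open>diffusion_op\<close>, so \<open>A\<close> is a multiplier by
  definition. By \<open>bij_fourier_L2\<close> the \<open>inv\<close> is a genuine two-sided
  inverse.\<close>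

definition fourier_multiplier :: "(real ^ 'n \<Rightarrow> complex) \<Rightarrow> 'n::finite L2 \<Rightarrow> 'n L2" where
  "fourier_multiplier m u = inv fourier_L2 (mult_L2 m (fourier_L2 u))"

lemma fourier_L2_multiplier [simp]: "fourier_L2 (fourier_multiplier m u) = mult_L2 m (fourier_L2 u)"
  unfolding fourier_multiplier_def by (rule surj_f_inv_f[OF bij_is_surj[OF bij_fourier_L2]])

lemma fourier_L2_eqI: "fourier_L2 u = fourier_L2 v \<Longrightarrow> u = v"
  by (rule injD[OF bij_is_inj[OF bij_fourier_L2]])

lemma bounded_clinear_fourier_multiplier:
  assumes m: "bounded_symbol m"
  shows "bounded_clinear_L2 (fourier_multiplier m)"
proof -
  obtain B where B: "\<And>\<xi>. cmod (m \<xi>) \<le> B" using m by (auto simp: bounded_symbol_def)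
  show ?thesis
  proof (rule bounded_clinearI[where K = B])
    show "norm (fourier_multiplier m u) \<le> norm u * B" for u
      using norm_mult_L2_le[OF bounded_symbol_measurable[OF m] B, of "fourier_L2 u"]
      by (simp flip: fourier_L2_multiplier)
  qed (rule fourier_L2_eqI, simp add: fourier_L2_add mult_L2_add m fourier_L2_cscale mult_L2_cscale)+
qed

lemma fourier_multiplier_mult:
  "bounded_symbol m \<Longrightarrow> bounded_symbol k \<Longrightarrow>
    fourier_multiplier m (fourier_multiplier k u) = fourier_multiplier (\<lambda>\<xi>. m \<xi> * k \<xi>) u"
  by (rule fourier_L2_eqI) (simp add: mult_L2_mult_L2)

lemma fourier_multiplier_plus:
  "bounded_symbol m \<Longrightarrow> bounded_symbol k \<Longrightarrow>
    fourier_multiplier m u + fourier_multiplier k u = fourier_multiplier (\<lambda>\<xi>. m \<xi> + k \<xi>) u"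
  by (rule fourier_L2_eqI) (simp add: mult_L2_plus fourier_L2_add)

lemma fourier_multiplier_one [simp]: "fourier_multiplier (\<lambda>_. 1) u = u"
  by (rule fourier_L2_eqI) (simp add: mult_L2_one)

lemma cinner_fourier_multiplier:
  assumes m: "bounded_symbol m"
  shows "cinner (fourier_multiplier m u) v = cinner u (fourier_multiplier (\<lambda>\<xi>. cnj (m \<xi>)) v)"
proof -
  have "cinner (fourier_multiplier m u) v = cinner (fourier_L2 (fourier_multiplier m u)) (fourier_L2 v)"
    by (simp only: cinner_fourier_L2)
  also have "\<dots> = cinner (fourier_L2 u) (fourier_L2 (fourier_multiplier (\<lambda>\<xi>. cnj (m \<xi>)) v))"
    by (simp add: cinner_mult_L2 m)
  finally show ?thesis by (simp only: cinner_fourier_L2)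
qed

lemma inner_fourier_multiplier:
  "bounded_symbol m \<Longrightarrow> fourier_multiplier m u \<bullet> v = u \<bullet> fourier_multiplier (\<lambda>\<xi>. cnj (m \<xi>)) v"
  by (simp add: cinner_fourier_multiplier flip: Re_cinner)

text \<open>Resolves the definite description in \<open>adjoint_L2\<close>: the conjugate symbol
  provides a witness, and \<open>cinner_eqI\<close> gives uniqueness.\<close>

lemma adjoint_fourier_multiplier:
  assumes m: "bounded_symbol m"
  shows "adjoint_L2 (fourier_multiplier m) = fourier_multiplier (\<lambda>\<xi>. cnj (m \<xi>))"
  unfolding adjoint_L2_def
proof (rule the_equality)
  show "\<forall>f g. cinner (fourier_multiplier m f) g = cinner f (fourier_multiplier (\<lambda>\<xi>. cnj (m \<xi>)) g)"
    by (simp add: cinner_fourier_multiplier m)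
  fix B assume "\<forall>f g. cinner (fourier_multiplier m f) g = cinner f (B g)"
  then show "B = fourier_multiplier (\<lambda>\<xi>. cnj (m \<xi>))"
    by (auto intro!: ext cinner_eqI simp: cinner_fourier_multiplier m)
qed

text \<open>Since |q - 1|^2 \<le> 4, dominated convergence applies on the Fourier side; the isometry
  carries the limit back.\<close>

lemma fourier_multiplier_tendsto:
  assumes [measurable]: "\<And>k. q k \<in> borel_measurable borel" and bd: "\<And>k \<xi>. cmod (q k \<xi>) \<le> 1"
    and lim: "\<And>\<xi>. (\<lambda>k. q k \<xi>) \<longlonglongrightarrow> 1"
  shows "(\<lambda>k. fourier_multiplier (q k) u) \<longlonglongrightarrow> u"
proof -
  define v where "v = fourier_L2 u"
  have "(\<lambda>k. abs_L2 (\<lambda>\<xi>. q k \<xi> * rep_L2 v \<xi>)) \<longlonglongrightarrow> abs_L2 (rep_L2 v)"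
  proof (rule tendsto_L2_I)
    show "square_integrable (\<lambda>\<xi>. q k \<xi> * rep_L2 v \<xi>)" for k
      by (rule mult_square_integrable(1)[where B = 1]) (use bd in auto)
    have "(\<lambda>k. LINT \<xi>|lborel. (cmod (q k \<xi> * rep_L2 v \<xi> - rep_L2 v \<xi>))\<^sup>2) 
        \<longlonglongrightarrow> (LINT \<xi>::real ^ 'a|lborel. (0::real))"
    proof (rule integral_dominated_convergence)
      show "integrable lborel (\<lambda>\<xi>. 4 * (cmod (rep_L2 v \<xi>))\<^sup>2)"
        using square_integrable_rep[of v] by (simp add: square_integrable_def)
      show "AE \<xi> in lborel. (\<lambda>k. (cmod (q k \<xi> * rep_L2 v \<xi> - rep_L2 v \<xi>))\<^sup>2) \<longlonglongrightarrow> 0"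
      proof (rule AE_I2)
        fix \<xi>
        have "(\<lambda>k. (cmod (q k \<xi> * rep_L2 v \<xi> - rep_L2 v \<xi>))\<^sup>2) 
            \<longlonglongrightarrow> (cmod (1 * rep_L2 v \<xi> - rep_L2 v \<xi>))\<^sup>2"
          by (intro tendsto_intros lim)
        then show "(\<lambda>k. (cmod (q k \<xi> * rep_L2 v \<xi> - rep_L2 v \<xi>))\<^sup>2) \<longlonglongrightarrow> 0" by simp
      qed
      show "AE \<xi> in lborel. norm ((cmod (q k \<xi> * rep_L2 v \<xi> - rep_L2 v \<xi>))\<^sup>2) \<le> 4 * (cmod (rep_L2 v \<xi>))\<^sup>2" for k
      proof (rule AE_I2)
        fix \<xi>
        have "cmod (q k \<xi> * rep_L2 v \<xi> - rep_L2 v \<xi>) \<le> cmod (q k \<xi>) * cmod (rep_L2 v \<xi>) + cmod (rep_L2 v \<xi>)"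
          using norm_triangle_ineq4[of "q k \<xi> * rep_L2 v \<xi>" "rep_L2 v \<xi>"] by (simp add: norm_mult)
        also have "\<dots> \<le> 2 * cmod (rep_L2 v \<xi>)"
          using mult_right_mono[OF bd[of k \<xi>], of "cmod (rep_L2 v \<xi>)"] by simp
        finally have "(cmod (q k \<xi> * rep_L2 v \<xi> - rep_L2 v \<xi>))\<^sup>2 \<le> (2 * cmod (rep_L2 v \<xi>))\<^sup>2"
          by (rule power_mono) simp
        then show "norm ((cmod (q k \<xi> * rep_L2 v \<xi> - rep_L2 v \<xi>))\<^sup>2) \<le> 4 * (cmod (rep_L2 v \<xi>))\<^sup>2"
          by (simp add: power_mult_distrib)
      qed
    qed auto
    then show "(\<lambda>k. LINT \<xi>|lborel. (cmod (q k \<xi> * rep_L2 v \<xi> - rep_L2 v \<xi>))\<^sup>2) \<longlonglongrightarrow> 0" by simp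
  qed simp
  then have "(\<lambda>k. fourier_L2 (fourier_multiplier (q k) u)) \<longlonglongrightarrow> fourier_L2 u"
    by (simp add: v_def mult_L2_def)
  then have "(\<lambda>k. norm (fourier_L2 (fourier_multiplier (q k) u - u))) \<longlonglongrightarrow> 0"
    unfolding fourier_L2_diff by (intro tendsto_norm_zero LIM_zero)
  then show ?thesis
    unfolding norm_fourier_L2 by (rule LIM_zero_cancel[OF tendsto_norm_zero_cancel])
qed

section \<open>Mollification as a multiplier\<close>

text \<open>Both sides are continuous, and convolution by \<open>k\<close> maps the intersection of
  L1 and L2 into itself, where the convolution theorem for Fourier integrals applies.\<close>

lemma convolution_L2_eq_multiplier:
  fixes k :: "real ^ 'n \<Rightarrow> complex"
  assumes k: "integrable lborel k"
  shows "convolution_L2 k = fourier_multiplier (fourier_integral k)"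
proof
  fix u
  have meas [measurable]: "fourier_integral k \<in> borel_measurable borel"
    by (rule fourier_integral_measurable) (use k in auto)
  have bs: "bounded_symbol (fourier_integral k)"
    by (rule bounded_symbolI[OF meas fourier_integral_bound[OF k]])
  have "bounded_linear (fourier_multiplier (fourier_integral k))"
    using bounded_clinear_fourier_multiplier[OF bs] by (simp add: bounded_clinear_L2_def)
  then have "closed {u. convolution_L2 k u = fourier_multiplier (fourier_integral k) u}"
    by (intro closed_Collect_eq continuous_convolution_L2[OF k] linear_continuous_on)
  then show "convolution_L2 k u = fourier_multiplier (fourier_integral k) u"
  proof (induction u rule: L2_dense_induct)
    case (integrable f)
    have eq: "fourier_integral (convolution k f) = (\<lambda>\<xi>. fourier_integral k \<xi> * fourier_integral f \<xi>)"
      by (rule ext) (rule fourier_integral_convolution[OF k integrable(1)])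
    show ?case
    proof (rule fourier_L2_eqI)
      show "fourier_L2 (convolution_L2 k (abs_L2 f)) = fourier_L2 (fourier_multiplier (fourier_integral k) (abs_L2 f))"
        using integrable k 
        by (simp add: convolution_L2_abs fourier_L2_abs convolution_integrable convolution_square_integrable
          mult_L2_abs bs plancherel_integral(1) eq)
    qed
  qed
qed

text \<open>The factor \<beta>^(-n) in \<open>dilate\<close> is exactly cancelled by the Jacobian of
  the dilation.\<close>

lemma
  fixes \<phi> :: "real ^ 'n::finite \<Rightarrow> real"
  assumes \<phi>: "integrable lborel \<phi>" and \<beta>: "\<beta> > 0"
  shows integrable_dilate: "integrable lborel (\<lambda>x. complex_of_real (dilate \<phi> \<beta> x))"
    and fourier_integral_dilated_kernel: "fourier_integral (\<lambda>x. complex_of_real (dilate \<phi> \<beta> x)) \<xi>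
      = fourier_integral (\<lambda>x. complex_of_real (\<phi> x)) (\<beta> *\<^sub>R \<xi>)"
proof -
  define f where "f x = complex_of_real (\<phi> x)" for x
  have f: "integrable lborel f" unfolding f_def using \<phi> by simp
  have eq: "complex_of_real (dilate \<phi> \<beta> x) = (1 / of_real \<beta> ^ CARD('n)) * f (inverse \<beta> *\<^sub>R x)" for x
    by (simp add: dilate_def f_def)
  have "integrable lborel (\<lambda>x. f (inverse \<beta> *\<^sub>R x))"
    using integrable_affine_iff[of "inverse \<beta>" f 0] \<beta> f by simp
  then show "integrable lborel (\<lambda>x. complex_of_real (dilate \<phi> \<beta> x))"
    unfolding eq by (intro integrable_mult_right)
  have "fourier_integral (\<lambda>x. complex_of_real (dilate \<phi> \<beta> x)) \<xi>
      = (1 / of_real \<beta> ^ CARD('n)) * (fourier_integral f (\<xi> /\<^sub>R inverse \<beta>) / of_real (inverse \<beta>) ^ CARD('n))"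
    unfolding eq fourier_integral_cmult
    by (subst fourier_integral_dilate[of "inverse \<beta>" f, OF _ f]) (use \<beta> in simp_all)
  also have "\<dots> = fourier_integral f (\<xi> /\<^sub>R inverse \<beta>)"
    using \<beta> by (simp add: power_inverse)
  also have "\<xi> /\<^sub>R inverse \<beta> = \<beta> *\<^sub>R \<xi>" by simp
  also have "f = (\<lambda>x. complex_of_real (\<phi> x))" by (rule ext) (rule f_def)
  finally show "fourier_integral (\<lambda>x. complex_of_real (dilate \<phi> \<beta> x)) \<xi>
      = fourier_integral (\<lambda>x. complex_of_real (\<phi> x)) (\<beta> *\<^sub>R \<xi>)" .
qed

lemma mollify_defect_eq_multiplier:
  fixes \<phi> :: "real ^ 'n::finite \<Rightarrow> real"
  assumes \<phi>: "integrable lborel \<phi>" and \<beta>: "\<beta> > 0"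
  defines "\<Phi> \<equiv> fourier_integral (\<lambda>x. complex_of_real (\<phi> x))"
  shows "bounded_symbol (\<lambda>\<xi>. 1 - \<Phi> (\<beta> *\<^sub>R \<xi>))"
    and "mollify_defect \<phi> \<beta> = fourier_multiplier (\<lambda>\<xi>. 1 - \<Phi> (\<beta> *\<^sub>R \<xi>))"
proof -
  let ?k = "\<lambda>x. complex_of_real (dilate \<phi> \<beta> x)"
  have \<Phi>_meas [measurable]: "\<Phi> \<in> borel_measurable borel"
    unfolding \<Phi>_def by (rule fourier_integral_measurable) (use \<phi> in auto)
  have "integrable lborel (\<lambda>x. complex_of_real (\<phi> x))" using \<phi> by simp
  note bound = fourier_integral_bound[OF this, folded \<Phi>_def]
  have bs: "bounded_symbol (\<lambda>\<xi>. \<Phi> (\<beta> *\<^sub>R \<xi>))"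
    by (rule bounded_symbolI[OF _ bound]) (rule measurable_compose[OF _ \<Phi>_meas], simp)
  then show bs1: "bounded_symbol (\<lambda>\<xi>. 1 - \<Phi> (\<beta> *\<^sub>R \<xi>))"
    by (intro bounded_symbol_diff bounded_symbol_const)
  have "fourier_integral ?k = (\<lambda>\<xi>. \<Phi> (\<beta> *\<^sub>R \<xi>))"
    unfolding \<Phi>_def by (rule ext) (rule fourier_integral_dilated_kernel[OF \<phi> \<beta>])
  then have C: "mollify_op \<phi> \<beta> u = fourier_multiplier (\<lambda>\<xi>. \<Phi> (\<beta> *\<^sub>R \<xi>)) u" for u
    using fun_cong[OF convolution_L2_eq_multiplier[OF integrable_dilate[OF \<phi> \<beta>]], of u]
    by (simp add: mollify_op_def convolution_L2_def convolution_def[abs_def])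
  show "mollify_defect \<phi> \<beta> = fourier_multiplier (\<lambda>\<xi>. 1 - \<Phi> (\<beta> *\<^sub>R \<xi>))"
  proof
    fix u
    have "fourier_multiplier (\<lambda>\<xi>. 1 - \<Phi> (\<beta> *\<^sub>R \<xi>)) u + fourier_multiplier (\<lambda>\<xi>. \<Phi> (\<beta> *\<^sub>R \<xi>)) u = u"
      by (simp add: fourier_multiplier_plus bs bs1)
    then show "mollify_defect \<phi> \<beta> u = fourier_multiplier (\<lambda>\<xi>. 1 - \<Phi> (\<beta> *\<^sub>R \<xi>)) u"
      unfolding mollify_defect_def C by (simp add: algebra_simps)
  qed
qed

section \<open>Regularization by multipliers\<close>

text \<open>The quadratic problem for arbitrary symbols \<open>a\<close> and \<open>d\<close>. The
  lower bound \<open>c\<close> makes 1/m bounded, so the normal operator is invertible and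
  \<open>r\<close> solves the normal equation. Around that solution the functional is its value
  there plus a purely quadratic term, which gives strict minimality.\<close>

lemma
  fixes a d :: "real ^ 'n::finite \<Rightarrow> complex"
  assumes a: "bounded_symbol a" and d: "bounded_symbol d"
    and c: "c > 0" "\<And>\<xi>. c \<le> (cmod (a \<xi>))\<^sup>2 + (cmod (d \<xi>))\<^sup>2"
  defines "r \<equiv> (\<lambda>\<xi>. cnj (a \<xi>) / of_real ((cmod (a \<xi>))\<^sup>2 + (cmod (d \<xi>))\<^sup>2))"
  shows bounded_symbol_regularizer: "bounded_symbol r"
    and normal_equation_multiplier:
      "u = fourier_multiplier r g \<longleftrightarrow>
        fourier_multiplier (\<lambda>\<xi>. cnj (a \<xi>)) (fourier_multiplier a u) +
        fourier_multiplier (\<lambda>\<xi>. cnj (d \<xi>)) (fourier_multiplier d u) = fourier_multiplier (\<lambda>\<xi>. cnj (a \<xi>)) g"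
    and strict_minimum_multiplier: "u \<noteq> fourier_multiplier r g \<Longrightarrow>
        (norm (fourier_multiplier a (fourier_multiplier r g) - g))\<^sup>2 + (norm (fourier_multiplier d (fourier_multiplier r g)))\<^sup>2
        < (norm (fourier_multiplier a u - g))\<^sup>2 + (norm (fourier_multiplier d u))\<^sup>2"
proof -
  define m where "m \<xi> = (cmod (a \<xi>))\<^sup>2 + (cmod (d \<xi>))\<^sup>2" for \<xi>
  have m_pos: "m \<xi> > 0" "m \<xi> \<ge> c" for \<xi> using c(1) c(2)[of \<xi>] by (simp_all add: m_def)
  have m_eq: "complex_of_real (m \<xi>) = cnj (a \<xi>) * a \<xi> + cnj (d \<xi>) * d \<xi>" for \<xi>
    unfolding m_def of_real_add complex_norm_square by (simp add: mult.commute)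
  note bsm = bounded_symbol_add[OF bounded_symbol_mult[OF bounded_symbol_cnj[OF a] a] bounded_symbol_mult[OF bounded_symbol_cnj[OF d] d]]
  have m_bs: "bounded_symbol (\<lambda>\<xi>. complex_of_real (m \<xi>))" unfolding m_eq by (rule bsm)
  have [measurable]: "a \<in> borel_measurable borel" "d \<in> borel_measurable borel"
    using a d by (auto simp: bounded_symbol_def)
  have i_bs: "bounded_symbol (\<lambda>\<xi>. 1 / complex_of_real (m \<xi>))"
  proof (rule bounded_symbolI[where B = "1 / c"])
    show "(\<lambda>\<xi>. 1 / complex_of_real (m \<xi>)) \<in> borel_measurable borel" unfolding m_def by measurable
    show "cmod (1 / complex_of_real (m \<xi>)) \<le> 1 / c" for \<xi>
      using m_pos[of \<xi>] c(1) by (simp add: norm_divide frac_le)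
  qed
  have r_eq: "r = (\<lambda>\<xi>. 1 / complex_of_real (m \<xi>) * cnj (a \<xi>))" by (simp add: r_def m_def)
  show r: "bounded_symbol r" unfolding r_eq by (intro bounded_symbol_mult i_bs bounded_symbol_cnj a)
  have normal: "fourier_multiplier (\<lambda>\<xi>. cnj (a \<xi>)) (fourier_multiplier a v) +
        fourier_multiplier (\<lambda>\<xi>. cnj (d \<xi>)) (fourier_multiplier d v) = fourier_multiplier (\<lambda>\<xi>. complex_of_real (m \<xi>)) v" for v
    unfolding m_eq
    by (simp add: fourier_multiplier_mult fourier_multiplier_plus a d bounded_symbol_cnj bounded_symbol_mult)
  have m_inv: "fourier_multiplier (\<lambda>\<xi>. 1 / complex_of_real (m \<xi>)) (fourier_multiplier (\<lambda>\<xi>. complex_of_real (m \<xi>)) v) = v" for v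
  proof -
    have "(\<lambda>\<xi>. 1 / complex_of_real (m \<xi>) * complex_of_real (m \<xi>)) = (\<lambda>_. 1)"
      using m_pos(1) by (auto simp: fun_eq_iff less_le)
    then show ?thesis unfolding fourier_multiplier_mult[OF i_bs m_bs] by simp
  qed
  have m_r: "fourier_multiplier (\<lambda>\<xi>. complex_of_real (m \<xi>)) (fourier_multiplier r g) = fourier_multiplier (\<lambda>\<xi>. cnj (a \<xi>)) g"
  proof -
    have "(\<lambda>\<xi>. complex_of_real (m \<xi>) * r \<xi>) = (\<lambda>\<xi>. cnj (a \<xi>))"
      unfolding r_eq using m_pos(1) by (auto simp: fun_eq_iff less_le)
    then show ?thesis unfolding fourier_multiplier_mult[OF m_bs r] by simp
  qed
  have r_mult: "fourier_multiplier r g = fourier_multiplier (\<lambda>\<xi>. 1 / complex_of_real (m \<xi>)) (fourier_multiplier (\<lambda>\<xi>. cnj (a \<xi>)) g)"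
    unfolding fourier_multiplier_mult[OF i_bs bounded_symbol_cnj[OF a]] r_eq ..
  show "u = fourier_multiplier r g \<longleftrightarrow>
        fourier_multiplier (\<lambda>\<xi>. cnj (a \<xi>)) (fourier_multiplier a u) +
        fourier_multiplier (\<lambda>\<xi>. cnj (d \<xi>)) (fourier_multiplier d u) = fourier_multiplier (\<lambda>\<xi>. cnj (a \<xi>)) g"
    unfolding normal using m_inv[of u] m_r r_mult by auto
  have lin: "fourier_multiplier k (v + w) = fourier_multiplier k v + fourier_multiplier k w" 
    if "bounded_symbol k" for k and v w :: "'n L2"
    using bounded_clinear_fourier_multiplier[OF that] by (simp add: bounded_clinear_L2_def linear_simps)
  have lin_diff: "fourier_multiplier k (v - w) = fourier_multiplier k v - fourier_multiplier k w" 
    if "bounded_symbol k" for k and v w :: "'n L2"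
    using bounded_clinear_fourier_multiplier[OF that] by (simp add: bounded_clinear_L2_def linear_simps)
  have sq: "(norm (v + w))\<^sup>2 = (norm v)\<^sup>2 + 2 * (v \<bullet> w) + (norm w)\<^sup>2" for v w :: "'n L2"
    unfolding power2_norm_eq_inner by (simp add: inner_add_left inner_add_right inner_commute)
  define w where "w = fourier_multiplier r g"
  define h where "h = u - w"
  assume "u \<noteq> fourier_multiplier r g"
  then have "h \<noteq> 0" by (simp add: h_def w_def)
  have u: "u = w + h" by (simp add: h_def)
  \<comment> \<open>Half the first variation at \<open>w\<close> in direction \<open>h\<close>.
    Moving the multipliers to the other side collects it into the residual of the normal equation,
    which is zero at \<open>w\<close>.\<close>
  have "(fourier_multiplier a w - g) \<bullet> fourier_multiplier a h + fourier_multiplier d w \<bullet> fourier_multiplier d h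
      = (fourier_multiplier (\<lambda>\<xi>. complex_of_real (m \<xi>)) w - fourier_multiplier (\<lambda>\<xi>. cnj (a \<xi>)) g) \<bullet> h"
    unfolding normal[symmetric]
    by (simp add: inner_commute[of _ "fourier_multiplier _ h"] inner_fourier_multiplier a d)
      (simp add: inner_diff_right inner_diff_left inner_add_left inner_add_right inner_commute
       lin_diff a d bounded_symbol_cnj)
  then have cross: "(fourier_multiplier a w - g) \<bullet> fourier_multiplier a h + fourier_multiplier d w \<bullet> fourier_multiplier d h = 0"
    by (simp add: w_def m_r)
  have "(norm (fourier_multiplier a u - g))\<^sup>2 + (norm (fourier_multiplier d u))\<^sup>2
      = (norm ((fourier_multiplier a w - g) + fourier_multiplier a h))\<^sup>2 + (norm (fourier_multiplier d w + fourier_multiplier d h))\<^sup>2"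
    by (simp add: u lin a d algebra_simps)
  also have "\<dots> = (norm (fourier_multiplier a w - g))\<^sup>2 + (norm (fourier_multiplier d w))\<^sup>2
      + ((norm (fourier_multiplier a h))\<^sup>2 + (norm (fourier_multiplier d h))\<^sup>2)"
    unfolding sq using cross by linarith
  finally have expand: "(norm (fourier_multiplier a u - g))\<^sup>2 + (norm (fourier_multiplier d u))\<^sup>2 = \<dots>" .
  \<comment> \<open>If both terms vanished, the normal operator would annihilate \<open>h\<close>,
    contrary to its invertibility.\<close>
  have "(norm (fourier_multiplier a h))\<^sup>2 + (norm (fourier_multiplier d h))\<^sup>2 > 0"
  proof (rule ccontr)
    assume "\<not> ?thesis"
    then have "(norm (fourier_multiplier a h))\<^sup>2 + (norm (fourier_multiplier d h))\<^sup>2 = 0"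
      by (simp add: sum_power2_gt_zero_iff)
    then have "fourier_multiplier a h = fourier_multiplier a 0" "fourier_multiplier d h = fourier_multiplier d 0"
      using lin[OF a, of 0 0] lin[OF d, of 0 0] by (simp_all add: sum_power2_eq_zero_iff)
    then have "fourier_multiplier (\<lambda>\<xi>. complex_of_real (m \<xi>)) h = fourier_multiplier (\<lambda>\<xi>. complex_of_real (m \<xi>)) 0"
      by (simp flip: normal)
    then have "h = 0" using m_inv[of h] m_inv[of 0] by simp
    with \<open>h \<noteq> 0\<close> show False ..
  qed
  with expand show "(norm (fourier_multiplier a (fourier_multiplier r g) - g))\<^sup>2 + (norm (fourier_multiplier d (fourier_multiplier r g)))\<^sup>2
        < (norm (fourier_multiplier a u - g))\<^sup>2 + (norm (fourier_multiplier d u))\<^sup>2"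
    unfolding w_def by linarith
qed

section \<open>The diffusion symbol and coercivity\<close>

lemma diffusion_op_eq_multiplier:
  "diffusion_op \<gamma> T \<tau> = fourier_multiplier (\<lambda>\<xi>. of_real (diffusion_symbol \<gamma> T \<tau> \<xi>))"
  by (rule ext) (simp add: diffusion_op_def fourier_multiplier_def)

lemma diffusion_symbol_measurable [measurable]: "diffusion_symbol \<gamma> T \<tau> \<in> borel_measurable borel"
  unfolding diffusion_symbol_def[abs_def] by measurable

text \<open>Both bounds rest on the nonnegative integral of \<gamma>. The monotonicity bounds the
  symbol on a ball from below by its value at a boundary point.\<close>

lemma
  fixes \<xi> :: "real ^ 'n"
  assumes "\<And>s. s \<in> {0<..<T} \<Longrightarrow> 0 < \<gamma> s"
  shows diffusion_symbol_le_1: "diffusion_symbol \<gamma> T \<tau> \<xi> \<le> 1"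
    and diffusion_symbol_ge: "0 \<le> \<tau> \<Longrightarrow> norm \<xi> \<le> norm \<eta> \<Longrightarrow>
      diffusion_symbol \<gamma> T \<tau> (\<eta> :: real ^ 'n) \<le> diffusion_symbol \<gamma> T \<tau> \<xi>"
proof -
  have G: "0 \<le> (LINT s:{0<..<T}|lebesgue. \<gamma> s)"
    unfolding set_lebesgue_integral_def 
    by (rule Bochner_Integration.integral_nonneg) (use assms in \<open>auto simp: indicator_def intro: less_imp_le\<close>)
  then show "diffusion_symbol \<gamma> T \<tau> \<xi> \<le> 1"
    by (simp add: diffusion_symbol_def)
  show "diffusion_symbol \<gamma> T \<tau> \<eta> \<le> diffusion_symbol \<gamma> T \<tau> \<xi>" if "0 \<le> \<tau>" "norm \<xi> \<le> norm \<eta>"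
    unfolding diffusion_symbol_def using that G
    by (auto intro!: mult_right_mono powr_mono2)
qed

text \<open>High frequencies are controlled by the defect of the mollifier, whose transform vanishes at
  infinity; low frequencies by the diffusion symbol, which is bounded below on bounded sets.\<close>

lemma symbol_coercive:
  fixes \<Phi> :: "real ^ 'n \<Rightarrow> complex"
  assumes \<gamma>: "\<And>s. s \<in> {0<..<T} \<Longrightarrow> 0 < \<gamma> s" and "0 \<le> \<tau>" "0 < \<beta>" 
    and \<Phi>: "(\<Phi> \<longlongrightarrow> 0) at_infinity"
  obtains c where "c > 0" 
    "\<And>\<xi>. c \<le> (diffusion_symbol \<gamma> T \<tau> \<xi>)\<^sup>2 + (cmod (1 - \<Phi> (\<beta> *\<^sub>R \<xi>)))\<^sup>2"
proof -
  have "eventually (\<lambda>\<eta>. dist (\<Phi> \<eta>) 0 < 1 / 2) at_infinity"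
    by (rule tendstoD[OF \<Phi>]) simp
  then obtain R where R: "\<And>\<eta>. R \<le> norm \<eta> \<Longrightarrow> cmod (\<Phi> \<eta>) < 1 / 2"
    by (auto simp: eventually_at_infinity)
  \<comment> \<open>Any point at the threshold radius: beyond |R| / \<beta> the defect has modulus
    at least 1/2, and within it the symbol is at least its value \<open>p\<close> at \<eta>. The
    absolute value allows for a negative \<open>R\<close>.\<close>
  obtain \<eta> :: "real ^ 'n" where \<eta>: "norm \<eta> = \<bar>R\<bar> / \<beta>"
    using vector_choose_size[of "\<bar>R\<bar> / \<beta>"] \<open>0 < \<beta>\<close> by auto
  define p where "p = diffusion_symbol \<gamma> T \<tau> \<eta>"
  have "p > 0" by (simp add: p_def diffusion_symbol_def)
  show ?thesis
  proof (rule that[of "min ((1 / 2)\<^sup>2) (p\<^sup>2)"])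
    show "min ((1 / 2)\<^sup>2) (p\<^sup>2) > 0" using \<open>p > 0\<close> by simp
    fix \<xi>
    show "min ((1 / 2)\<^sup>2) (p\<^sup>2) \<le> (diffusion_symbol \<gamma> T \<tau> \<xi>)\<^sup>2 + (cmod (1 - \<Phi> (\<beta> *\<^sub>R \<xi>)))\<^sup>2"
    proof (cases "norm \<xi> \<le> \<bar>R\<bar> / \<beta>")
      case True
      then have "p \<le> diffusion_symbol \<gamma> T \<tau> \<xi>"
        unfolding p_def by (intro diffusion_symbol_ge \<gamma>) (use \<eta> \<open>0 \<le> \<tau>\<close> in auto)
      then have "p\<^sup>2 \<le> (diffusion_symbol \<gamma> T \<tau> \<xi>)\<^sup>2"
        using \<open>p > 0\<close> by (intro power_mono) auto
      then show ?thesis by (intro min.coboundedI2 add_increasing2) auto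
    next
      case False
      then have "R \<le> norm (\<beta> *\<^sub>R \<xi>)" using \<open>0 < \<beta>\<close> by (simp add: field_simps)
      then have "cmod (\<Phi> (\<beta> *\<^sub>R \<xi>)) < 1 / 2" by (rule R)
      then have "1 / 2 \<le> cmod (1 - \<Phi> (\<beta> *\<^sub>R \<xi>))"
        using norm_triangle_ineq2[of 1 "\<Phi> (\<beta> *\<^sub>R \<xi>)"] by simp
      then have "(1 / 2)\<^sup>2 \<le> (cmod (1 - \<Phi> (\<beta> *\<^sub>R \<xi>)))\<^sup>2" by (intro power_mono) auto
      then show ?thesis by (intro min.coboundedI1 add_increasing) auto
    qed
  qed
qed

section \<open>The regularized solutions and their limit\<close>

theorem theorem1:
  fixes \<gamma> :: "real \<Rightarrow> real" and T \<tau> :: real and \<phi> :: "real ^ 'n::finite \<Rightarrow> real"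
    and A :: "'n L2 \<Rightarrow> 'n L2" and R :: "real \<Rightarrow> 'n L2 \<Rightarrow> 'n L2"
  assumes T: "0 < T" and \<tau>: "0 < \<tau>" "\<tau> \<le> 1"
    and \<gamma>_pos: "\<And>s. s \<in> {0<..<T} \<Longrightarrow> 0 < \<gamma> s"
    and \<gamma>_int: "set_integrable lebesgue {0<..<T} \<gamma>"
    and \<phi>_smooth: "smooth \<phi>"
    and \<phi>_L1: "integrable lborel \<phi>"
    and \<phi>_one: "(LINT x|lborel. \<phi> x) = 1"
    and A: "A = diffusion_op \<gamma> T \<tau>"
    and R: "\<And>\<beta> g. R \<beta> g = regularized_solution A \<phi> \<beta> g"
  shows "(\<forall>\<beta>>0. \<forall>g.
            (\<exists>!u. is_arg_min (objective A \<phi> \<beta> g) (\<lambda>_. True) u) \<and>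
            (\<forall>u. u = R \<beta> g \<longleftrightarrow>
               adjoint_L2 A (A u)
                 + adjoint_L2 (mollify_defect \<phi> \<beta>) (mollify_defect \<phi> \<beta> u)
               = adjoint_L2 A g)) \<and>
         (\<forall>\<beta>>0. bounded_clinear_L2 (R \<beta>)) \<and>
         (\<forall>u. ((\<lambda>\<beta>. R \<beta> (A u)) \<longlongrightarrow> u) (at_right 0)) \<and>
         regularization_method A R"
proof -
  define a :: "real ^ 'n \<Rightarrow> complex" where "a \<xi> = of_real (diffusion_symbol \<gamma> T \<tau> \<xi>)" for \<xi>
  define \<Phi> where "\<Phi> = fourier_integral (\<lambda>x. complex_of_real (\<phi> x))"
  define d where "d \<beta> \<xi> = 1 - \<Phi> (\<beta> *\<^sub>R \<xi>)" for \<beta> \<xi>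
  define r where "r \<beta> \<xi> = cnj (a \<xi>) / of_real ((cmod (a \<xi>))\<^sup>2 + (cmod (d \<beta> \<xi>))\<^sup>2)" for \<beta> \<xi>
  have \<phi>c: "integrable lborel (\<lambda>x. complex_of_real (\<phi> x))" using \<phi>_L1 by simp
  have a_pos: "0 < diffusion_symbol \<gamma> T \<tau> \<xi>" for \<xi> :: "real ^ 'n" by (simp add: diffusion_symbol_def)
  have a_cmod: "cmod (a \<xi>) = diffusion_symbol \<gamma> T \<tau> \<xi>" for \<xi> by (simp add: a_def less_imp_le[OF a_pos])
  have a_bs: "bounded_symbol a"
  proof (rule bounded_symbolI[where B = 1])
    show "a \<in> borel_measurable borel" unfolding a_def by measurable
    show "cmod (a \<xi>) \<le> 1" for \<xi>
      unfolding a_cmod by (rule diffusion_symbol_le_1[OF \<gamma>_pos])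
  qed
  have A_eq: "A = fourier_multiplier a"
    unfolding A diffusion_op_eq_multiplier a_def[abs_def] ..
  have d_bs: "bounded_symbol (d \<beta>)" and D_eq: "mollify_defect \<phi> \<beta> = fourier_multiplier (d \<beta>)"
    if "0 < \<beta>" for \<beta>
    using mollify_defect_eq_multiplier[OF \<phi>_L1 that] by (simp_all add: d_def[abs_def] \<Phi>_def)
  have coercive: "\<exists>c>0. \<forall>\<xi>. c \<le> (cmod (a \<xi>))\<^sup>2 + (cmod (d \<beta> \<xi>))\<^sup>2" if \<beta>: "0 < \<beta>" for \<beta>
  proof -
    obtain c where "c > 0" "\<And>\<xi>. c \<le> (diffusion_symbol \<gamma> T \<tau> \<xi>)\<^sup>2 + (cmod (1 - \<Phi> (\<beta> *\<^sub>R \<xi>)))\<^sup>2"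
      by (rule symbol_coercive[where \<gamma> = \<gamma> and T = T and \<tau> = \<tau> and \<beta> = \<beta> and \<Phi> = \<Phi>])
        (use \<gamma>_pos \<tau> \<beta> riemann_lebesgue[OF \<phi>c] in \<open>auto simp: \<Phi>_def\<close>)
    then show ?thesis unfolding a_cmod d_def by blast
  qed
  have r_bs: "bounded_symbol (r \<beta>)" if "0 < \<beta>" for \<beta>
    using coercive[OF that] bounded_symbol_regularizer[OF a_bs d_bs[OF that]]
    unfolding r_def[abs_def] by blast
  \<comment> \<open>Strictness against every competitor yields existence and uniqueness of the
    minimizer at once.\<close>
  have min: "objective A \<phi> \<beta> g (fourier_multiplier (r \<beta>) g) < objective A \<phi> \<beta> g u"
    if \<beta>: "0 < \<beta>" and "u \<noteq> fourier_multiplier (r \<beta>) g" for \<beta> g u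
  proof -
    obtain c where "c > 0" "\<And>\<xi>. c \<le> (cmod (a \<xi>))\<^sup>2 + (cmod (d \<beta> \<xi>))\<^sup>2"
      using coercive[OF \<beta>] by blast
    then show ?thesis
      using strict_minimum_multiplier[OF a_bs d_bs[OF \<beta>], of c u g, folded r_def] that(2)
      unfolding objective_def D_eq[OF \<beta>] A_eq by simp
  qed
  have arg_min_iff: "is_arg_min (objective A \<phi> \<beta> g) (\<lambda>_. True) u \<longleftrightarrow> u = fourier_multiplier (r \<beta>) g"
    if \<beta>: "0 < \<beta>" for \<beta> g u
    using min[OF \<beta>] unfolding is_arg_min_def by (metis less_asym)
  \<comment> \<open>\<open>arg_min\<close> chooses some minimizer; by \<open>arg_min_iff\<close>
    there is only one to choose.\<close>
  have R_eq: "R \<beta> = fourier_multiplier (r \<beta>)" if \<beta>: "0 < \<beta>" for \<beta>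
    by (rule ext) (simp add: R regularized_solution_def arg_min_def arg_min_iff[OF \<beta>])
  have normal: "u = R \<beta> g \<longleftrightarrow>
      adjoint_L2 A (A u) + adjoint_L2 (mollify_defect \<phi> \<beta>) (mollify_defect \<phi> \<beta> u) = adjoint_L2 A g"
    if \<beta>: "0 < \<beta>" for \<beta> g u
  proof -
    obtain c where "c > 0" "\<And>\<xi>. c \<le> (cmod (a \<xi>))\<^sup>2 + (cmod (d \<beta> \<xi>))\<^sup>2"
      using coercive[OF \<beta>] by blast
    then show ?thesis
      using normal_equation_multiplier[OF a_bs d_bs[OF \<beta>], of c u g, folded r_def]
      unfolding R_eq[OF \<beta>] D_eq[OF \<beta>] A_eq
      by (simp only: adjoint_fourier_multiplier a_bs d_bs[OF \<beta>])
  qed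
  have bounded: "bounded_clinear_L2 (R \<beta>)" if "0 < \<beta>" for \<beta>
    unfolding R_eq[OF that] by (rule bounded_clinear_fourier_multiplier[OF r_bs[OF that]])
  \<comment> \<open>The one-sided limit is reduced to sequences, for which dominated convergence is
    stated.\<close>
  have limit: "((\<lambda>\<beta>. R \<beta> (A u)) \<longlongrightarrow> u) (at_right 0)" for u
    unfolding tendsto_at_iff_sequentially
  proof (intro allI impI)
    fix \<beta> :: "nat \<Rightarrow> real"
    assume "\<forall>k. \<beta> k \<in> {0<..} - {0}" and lim: "\<beta> \<longlonglongrightarrow> 0"
    then have \<beta>: "0 < \<beta> k" for k by auto
    have "(\<lambda>k. fourier_multiplier (\<lambda>\<xi>. r (\<beta> k) \<xi> * a \<xi>) u) \<longlonglongrightarrow> u"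
    proof (rule fourier_multiplier_tendsto)
      show "(\<lambda>\<xi>. r (\<beta> k) \<xi> * a \<xi>) \<in> borel_measurable borel" for k
        by (rule bounded_symbol_measurable[OF bounded_symbol_mult[OF r_bs[OF \<beta>] a_bs]])
      have eq: "r (\<beta> k) \<xi> * a \<xi> = of_real ((cmod (a \<xi>))\<^sup>2 / ((cmod (a \<xi>))\<^sup>2 + (cmod (d (\<beta> k) \<xi>))\<^sup>2))" for k \<xi>
        by (simp add: r_def complex_norm_square[of "a \<xi>"] mult.commute del: of_real_power)
      \<comment> \<open>Positivity of the symbol, that is injectivity of \<open>A\<close>, keeps the
        denominator away from 0 in the limit, where the defect disappears.\<close>
      have pos: "0 < (cmod (a \<xi>))\<^sup>2" for \<xi> using a_pos[of \<xi>] by (simp add: a_cmod)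
      show "cmod (r (\<beta> k) \<xi> * a \<xi>) \<le> 1" for k \<xi>
        unfolding eq norm_of_real using pos[of \<xi>] by (simp add: divide_le_eq_1 add_pos_nonneg)
      fix \<xi>
      have "isCont \<Phi> (0 *\<^sub>R \<xi>)"
        using fourier_integral_continuous[OF \<phi>c] by (simp add: \<Phi>_def continuous_on_eq_continuous_at)
      then have "(\<lambda>k. \<Phi> (\<beta> k *\<^sub>R \<xi>)) \<longlonglongrightarrow> \<Phi> (0 *\<^sub>R \<xi>)"
        by (rule isCont_tendsto_compose) (rule tendsto_scaleR[OF lim tendsto_const])
      \<comment> \<open>The unit mass of the kernel enters here.\<close>
      moreover have "\<Phi> (0 *\<^sub>R \<xi>) = 1" 
        using \<phi>_one by (simp add: \<Phi>_def fourier_integral_def)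
      ultimately have "(\<lambda>k. \<Phi> (\<beta> k *\<^sub>R \<xi>)) \<longlonglongrightarrow> 1" by (simp only:)
      then have "(\<lambda>k. (cmod (d (\<beta> k) \<xi>))\<^sup>2) \<longlonglongrightarrow> (cmod (1 - 1))\<^sup>2"
        unfolding d_def by (intro tendsto_power tendsto_norm tendsto_diff tendsto_const)
      then have "(\<lambda>k. (cmod (a \<xi>))\<^sup>2 / ((cmod (a \<xi>))\<^sup>2 + (cmod (d (\<beta> k) \<xi>))\<^sup>2)) 
          \<longlonglongrightarrow> (cmod (a \<xi>))\<^sup>2 / ((cmod (a \<xi>))\<^sup>2 + (cmod (1 - 1))\<^sup>2)"
        by (intro tendsto_divide tendsto_add tendsto_const) (use pos[of \<xi>] in auto)
      then have "(\<lambda>k. r (\<beta> k) \<xi> * a \<xi>) 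
          \<longlonglongrightarrow> of_real ((cmod (a \<xi>))\<^sup>2 / ((cmod (a \<xi>))\<^sup>2 + (cmod (1 - 1))\<^sup>2))"
        unfolding eq by (rule tendsto_of_real)
      then show "(\<lambda>k. r (\<beta> k) \<xi> * a \<xi>) \<longlonglongrightarrow> 1" using pos[of \<xi>] by simp
    qed
    then show "((\<lambda>\<beta>. R \<beta> (A u)) \<circ> \<beta>) \<longlonglongrightarrow> u"
      by (simp add: o_def R_eq[OF \<beta>] A_eq fourier_multiplier_mult r_bs[OF \<beta>] a_bs)
  qed
  show ?thesis
    unfolding regularization_method_def using arg_min_iff normal bounded limit by auto
qed

end
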